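(* Let $(X,\rho,\mu)$ be a space of homogeneous type (with the standing assumptions listed in the context) and $\gamma\in(0,1)$. Then, for any $q\in(1,\infty)$, $$\mathrm{PBMO}^+(X\times\mathbb R)=\{-\xi\log\omega:\ \omega\in A_q^+(\gamma),\ \xi\in(0,\infty)\}$$ and $$\mathrm{PBMO}^-(X\times\mathbb R)=\{-\xi\log\omega:\ \omega\in A_q^-(\gamma),\ \xi\in(0,\infty)\}.$$
   Context: Setting. $(X,\rho)$ is a quasi-metric space: $\rho:X\times X\to[0,\infty)$, $\rho(x,y)=0$ iff $x=y$, $\rho(x,y)=\rho(y,x)$, and $\rho(x,y)\le K_0[\rho(x,z)+\rho(z,y)]$ for all $x,y,z\in X$, with a constant $K_0\in[1,\infty)$. Balls are $B(x,r)=\{y\in X:\rho(x,y)<r\}$. $\mu$ is a nonnegative measure on a $\sigma$-algebra containing the balls which is doubling: $\mu(B(x,2r))\le C_\mu\mu(B(x,r))$ for all $x\in X$, $r\in(0,\infty)$; then $(X,\rho,\mu)$ is called a space of homogeneous type. Standing assumptions: (a) for each $x$ the balls $\{B(x,r)\}_{r>0}$ form a basis of open neighborhoods of $x$; (b) $\mu$ is Borel regular (open sets are measurable and every $A\subset X$ lies in a Borel set $E$ with $\mu(A)=\mu(E)$); (c) $0<\mu(B(x,r))<\infty$ for all balls; (d) $\operatorname{diam}(X)=\infty$ and $\mu(\{x\})=0$ for all $x$; (e) monotone geodesic property: there is a constant $\widetilde K>0$ such that for all $s\in(0,\infty)$ and $x,y\in X$ with $\rho(x,y)\ge s$ there are $m\in\mathbb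 N$ and points $x_0=x,x_1,\dots,x_m=y$ with $\rho(x_i,x_{i+1})\le\widetilde K s$ and $\rho(x_{i+1},x_m)\le\rho(x_i,x_m)-s$ for $i=0,\dots,m-1$. Fix $p\in(1,\infty)$. $X\times\mathbb R$ carries the quasi-metric $d((x,t),(y,s))=\max\{\rho(x,y),|t-s|^{1/p}\}$ and the product measure $\lambda=\mu\times m$, $m$ being Lebesgue measure on $\mathbb R$; the same basic assumptions (a)-(d) are made for $(X\times\mathbb R,d,\lambda)$. All integrals are with respect to $\lambda$, and $⨍_E f:=\frac1{\lambda(E)}\int_E f$ denotes the average. For $r\in\mathbb R$, $r_+=\max\{0,r\}$. Parabolic cylinders. For $x\in X$, $t\in\mathbb R$, $l\in(0,\infty)$, $\gamma\in[0,1)$ put $R=R(x,t,l)=B(x,l)\times(t-l^p,t+l^p)$, $R^-(\gamma)=B(x,l)\times(t-l^p,t-\gamma l^p)$, $R^+(\gamma)=B(x,l)\times(t+\gamma l^p,t+l^p)$. Weights. A weight is a real-valued, $\lambda$-almost everywhere positive, locally integrable function on $X\times\mathbb R$ (integrable on some cylinder $R(x,t,r)$ around each point). For $q\in(1,\infty)$, with $1/q+1/q'=1$, and $\gamma\in[0,1)$, a weight $\omega$ belongs to $A^+_q(\gamma)$ if $\sup_{R}\left[⨍_{R^-(\gamma)}\omega\right]\left[⨍_{R^+(\gamma)}\omega^{1-q'}\right]^{q-1}<\infty$, and to $A^-_q(\gamma)$ if $\sup_{R}\left[⨍_{R^+(\gamma)}\omega\right]\left[⨍_{R^-(\gamma)}\omega^{1-q'}\right]^{q-1}<\infty$,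 the suprema being over all parabolic cylinders $R(x,t,l)$. Parabolic BMO. $\mathrm{PBMO}^+(X\times\mathbb R)$ is the set of all (real-valued) $u\in L^1_{\rm loc}(X\times\mathbb R)$ for which there exist $\gamma\in(0,1)$ and constants $a_R\in\mathbb R$ (which may depend on the cylinder $R$) with $\sup_R\left[⨍_{R^+(\gamma)}(u-a_R)_+ + ⨍_{R^-(\gamma)}(a_R-u)_+\right]<\infty$, the supremum being over all parabolic cylinders $R=R(x,t,l)$. $\mathrm{PBMO}^-(X\times\mathbb R)$ is the set of all such $u$ for which there exist $\gamma\in(0,1)$ and constants $b_R\in\mathbb R$ with $\sup_R\left[⨍_{R^-(\gamma)}(u-b_R)_+ + ⨍_{R^+(\gamma)}(b_R-u)_+\right]<\infty$. Functions are identified when equal $\lambda$-almost everywhere. *)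

theory Defs
  imports "HOL-Analysis.Analysis"
begin

section \<open>Quasi-metric spaces and spaces of homogeneous type\<close>

definition qball :: "('a \<Rightarrow> 'a \<Rightarrow> real) \<Rightarrow> 'a \<Rightarrow> real \<Rightarrow> 'a set"
  where "qball \<rho> x r = {y. \<rho> x y < r}"

text \<open>The topology induced by a quasi-metric. Balls need not be open in it, but it is the only
  topology for which the balls around each point can be a basis of neighbourhoods of that point.\<close>

definition qopen :: "('a \<Rightarrow> 'a \<Rightarrow> real) \<Rightarrow> 'a set \<Rightarrow> bool"
  where "qopen \<rho> U \<longleftrightarrow> (\<forall>x\<in>U. \<exists>r>0. qball \<rho> x r \<subseteq> U)"

definition qborel :: "('a \<Rightarrow> 'a \<Rightarrow> real) \<Rightarrow> 'a set set"
  where "qborel \<rho> = sigma_sets UNIV {U. qopen \<rho> U}"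

locale quasi_metric =
  fixes \<rho> :: "'a \<Rightarrow> 'a \<Rightarrow> real"
  assumes nonneg: "0 \<le> \<rho> x y"
    and eq_0_iff: "\<rho> x y = 0 \<longleftrightarrow> x = y"
    and sym: "\<rho> x y = \<rho> y x"
    and quasi_triangle: "\<exists>K0\<ge>1. \<forall>x y z. \<rho> x y \<le> K0 * (\<rho> x z + \<rho> z y)"

locale homogeneous_type = quasi_metric \<rho>
  for \<rho> :: "'a \<Rightarrow> 'a \<Rightarrow> real" +
  fixes \<mu> :: "'a measure"
  assumes space_eq: "space \<mu> = UNIV"
    and ball_measurable: "0 < r \<Longrightarrow> qball \<rho> x r \<in> sets \<mu>"
    and doubling: "\<exists>C::real. \<forall>x. \<forall>r>0.
      emeasure \<mu> (qball \<rho> x (2 * r)) \<le> ennreal C * emeasure \<mu> (qball \<rho> x r)"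

text \<open>The basic assumptions on a quasi-metric \<open>\<rho>\<close> and a measure \<open>\<mu>\<close>. In \<open>borel_regular\<close> the set
  \<open>A\<close> is arbitrary, so its measure is the outer measure induced by \<open>\<mu>\<close>.\<close>

locale basic_assumptions =
  fixes \<rho> :: "'a \<Rightarrow> 'a \<Rightarrow> real" and \<mu> :: "'a measure"
  assumes ball_open: "0 < r \<Longrightarrow> qopen \<rho> (qball \<rho> x r)"
    and open_measurable: "qopen \<rho> U \<Longrightarrow> U \<in> sets \<mu>"
    and borel_regular: "\<exists>E\<in>qborel \<rho>. A \<subseteq> E \<and> outer_measure_of \<mu> A = emeasure \<mu> E"
    and ball_pos: "0 < r \<Longrightarrow> 0 < emeasure \<mu> (qball \<rho> x r)"
    and ball_finite: "0 < r \<Longrightarrow> emeasure \<mu> (qball \<rho> x r) < \<infinity>"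
    and diam_infinite: "(SUP z. ereal (\<rho> (fst z) (snd z))) = \<infinity>"
    and point_null: "{x} \<in> null_sets \<mu>"

definition monotone_geodesic :: "('a \<Rightarrow> 'a \<Rightarrow> real) \<Rightarrow> bool"
  where "monotone_geodesic \<rho> \<longleftrightarrow>
    (\<exists>K>0. \<forall>s>0. \<forall>x y. s \<le> \<rho> x y \<longrightarrow>
      (\<exists>(m::nat) (c :: nat \<Rightarrow> 'a). c 0 = x \<and> c m = y \<and>
        (\<forall>i<m. \<rho> (c i) (c (Suc i)) \<le> K * s \<and> \<rho> (c (Suc i)) (c m) \<le> \<rho> (c i) (c m) - s)))"


section \<open>The product with the time axis and parabolic cylinders\<close>

definition parabolic_dist ::
    "('a \<Rightarrow> 'a \<Rightarrow> real) \<Rightarrow> real \<Rightarrow> 'a \<times> real \<Rightarrow> 'a \<times> real \<Rightarrow> real"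
  where "parabolic_dist \<rho> p z w = max (\<rho> (fst z) (fst w)) (\<bar>snd z - snd w\<bar> powr (1 / p))"

definition time_product :: "'a measure \<Rightarrow> ('a \<times> real) measure"
  where "time_product \<mu> = \<mu> \<Otimes>\<^sub>M lebesgue"

definition cylinder ::
    "('a \<Rightarrow> 'a \<Rightarrow> real) \<Rightarrow> real \<Rightarrow> 'a \<Rightarrow> real \<Rightarrow> real \<Rightarrow> ('a \<times> real) set"
  where "cylinder \<rho> p x t l = qball \<rho> x l \<times> {t - l powr p <..< t + l powr p}"

definition cylinder_minus ::
    "('a \<Rightarrow> 'a \<Rightarrow> real) \<Rightarrow> real \<Rightarrow> real \<Rightarrow> 'a \<Rightarrow> real \<Rightarrow> real \<Rightarrow> ('a \<times> real) set"
  where "cylinder_minus \<rho> p \<gamma> x t l = qball \<rho> x l \<times> {t - l powr p <..< t - \<gamma> * l powr p}"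

definition cylinder_plus ::
    "('a \<Rightarrow> 'a \<Rightarrow> real) \<Rightarrow> real \<Rightarrow> real \<Rightarrow> 'a \<Rightarrow> real \<Rightarrow> real \<Rightarrow> ('a \<times> real) set"
  where "cylinder_plus \<rho> p \<gamma> x t l = qball \<rho> x l \<times> {t + \<gamma> * l powr p <..< t + l powr p}"

definition locally_integrable ::
    "('a \<Rightarrow> 'a \<Rightarrow> real) \<Rightarrow> 'a measure \<Rightarrow> real \<Rightarrow> ('a \<times> real \<Rightarrow> real) \<Rightarrow> bool"
  where "locally_integrable \<rho> \<mu> p u \<longleftrightarrow>
    u \<in> borel_measurable (time_product \<mu>) \<and>
    (\<forall>x t. \<exists>r>0. set_integrable (time_product \<mu>) (cylinder \<rho> p x t r) u)"

text \<open>Averages are only needed for nonnegative functions. They take values in \<open>[0,\<infinity>]\<close>, so that a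
  nonintegrable function has average \<open>\<infinity>\<close> and not the default value \<open>0\<close> of the Bochner integral;
  negative values are truncated to \<open>0\<close> by \<open>ennreal\<close>.\<close>

definition average :: "'b measure \<Rightarrow> 'b set \<Rightarrow> ('b \<Rightarrow> real) \<Rightarrow> ennreal"
  where "average M E f = (\<integral>\<^sup>+z\<in>E. ennreal (f z) \<partial>M) / emeasure M E"

text \<open>Powers of elements of \<open>[0,\<infinity>]\<close>, meant for exponents \<open>a > 0\<close>.\<close>

definition ennreal_pow :: "ennreal \<Rightarrow> real \<Rightarrow> ennreal"
  where "ennreal_pow c a = (if c = \<infinity> then \<infinity> else ennreal (enn2real c powr a))"


section \<open>Weights\<close>

definition weight :: "('a \<Rightarrow> 'a \<Rightarrow> real) \<Rightarrow> 'a measure \<Rightarrow> real \<Rightarrow> ('a \<times> real \<Rightarrow> real) \<Rightarrow> bool"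
  where "weight \<rho> \<mu> p \<omega> \<longleftrightarrow>
    locally_integrable \<rho> \<mu> p \<omega> \<and> (AE z in time_product \<mu>. 0 < \<omega> z)"

definition conj_exponent :: "real \<Rightarrow> real"
  where "conj_exponent q = q / (q - 1)"

lemma conj_exponent: "1 < q \<Longrightarrow> 1 / q + 1 / conj_exponent q = 1"
  by (simp add: conj_exponent_def field_simps)

text \<open>There is no indeterminate product \<open>0 \<cdot> \<infinity>\<close> in the suprema below: a weight is positive almost
  everywhere, so both averages are positive.\<close>

definition A_plus ::
    "('a \<Rightarrow> 'a \<Rightarrow> real) \<Rightarrow> 'a measure \<Rightarrow> real \<Rightarrow> real \<Rightarrow> real \<Rightarrow> ('a \<times> real \<Rightarrow> real) set"
  where "A_plus \<rho> \<mu> p q \<gamma> = {\<omega>. weight \<rho> \<mu> p \<omega> \<and>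
    (SUP (x, t, l) \<in> UNIV \<times> UNIV \<times> {0<..}.
       average (time_product \<mu>) (cylinder_minus \<rho> p \<gamma> x t l) \<omega> *
       ennreal_pow (average (time_product \<mu>) (cylinder_plus \<rho> p \<gamma> x t l)
                      (\<lambda>z. \<omega> z powr (1 - conj_exponent q))) (q - 1)) < \<infinity>}"

definition A_minus ::
    "('a \<Rightarrow> 'a \<Rightarrow> real) \<Rightarrow> 'a measure \<Rightarrow> real \<Rightarrow> real \<Rightarrow> real \<Rightarrow> ('a \<times> real \<Rightarrow> real) set"
  where "A_minus \<rho> \<mu> p q \<gamma> = {\<omega>. weight \<rho> \<mu> p \<omega> \<and>
    (SUP (x, t, l) \<in> UNIV \<times> UNIV \<times> {0<..}.
       average (time_product \<mu>) (cylinder_plus \<rho> p \<gamma> x t l) \<omega> *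
       ennreal_pow (average (time_product \<mu>) (cylinder_minus \<rho> p \<gamma> x t l)
                      (\<lambda>z. \<omega> z powr (1 - conj_exponent q))) (q - 1)) < \<infinity>}"


section \<open>Parabolic BMO\<close>

text \<open>The constant attached to a cylinder is a function of its parameters \<open>(x, t, l)\<close>.\<close>

definition PBMO_plus ::
    "('a \<Rightarrow> 'a \<Rightarrow> real) \<Rightarrow> 'a measure \<Rightarrow> real \<Rightarrow> ('a \<times> real \<Rightarrow> real) set"
  where "PBMO_plus \<rho> \<mu> p = {u. locally_integrable \<rho> \<mu> p u \<and>
    (\<exists>\<gamma>. 0 < \<gamma> \<and> \<gamma> < 1 \<and> (\<exists>a :: 'a \<Rightarrow> real \<Rightarrow> real \<Rightarrow> real.
      (SUP (x, t, l) \<in> UNIV \<times> UNIV \<times> {0<..}.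
         average (time_product \<mu>) (cylinder_plus \<rho> p \<gamma> x t l) (\<lambda>z. max 0 (u z - a x t l)) +
         average (time_product \<mu>) (cylinder_minus \<rho> p \<gamma> x t l) (\<lambda>z. max 0 (a x t l - u z)))
      < \<infinity>))}"

definition PBMO_minus ::
    "('a \<Rightarrow> 'a \<Rightarrow> real) \<Rightarrow> 'a measure \<Rightarrow> real \<Rightarrow> ('a \<times> real \<Rightarrow> real) set"
  where "PBMO_minus \<rho> \<mu> p = {u. locally_integrable \<rho> \<mu> p u \<and>
    (\<exists>\<gamma>. 0 < \<gamma> \<and> \<gamma> < 1 \<and> (\<exists>b :: 'a \<Rightarrow> real \<Rightarrow> real \<Rightarrow> real.
      (SUP (x, t, l) \<in> UNIV \<times> UNIV \<times> {0<..}.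
         average (time_product \<mu>) (cylinder_minus \<rho> p \<gamma> x t l) (\<lambda>z. max 0 (u z - b x t l)) +
         average (time_product \<mu>) (cylinder_plus \<rho> p \<gamma> x t l) (\<lambda>z. max 0 (b x t l - u z)))
      < \<infinity>))}"

text \<open>The class of a function modulo equality almost everywhere.\<close>

definition ae_class :: "'b measure \<Rightarrow> ('b \<Rightarrow> real) \<Rightarrow> ('b \<Rightarrow> real) set"
  where "ae_class M u = {v \<in> borel_measurable M. AE z in M. v z = u z}"

end

theory Submission
  imports Defs
begin

text \<open>If \<open>\<omega>\<close> is a weight in the class, then \<open>a\<^sub>R = -\<xi> log (average of \<omega>)\<close> over the half of \<open>R\<close> in
  which \<open>\<omega>\<close> is averaged shows that \<open>-\<xi> log \<omega>\<close> has parabolic bounded mean oscillation, because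
  \<open>log y \<le> y\<close>.

  The converse is a John--Nirenberg inequality. With \<open>\<gamma>\<^sub>0\<close> the lag given for \<open>u\<close>, a Calderon--Zygmund
  stopping time for the constants \<open>a\<^sub>R\<close> on shrinking cylinders, with the Vitali covering lemma and
  Lebesgue density, gives exponential integrability of \<open>(u - a\<^sub>R)\<^sub>+\<close> on a small box inside the half of
  \<open>R\<close> on which \<open>u\<close> is bounded above. To pass to the lag \<open>\<gamma>\<close> and to the whole half, cover it by
  such boxes of size \<open>\<theta> l\<close> and compare their constants with a single one attached to the centre
  of \<open>R\<close>: the constants almost decrease from a cylinder to an overlapping later one, and a
  monotone geodesic chain of small cylinders needs little time because \<open>p > 1\<close>. The other half follows
  by applying this to \<open>-u\<close>.\<close>

section \<open>Covering and regularity\<close>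

text \<open>The \<open>A_q\<close> product pairs a mean of \<open>\<omega>\<close> over one half of
  a cylinder with a mean of a negative power over the other, so the exponential estimates on the two
  halves must refer to the same constant \<open>c\<close>; only then do the factors
  \<open>exp c\<close> and \<open>exp (-c)\<close> cancel. For this reason the chain argument works
  for every small \<open>\<theta>\<close> and for an interval of reference times: the estimates for
  \<open>u\<close> and for \<open>-u\<close> can then be run with one \<open>\<theta>\<close> and
  moved onto one constant.

  The stopping rule looks at the constants and not at means of \<open>u\<close>, because on each
  half \<open>u\<close> is controlled from one side only. A large constant says that
  \<open>u\<close> is large on the opposite half, away from the points to be covered. Hence the
  selected boxes contain both halves: mass is counted on the opposite halves, which must be
  disjoint, while the points are covered by enlarged boxes around the centres. Stopping boxes
  centred near the edge of the given half would protrude from it, so decay is first obtained on a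
  box of relative size \<open>\<delta>\<close>; covering a half by such boxes makes up for this
  loss.\<close>

lemma vitali_selection:
  fixes S :: "'i \<Rightarrow> 'b set" and lev :: "'i \<Rightarrow> nat"
  assumes ne: "\<And>i. i \<in> I \<Longrightarrow> S i \<noteq> {}"
  obtains J where "J \<subseteq> I" "disjoint_family_on S J"
    "\<And>i. i \<in> I \<Longrightarrow> \<exists>j\<in>J. S i \<inter> S j \<noteq> {} \<and> lev j \<le> lev i"
proof -
  \<comment> \<open>The last clause is the one that survives both unions of chains and the extension
    below: whatever meets the family meets a member of level at most its own.\<close>
  define \<Omega> where "\<Omega> = {G. G \<subseteq> I \<and> disjoint_family_on S G \<and>
    (\<forall>i\<in>I. \<forall>g\<in>G. S i \<inter> S g \<noteq> {} \<longrightarrow> (\<exists>j\<in>G. S i \<inter> S j \<noteq> {} \<and> lev j \<le> lev i))}"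
  have "\<Union>\<C> \<in> \<Omega>" if \<C>: "subset.chain \<Omega> \<C>" for \<C>
  proof -
    have sub: "\<C> \<subseteq> \<Omega>" and tot: "\<And>A B. A \<in> \<C> \<Longrightarrow> B \<in> \<C> \<Longrightarrow> A \<subseteq> B \<or> B \<subseteq> A"
      using \<C> by (auto simp: subset_chain_def)
    have "disjoint_family_on S (\<Union>\<C>)"
      unfolding disjoint_family_on_def
    proof (intro ballI impI)
      fix m n assume mn: "m \<in> \<Union>\<C>" "n \<in> \<Union>\<C>" "m \<noteq> n"
      then obtain A B where AB: "A \<in> \<C>" "B \<in> \<C>" "m \<in> A" "n \<in> B" by blast
      then obtain C where "C \<in> \<C>" "m \<in> C" "n \<in> C" using tot by blast
      then have "disjoint_family_on S C" using sub by (auto simp: \<Omega>_def)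
      then show "S m \<inter> S n = {}" using \<open>m \<in> C\<close> \<open>n \<in> C\<close> mn(3)
        by (auto simp: disjoint_family_on_def)
    qed
    moreover have "\<exists>j\<in>\<Union>\<C>. S i \<inter> S j \<noteq> {} \<and> lev j \<le> lev i"
      if "i \<in> I" "g \<in> \<Union>\<C>" "S i \<inter> S g \<noteq> {}" for i g
    proof -
      from that obtain A where A: "A \<in> \<C>" "g \<in> A" by blast
      then have "A \<in> \<Omega>" using sub by blast
      then have "\<exists>j\<in>A. S i \<inter> S j \<noteq> {} \<and> lev j \<le> lev i"
        using that A by (auto simp: \<Omega>_def)
      then show ?thesis using A by blast
    qed
    moreover have "\<Union>\<C> \<subseteq> I" using sub by (auto simp: \<Omega>_def)
    ultimately show ?thesis by (auto simp: \<Omega>_def)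
  qed
  then obtain G where G: "G \<in> \<Omega>" and max: "\<And>X. X \<in> \<Omega> \<Longrightarrow> G \<subseteq> X \<Longrightarrow> X = G"
    using subset_Zorn'[of \<Omega>] by blast
  have G_prop: "G \<subseteq> I" "disjoint_family_on S G"
    "\<And>i g. i \<in> I \<Longrightarrow> g \<in> G \<Longrightarrow> S i \<inter> S g \<noteq> {} \<Longrightarrow> \<exists>j\<in>G. S i \<inter> S j \<noteq> {} \<and> lev j \<le> lev i"
    using G by (auto simp: \<Omega>_def)
  have meets: "\<exists>g\<in>G. S i \<inter> S g \<noteq> {}" if "i \<in> I" for i
  proof (rule ccontr)
    assume no: "\<not> ?thesis"
    \<comment> \<open>If some set missed the maximal family, one of least level could be added. An
      index that meets the family only through the new member itself missed the old family, so its
      level is not smaller.\<close>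
    define P where "P k \<longleftrightarrow> k \<in> I \<and> (\<forall>g\<in>G. S k \<inter> S g = {})" for k
    have "P i" using no that by (auto simp: P_def)
    then obtain k where k: "P k" and least: "\<And>k'. P k' \<Longrightarrow> lev k \<le> lev k'"
      using ex_has_least_nat[of P i lev] by blast
    have "insert k G \<in> \<Omega>"
    proof -
      have "\<exists>j\<in>insert k G. S i \<inter> S j \<noteq> {} \<and> lev j \<le> lev i"
        if "i \<in> I" "g \<in> insert k G" "S i \<inter> S g \<noteq> {}" for i g
      proof (cases "\<exists>g\<in>G. S i \<inter> S g \<noteq> {}")
        case True
        then show ?thesis using G_prop(3) \<open>i \<in> I\<close> by blast
      next
        case False
        then have "P i" using \<open>i \<in> I\<close> by (auto simp: P_def)
        then show ?thesis using least[of i] that False by auto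
      qed
      moreover have "disjoint_family_on S (insert k G)"
        using G_prop(2) k by (auto simp: disjoint_family_on_def P_def)
      ultimately show ?thesis using G_prop(1) k by (auto simp: \<Omega>_def P_def)
    qed
    then have "k \<in> G" using max[of "insert k G"] by blast
    then show False using k ne[of k] by (auto simp: P_def)
  qed
  show thesis
    using that[of G] G_prop meets by blast
qed

text \<open>Finite disjoint subfamilies have total measure at most that of \<open>W\<close>, so the
  measures are summable and only countably many are nonzero.\<close>

lemma countable_disjoint_positive:
  assumes disj: "disjoint_family_on S J"
    and meas: "\<And>i. i \<in> J \<Longrightarrow> S i \<in> sets M" and pos: "\<And>i. i \<in> J \<Longrightarrow> 0 < emeasure M (S i)"
    and sub: "\<And>i. i \<in> J \<Longrightarrow> S i \<subseteq> W" and W: "W \<in> sets M" "emeasure M W < \<infinity>"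
  shows "countable J"
proof -
  have fin: "emeasure M (S i) < \<infinity>" if "i \<in> J" for i
    using emeasure_mono[OF sub[OF that] W(1)] W(2) by (meson le_less_trans)
  have "(\<lambda>i. measure M (S i)) summable_on J"
  proof (rule nonneg_bdd_above_summable_on)
    show "bdd_above (sum (\<lambda>i. measure M (S i)) ` {F. F \<subseteq> J \<and> finite F})"
    proof (rule bdd_aboveI2)
      fix F assume F: "F \<in> {F. F \<subseteq> J \<and> finite F}"
      have "(\<Sum>i\<in>F. measure M (S i)) = measure M (\<Union>i\<in>F. S i)"
      proof (rule measure_finite_Union[symmetric])
        show "disjoint_family_on S F"
          using F disj by (auto simp: disjoint_family_on_def)
      qed (use F meas fin in \<open>auto simp: less_top\<close>)
      also have "\<dots> \<le> measure M W"
        by (rule measure_mono_fmeasurable)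
          (use F meas sub W in \<open>auto simp: fmeasurable_def intro!: sets.finite_UN\<close>)
      finally show "(\<Sum>i\<in>F. measure M (S i)) \<le> measure M W" .
    qed
  qed simp
  then have "countable {i \<in> J. measure M (S i) \<noteq> 0}"
    by (rule summable_countable_real)
  moreover have "measure M (S i) \<noteq> 0" if "i \<in> J" for i
    using pos[OF that] fin[OF that] by (metis emeasure_eq_ennreal_measure ennreal_0 less_irrefl infinity_ennreal_def)
  ultimately show ?thesis by (metis (mono_tags, lifting) Collect_cong Collect_mem_eq)
qed

text \<open>In the applications \<open>lev\<close> is a dyadic scale index or constant; a small
  level means a large set. Since levels are natural numbers, a least one is attained, and the usual
  factor for almost maximal radii does not arise.\<close>

lemma vitali_covering:
  fixes S :: "'i \<Rightarrow> 'b set" and lev :: "'i \<Rightarrow> nat"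
  assumes meas: "\<And>i. i \<in> I \<Longrightarrow> S i \<in> sets M" and pos: "\<And>i. i \<in> I \<Longrightarrow> 0 < emeasure M (S i)"
    and sub: "\<And>i. i \<in> I \<Longrightarrow> S i \<subseteq> W" and W: "W \<in> sets M" "emeasure M W < \<infinity>"
  obtains J where "J \<subseteq> I" "countable J" "disjoint_family_on S J"
    "\<And>i. i \<in> I \<Longrightarrow> \<exists>j\<in>J. S i \<inter> S j \<noteq> {} \<and> lev j \<le> lev i"
proof -
  have "S i \<noteq> {}" if "i \<in> I" for i
    using pos[OF that] by auto
  then obtain J where J: "J \<subseteq> I" "disjoint_family_on S J"
    "\<And>i. i \<in> I \<Longrightarrow> \<exists>j\<in>J. S i \<inter> S j \<noteq> {} \<and> lev j \<le> lev i"
    using vitali_selection[of I S lev] by blast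
  moreover have "countable J"
    by (rule countable_disjoint_positive[OF J(2), of M W]) (use meas pos sub W J(1) in auto)
  ultimately show thesis using that by blast
qed

section \<open>Countable families: sums over the indices as integrals over a counting
  measure\<close>

lemma nn_integral_UN_le:
  assumes cnt: "countable J" and meas: "\<And>i. i \<in> J \<Longrightarrow> S i \<in> sets M" and f: "f \<in> borel_measurable M"
    and sub: "A \<subseteq> (\<Union>i\<in>J. S i)"
  shows "(\<integral>\<^sup>+x\<in>A. f x \<partial>M) \<le> (\<integral>\<^sup>+i. (\<integral>\<^sup>+x\<in>S i. f x \<partial>M) \<partial>count_space J)"
proof -
  have "(\<integral>\<^sup>+x\<in>A. f x \<partial>M) \<le> (\<integral>\<^sup>+x. (\<integral>\<^sup>+i. f x * indicator (S i) x \<partial>count_space J) \<partial>M)"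
  proof (rule nn_integral_mono)
    fix x
    show "f x * indicator A x \<le> (\<integral>\<^sup>+i. f x * indicator (S i) x \<partial>count_space J)"
    proof (cases "x \<in> A")
      case True
      then obtain i where "i \<in> J" "x \<in> S i" using sub by blast
      then show ?thesis
        using nn_integral_ge_point[of i J "\<lambda>i. f x * indicator (S i) x"] True by simp
    qed simp
  qed
  also have "\<dots> = (\<integral>\<^sup>+i. (\<integral>\<^sup>+x\<in>S i. f x \<partial>M) \<partial>count_space J)"
    by (intro nn_integral_count_space_nn_integral cnt) (use meas f in measurable)
  finally show ?thesis .
qed

lemma emeasure_UN_le:
  assumes "countable J" and "\<And>i. i \<in> J \<Longrightarrow> S i \<in> sets M" and "A \<subseteq> (\<Union>i\<in>J. S i)"
  shows "emeasure M A \<le> (\<integral>\<^sup>+i. emeasure M (S i) \<partial>count_space J)"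
proof (cases "A \<in> sets M")
  case True
  then have "emeasure M A = (\<integral>\<^sup>+x\<in>A. 1 \<partial>M)" by simp
  also have "\<dots> \<le> (\<integral>\<^sup>+i. (\<integral>\<^sup>+x\<in>S i. 1 \<partial>M) \<partial>count_space J)"
    by (rule nn_integral_UN_le) (use assms in auto)
  also have "\<dots> = (\<integral>\<^sup>+i. emeasure M (S i) \<partial>count_space J)"
    by (rule nn_integral_cong) (use assms in auto)
  finally show ?thesis .
qed (simp add: emeasure_notin_sets)

lemma nn_integral_disjoint_le:
  assumes cnt: "countable J" and meas: "\<And>i. i \<in> J \<Longrightarrow> S i \<in> sets M" and f: "f \<in> borel_measurable M"
    and sub: "\<And>i. i \<in> J \<Longrightarrow> S i \<subseteq> W" and disj: "disjoint_family_on S J"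
  shows "(\<integral>\<^sup>+i. (\<integral>\<^sup>+x\<in>S i. f x \<partial>M) \<partial>count_space J) \<le> (\<integral>\<^sup>+x\<in>W. f x \<partial>M)"
proof -
  have "(\<integral>\<^sup>+i. (\<integral>\<^sup>+x\<in>S i. f x \<partial>M) \<partial>count_space J) =
      (\<integral>\<^sup>+i. emeasure (density M f) (S i) \<partial>count_space J)"
    by (rule nn_integral_cong) (use meas f in \<open>auto simp: emeasure_density\<close>)
  also have "\<dots> = emeasure (density M f) (\<Union>i\<in>J. S i)"
    by (rule emeasure_UN_countable[symmetric]) (use meas cnt disj in auto)
  also have "\<dots> = (\<integral>\<^sup>+x\<in>(\<Union>i\<in>J. S i). f x \<partial>M)"
    by (rule emeasure_density) (use f meas cnt in auto)
  also have "\<dots> \<le> (\<integral>\<^sup>+x\<in>W. f x \<partial>M)"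
    by (rule nn_integral_mono) (use sub in \<open>auto split: split_indicator\<close>)
  finally show ?thesis .
qed

lemma emeasure_disjoint_le:
  assumes "countable J" and "\<And>i. i \<in> J \<Longrightarrow> S i \<in> sets M" and "W \<in> sets M"
    and "\<And>i. i \<in> J \<Longrightarrow> S i \<subseteq> W" and "disjoint_family_on S J"
  shows "(\<integral>\<^sup>+i. emeasure M (S i) \<partial>count_space J) \<le> emeasure M W"
proof -
  have "(\<integral>\<^sup>+i. emeasure M (S i) \<partial>count_space J) = emeasure M (\<Union>i\<in>J. S i)"
    by (rule emeasure_UN_countable[symmetric]) (use assms in auto)
  also have "\<dots> \<le> emeasure M W"
    by (rule emeasure_mono) (use assms in auto)
  finally show ?thesis .
qed

section \<open>Open sets of a quasi-metric and outer regularity\<close>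

lemma qopen_Union: "(\<And>U. U \<in> \<U> \<Longrightarrow> qopen d U) \<Longrightarrow> qopen d (\<Union>\<U>)"
  unfolding qopen_def by (meson Union_iff Union_upper order_trans)

lemma qopen_Int: "qopen d U \<Longrightarrow> qopen d V \<Longrightarrow> qopen d (U \<inter> V)"
  unfolding qopen_def
proof (intro ballI)
  fix x assume "\<forall>x\<in>U. \<exists>r>0. qball d x r \<subseteq> U" "\<forall>x\<in>V. \<exists>r>0. qball d x r \<subseteq> V" "x \<in> U \<inter> V"
  then obtain r s where "r > 0" "s > 0" "qball d x r \<subseteq> U" "qball d x s \<subseteq> V" by blast
  then show "\<exists>r>0. qball d x r \<subseteq> U \<inter> V"
    by (intro exI[of _ "min r s"]) (auto simp: qball_def subset_iff)
qed

lemma qopen_Inter_finite: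
  assumes "finite I" "\<And>i. i \<in> I \<Longrightarrow> qopen d (V i)"
  shows "qopen d (\<Inter>i\<in>I. V i)"
  using assms
proof (induction I)
  case empty
  have "\<exists>r>0. qball d x r \<subseteq> UNIV" for x by (rule exI[of _ 1]) simp
  then show ?case by (simp add: qopen_def)
next
  case (insert i I)
  then show ?case by (simp add: qopen_Int)
qed

text \<open>Approximating \<open>A\<close> and its complement at once makes the complement step
  trivial. The overlap of \<open>U\<close> and \<open>V\<close> contains \<open>U - A\<close>, so
  its measure bounds the error; cutting down to \<open>B\<close> of finite measure permits
  continuity from above.\<close>

lemma qborel_outer_regular:
  fixes d :: "'b \<Rightarrow> 'b \<Rightarrow> real"
  assumes basic: "basic_assumptions d M"
    and sym: "\<And>x y. d x y = d y x" and refl: "\<And>x. d x x = 0"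
    and B: "B \<in> sets M" "emeasure M B < \<infinity>" and A: "A \<in> qborel d" and "0 < e"
  shows "\<exists>U V. qopen d U \<and> qopen d V \<and> A \<subseteq> U \<and> - A \<subseteq> V \<and> emeasure M (B \<inter> U \<inter> V) < ennreal e"
proof -
  interpret basic_assumptions d M by fact
  have small: "\<exists>n. emeasure M (T n) < ennreal e"
    if "\<And>n. T n \<in> sets M" "decseq T" "(\<Inter>n. T n) = {}" "\<And>n. T n \<subseteq> B" "0 < e"
    for T :: "nat \<Rightarrow> 'b set" and e :: real
  proof -
    have "emeasure M (T n) \<noteq> \<infinity>" for n
      using emeasure_mono[OF that(4) B(1), of n] B(2) by (auto simp: top_unique)
    then have "(\<lambda>n. emeasure M (T n)) \<longlonglongrightarrow> emeasure M (\<Inter>n. T n)"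
      using that(1,2) by (intro Lim_emeasure_decseq) auto
    then have "eventually (\<lambda>n. emeasure M (T n) < ennreal e) sequentially"
      using that(3,5) by (intro order_tendstoD(2)[where y = 0]) auto
    then show ?thesis by (auto simp: eventually_sequentially)
  qed
  show ?thesis
    using A \<open>0 < e\<close> unfolding qborel_def
  proof (induction A arbitrary: e rule: sigma_sets.induct)
    case (Basic U)
    then have U: "qopen d U" by simp
    \<comment> \<open>Shrinking open neighbourhoods of \<open>-U\<close>. A point of
      \<open>U\<close> lying in all of them would have points of \<open>-U\<close> arbitrarily
      close, against openness of \<open>U\<close>.\<close>
    define V where "V n = (\<Union>w\<in>-U. qball d w (1 / real (Suc n)))" for n
    have V: "qopen d (V n)" for n
      unfolding V_def by (intro qopen_Union) (auto intro!: ball_open)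
    have decV: "V n \<subseteq> V m" if "m \<le> n" for m n
    proof -
      have "1 / real (Suc n) \<le> 1 / real (Suc m)"
        using that by (intro divide_left_mono) auto
      then show ?thesis
        unfolding V_def qball_def by (auto intro: order_less_le_trans)
    qed
    have "(\<Inter>n. B \<inter> U \<inter> V n) = {}"
    proof (rule ccontr)
      assume "\<not> ?thesis"
      then obtain z where z: "z \<in> U" "\<And>n. z \<in> V n" by auto
      obtain r where r: "r > 0" "qball d z r \<subseteq> U" using U z(1) by (auto simp: qopen_def)
      obtain n where "1 / real (Suc n) < r"
        using reals_Archimedean[OF r(1)] by (auto simp: inverse_eq_divide)
      moreover obtain w where "w \<notin> U" "d w z < 1 / real (Suc n)"
        using z(2)[of n] by (auto simp: V_def qball_def)
      ultimately have "w \<in> qball d z r" using sym by (auto simp: qball_def)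
      then show False using r \<open>w \<notin> U\<close> by blast
    qed
    then have "\<exists>n. emeasure M (B \<inter> U \<inter> V n) < ennreal e"
      using Basic.prems decV B(1) open_measurable[OF U] open_measurable[OF V]
      by (intro small) (auto simp: decseq_def)
    then obtain n where "emeasure M (B \<inter> U \<inter> V n) < ennreal e" ..
    moreover have "- U \<subseteq> V n"
      unfolding V_def qball_def using refl by (auto intro!: bexI)
    ultimately show ?case using U V by blast
  next
    case Empty
    have "qopen d {}" "qopen d UNIV"
      using qopen_Inter_finite[of "{}" d] by (auto simp: qopen_def[of d "{}"])
    then show ?case using Empty by (intro exI[of _ "{}"] exI[of _ UNIV]) auto
  next
    case (Compl A)
    then obtain U V where "qopen d U" "qopen d V" "A \<subseteq> U" "- A \<subseteq> V"
      "emeasure M (B \<inter> U \<inter> V) < ennreal e" by blast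
    then show ?case by (intro exI[of _ V] exI[of _ U]) (auto simp: Int_ac)
  next
    case (Union A)
    have "\<forall>i. \<exists>U V. qopen d U \<and> qopen d V \<and> A i \<subseteq> U \<and> - A i \<subseteq> V \<and>
        emeasure M (B \<inter> U \<inter> V) < ennreal (e / 2 * (1 / 2) ^ Suc i)"
      using Union.prems by (intro allI Union.IH) auto
    then obtain U V where UV: "\<And>i. qopen d (U i)" "\<And>i. qopen d (V i)" "\<And>i. A i \<subseteq> U i"
      "\<And>i. - A i \<subseteq> V i" "\<And>i. emeasure M (B \<inter> U i \<inter> V i) < ennreal (e / 2 * (1 / 2) ^ Suc i)"
      by metis
    define U' where "U' = (\<Union>i. U i)"
    \<comment> \<open>Only finite intersections of open sets are known to be open, so the complement
      of the union is covered by finitely many \<open>V i\<close>. Half of \<open>e\<close> pays for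
      the errors collected in \<open>D\<close>; off \<open>D\<close> the sets
      \<open>U' \<inter> W N\<close> decrease to the empty set, and the other half pays for a late
      one.\<close>
    define W where "W N = (\<Inter>i\<in>{..N}. V i)" for N :: nat
    have U': "qopen d U'" unfolding U'_def by (intro qopen_Union) (use UV in auto)
    have W: "qopen d (W N)" for N unfolding W_def by (intro qopen_Inter_finite) (use UV in auto)
    have decW: "W n \<subseteq> W m" if "m \<le> n" for m n
      unfolding W_def using that by (intro INF_superset_mono) auto
    define D where "D = (\<Union>i. B \<inter> U i \<inter> V i)"
    have meas: "B \<inter> U i \<inter> V i \<in> sets M" for i
      using UV by (intro sets.Int B open_measurable)
    then have D: "D \<in> sets M" by (auto simp: D_def)
    have "\<exists>n. emeasure M (B \<inter> U' \<inter> W n - D) < ennreal (e / 2)"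
    proof (rule small)
      show "(\<Inter>n. B \<inter> U' \<inter> W n - D) = {}"
        by (auto simp: U'_def W_def D_def)
      show "decseq (\<lambda>n. B \<inter> U' \<inter> W n - D)"
        using decW by (auto simp: decseq_def)
      show "B \<inter> U' \<inter> W n - D \<in> sets M" for n
        by (intro sets.Diff sets.Int B open_measurable U' W D)
    qed (use Union.prems in auto)
    then obtain n where n: "emeasure M (B \<inter> U' \<inter> W n - D) < ennreal (e / 2)" ..
    have "emeasure M D \<le> (\<Sum>i. emeasure M (B \<inter> U i \<inter> V i))"
      unfolding D_def using meas by (intro emeasure_subadditive_countably) auto
    also have "\<dots> \<le> (\<Sum>i. ennreal (e / 2 * (1 / 2) ^ Suc i))"
      using UV(5) by (intro suminf_le) (auto intro: less_imp_le)
    also have "\<dots> = ennreal (e / 2)"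
      using Union.prems power_half_series[THEN sums_mult, of "e / 2"]
      by (intro suminf_ennreal_eq) auto
    finally have D_le: "emeasure M D \<le> ennreal (e / 2)" .
    have "emeasure M (B \<inter> U' \<inter> W n) \<le> emeasure M (D \<union> (B \<inter> U' \<inter> W n - D))"
      using D B(1) open_measurable[OF U'] open_measurable[OF W[of n]] by (intro emeasure_mono) auto
    also have "\<dots> \<le> emeasure M D + emeasure M (B \<inter> U' \<inter> W n - D)"
      using D B(1) open_measurable[OF U'] open_measurable[OF W[of n]]
      by (intro emeasure_subadditive) auto
    also have "\<dots> < ennreal (e / 2) + ennreal (e / 2)"
      by (rule le_less_trans[OF add_right_mono[OF D_le]]) (use n in \<open>simp add: ennreal_add_left_cancel_less\<close>)
    also have "\<dots> = ennreal e"
      using Union.prems by (simp flip: ennreal_plus)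
    finally have "emeasure M (B \<inter> U' \<inter> W n) < ennreal e" .
    moreover have "(\<Union>i. A i) \<subseteq> U'" "- (\<Union>i. A i) \<subseteq> W n"
      unfolding U'_def W_def using UV(3,4) by blast+
    ultimately show ?case using U' W by blast
  qed
qed

section \<open>Parabolic boxes and Lebesgue density\<close>

text \<open>The height \<open>L\<close> lets one family serve for everything: \<open>L = 1\<close>
  gives the balls of the parabolic quasi-metric, \<open>L = (1 - \<gamma>) / 2\<close> the halves of
  a cylinder, larger values boxes that contain both halves.\<close>

definition pbox :: "('a \<Rightarrow> 'a \<Rightarrow> real) \<Rightarrow> real \<Rightarrow> real \<Rightarrow> 'a \<Rightarrow> real \<Rightarrow> real \<Rightarrow> ('a \<times> real) set"
  where "pbox \<rho> p L x s l = qball \<rho> x l \<times> {s - L * l powr p <..< s + L * l powr p}"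

text \<open>The formula for the measure of a rectangle in \<open>time_product\<close> asks for
  sigma-finiteness of the second factor.\<close>

lemma sigma_finite_lebesgue: "sigma_finite_measure (lebesgue :: real measure)"
proof
  define A :: "real set set" where "A = range (\<lambda>n::nat. {- real n..real n})"
  have "x \<in> \<Union>A" for x :: real
  proof -
    obtain n :: nat where "\<bar>x\<bar> \<le> real n" using real_arch_simple by blast
    then have "x \<in> {- real n..real n}" by auto
    then show ?thesis unfolding A_def by blast
  qed
  then have "countable A \<and> A \<subseteq> sets lebesgue \<and> \<Union>A = space lebesgue \<and>
      (\<forall>a\<in>A. emeasure lebesgue a \<noteq> \<infinity>)"
    unfolding A_def by auto
  then show "\<exists>A::real set set. countable A \<and> A \<subseteq> sets lebesgue \<and> \<Union>A = space lebesgue \<and>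
      (\<forall>a\<in>A. emeasure lebesgue a \<noteq> \<infinity>)" ..
qed

locale parabolic_space =
  fixes \<rho> :: "'a \<Rightarrow> 'a \<Rightarrow> real" and \<mu> :: "'a measure" and p K D :: real
  assumes dist_nonneg: "0 \<le> \<rho> x y" and dist_refl: "\<rho> x x = 0" and dist_sym: "\<rho> x y = \<rho> y x"
    and K_ge_1: "1 \<le> K" and dist_triangle: "\<rho> x y \<le> K * (\<rho> x z + \<rho> z y)"
    and p_gt_1: "1 < p"
    and ball_sets: "0 < r \<Longrightarrow> qball \<rho> x r \<in> sets \<mu>"
    and ball_positive: "0 < r \<Longrightarrow> 0 < emeasure \<mu> (qball \<rho> x r)"
    and ball_bounded: "0 < r \<Longrightarrow> emeasure \<mu> (qball \<rho> x r) < \<infinity>"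
    and ball_doubling: "0 < r \<Longrightarrow> measure \<mu> (qball \<rho> x (2 * r)) \<le> D * measure \<mu> (qball \<rho> x r)"
    and basic_product: "basic_assumptions (parabolic_dist \<rho> p) (time_product \<mu>)"
    and space_mu: "space \<mu> = UNIV"
begin

abbreviation Q :: "real \<Rightarrow> 'a \<Rightarrow> real \<Rightarrow> real \<Rightarrow> ('a \<times> real) set"
  where "Q \<equiv> pbox \<rho> p"

abbreviation \<Lambda> :: "('a \<times> real) measure"
  where "\<Lambda> \<equiv> time_product \<mu>"

definition vol :: "real \<Rightarrow> 'a \<Rightarrow> real \<Rightarrow> real"
  where "vol L y l = 2 * L * l powr p * measure \<mu> (qball \<rho> y l)"

lemma mem_Q: "(y, s) \<in> Q L x t l \<longleftrightarrow> \<rho> x y < l \<and> \<bar>s - t\<bar> < L * l powr p"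
  by (auto simp: pbox_def qball_def)

lemma ball_measure_pos: "0 < r \<Longrightarrow> 0 < measure \<mu> (qball \<rho> x r)"
  using ball_positive[of r x] ball_bounded[of r x]
  by (simp add: measure_def enn2real_positive_iff less_top)

lemma emeasure_ball: "0 < r \<Longrightarrow> emeasure \<mu> (qball \<rho> x r) = ennreal (measure \<mu> (qball \<rho> x r))"
  using ball_bounded[of r x] by (intro emeasure_eq_ennreal_measure) auto

lemma Q_sets [measurable]: "0 < l \<Longrightarrow> Q L x s l \<in> sets \<Lambda>"
  unfolding pbox_def time_product_def using ball_sets by (intro pair_measureI) auto

lemma emeasure_Q: "0 < l \<Longrightarrow> 0 < L \<Longrightarrow> emeasure \<Lambda> (Q L x s l) = ennreal (vol L x l)"
proof -
  assume "0 < l" "0 < L"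
  interpret lebesgue: sigma_finite_measure "lebesgue :: real measure"
    by (rule sigma_finite_lebesgue)
  show ?thesis
    unfolding pbox_def time_product_def vol_def using \<open>0 < l\<close> \<open>0 < L\<close> ball_sets
    by (subst lebesgue.emeasure_pair_measure_Times)
      (auto simp: emeasure_ball ennreal_mult' [symmetric] algebra_simps)
qed

lemma vol_pos: "0 < l \<Longrightarrow> 0 < L \<Longrightarrow> 0 < vol L x l"
  using ball_measure_pos[of l x] by (simp add: vol_def)

lemma space_\<Lambda>: "space \<Lambda> = UNIV"
  by (simp add: time_product_def space_pair_measure space_mu)

section \<open>Doubling, volumes and dilated boxes\<close>

lemma ball_doubling_iter:
  "0 < r \<Longrightarrow> measure \<mu> (qball \<rho> x (2 ^ n * r)) \<le> D ^ n * measure \<mu> (qball \<rho> x r)"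
proof (induction n)
  case (Suc n)
  have "0 \<le> D"
    using ball_doubling[OF Suc.prems, of x] ball_measure_pos[OF Suc.prems, of x]
    by (metis measure_nonneg mult_less_0_iff not_le order.trans)
  have "measure \<mu> (qball \<rho> x (2 ^ Suc n * r)) \<le> D * measure \<mu> (qball \<rho> x (2 ^ n * r))"
    using ball_doubling[of "2 ^ n * r" x] Suc.prems by (simp add: mult.assoc)
  also have "\<dots> \<le> D * (D ^ n * measure \<mu> (qball \<rho> x r))"
    using Suc \<open>0 \<le> D\<close> by (intro mult_left_mono) auto
  finally show ?case by (simp add: mult.assoc)
qed simp

text \<open>The ball of radius \<open>l'\<close> about \<open>y\<close> lies in that of radius
  \<open>2 ^ n * l\<close> about \<open>y'\<close>, with \<open>n\<close> depending only on
  \<open>C\<close> and \<open>K\<close>; then \<open>n\<close> doublings lead back to radius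
  \<open>l\<close>. One \<open>B\<close> serves all centres and scales.\<close>

lemma vol_compare:
  assumes "0 < L" "0 < L'" "0 < C"
  obtains B where "0 < B"
    "\<And>y y' l l'. 0 < l \<Longrightarrow> 0 < l' \<Longrightarrow> l' \<le> C * l \<Longrightarrow> \<rho> y y' \<le> C * l \<Longrightarrow>
      vol L' y l' \<le> B * vol L y' l"
proof -
  obtain n :: nat where n: "2 * K * C < 2 ^ n"
    using real_arch_pow[of 2 "2 * K * C"] by auto
  \<comment> \<open>The factors stand for the ratio of the heights, the ratio of the time lengths
    and the \<open>n\<close> doublings.\<close>
  define B where "B = L' / L * C powr p * D ^ n"
  have bound: "vol L' y l' \<le> B * vol L y' l"
    if "0 < l" "0 < l'" "l' \<le> C * l" "\<rho> y y' \<le> C * l" for y y' l l'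
  proof -
    have "qball \<rho> y l' \<subseteq> qball \<rho> y' (2 ^ n * l)"
    proof
      fix z assume "z \<in> qball \<rho> y l'"
      then have "\<rho> y z < C * l" using that by (simp add: qball_def)
      then have "\<rho> y' z \<le> K * (C * l + C * l)"
        using dist_triangle[of y' z y] that(4) K_ge_1 dist_sym[of y y']
        by (smt (verit) mult_left_mono)
      also have "\<dots> = 2 * K * C * l" by simp
      also have "\<dots> < 2 ^ n * l" using n that(1) by (intro mult_strict_right_mono) auto
      finally show "z \<in> qball \<rho> y' (2 ^ n * l)" by (simp add: qball_def)
    qed
    then have "measure \<mu> (qball \<rho> y l') \<le> measure \<mu> (qball \<rho> y' (2 ^ n * l))"
      using that ball_sets ball_bounded
      by (intro measure_mono_fmeasurable) (auto simp: fmeasurable_def)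
    also have "\<dots> \<le> D ^ n * measure \<mu> (qball \<rho> y' l)"
      using that by (intro ball_doubling_iter)
    finally have 1: "measure \<mu> (qball \<rho> y l') \<le> D ^ n * measure \<mu> (qball \<rho> y' l)" .
    have "l' powr p \<le> (C * l) powr p"
      using that p_gt_1 by (intro powr_mono2) auto
    also have "\<dots> = C powr p * l powr p"
      using that assms by (simp add: powr_mult)
    finally have 2: "l' powr p \<le> C powr p * l powr p" .
    have "vol L' y l' \<le> 2 * L' * (C powr p * l powr p) * (D ^ n * measure \<mu> (qball \<rho> y' l))"
      unfolding vol_def using 1 2 assms by (intro mult_mono) auto
    also have "\<dots> = B * vol L y' l"
      using assms by (simp add: B_def vol_def)
    finally show ?thesis .
  qed
  have "0 < B"
  proof -
    \<comment> \<open>Positivity of \<open>B\<close> is read off from the bound itself, for two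
      boxes of positive volume about an arbitrary point.\<close>
    fix x :: 'a
    define l where "l = 1 / C"
    have "0 < vol L' x 1" "0 < vol L x l"
      using vol_pos assms by (auto simp: l_def)
    moreover have "vol L' x 1 \<le> B * vol L x l"
      using bound[of l 1 x x] assms dist_refl by (simp add: l_def)
    ultimately show "0 < B"
      by (smt (verit) mult_nonneg_nonneg zero_less_mult_iff)
  qed
  then show thesis using bound that by blast
qed

text \<open>The engulfing half of the Vitali argument. Engulfing the centre suffices, since each
  point to be covered is the centre of its own box. The heights may differ: disjoint boxes of height
  \<open>L\<close> are traded for covering boxes of height \<open>h\<close>.\<close>

lemma center_mem_dilated_box:
  assumes C: "1 \<le> C" "3 * K \<le> C" "2 * L \<le> h * C" and "0 < L" "0 < h" "0 < l" "l \<le> l'"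
    and meet: "Q L y s l \<inter> Q L y' s' l' \<noteq> {}"
  shows "(y, s) \<in> Q h y' s' (C * l')"
proof -
  obtain z t where z: "(z, t) \<in> Q L y s l" "(z, t) \<in> Q L y' s' l'"
    using meet by auto
  have "\<rho> y' y \<le> K * (\<rho> y' z + \<rho> z y)" by (rule dist_triangle)
  also have "\<dots> \<le> K * (l' + l')"
    using z K_ge_1 assms by (intro mult_left_mono) (auto simp: mem_Q dist_sym)
  also have "\<dots> < 3 * K * l'" using K_ge_1 assms by (simp add: algebra_simps)
  also have "\<dots> \<le> C * l'" using C assms by (intro mult_right_mono) auto
  finally have 1: "\<rho> y' y < C * l'" .
  have lp: "l powr p \<le> l' powr p" using assms p_gt_1 by (intro powr_mono2) auto
  have "\<bar>s - s'\<bar> < L * l powr p + L * l' powr p" using z by (auto simp: mem_Q)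
  also have "\<dots> \<le> L * l' powr p + L * l' powr p"
    using lp assms by (intro add_mono mult_left_mono) auto
  also have "\<dots> = (2 * L) * l' powr p" by simp
  also have "\<dots> \<le> (h * C) * l' powr p" using C by (intro mult_right_mono) auto
  \<comment> \<open>Here \<open>C \<le> C powr p\<close>, as \<open>C \<ge> 1\<close> and
    \<open>p > 1\<close>: a dilation gains at least as much in time as in space.\<close>
  also have "\<dots> \<le> (h * C powr p) * l' powr p"
    using powr_mono[of 1 p C] C p_gt_1 assms by (intro mult_right_mono mult_left_mono) auto
  also have "\<dots> = h * (C * l') powr p" using C assms by (simp add: powr_mult)
  finally show ?thesis using 1 by (simp add: mem_Q)
qed

lemma parabolic_ball_eq: "0 < r \<Longrightarrow> qball (parabolic_dist \<rho> p) (x, s) r = Q 1 x s r"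
proof -
  assume "0 < r"
  have "\<bar>s - t\<bar> powr (1 / p) < r \<longleftrightarrow> \<bar>t - s\<bar> < r powr p" for t
  proof -
    have "\<bar>s - t\<bar> powr (1 / p) < r \<longleftrightarrow> (\<bar>s - t\<bar> powr (1 / p)) powr p < r powr p"
      using \<open>0 < r\<close> p_gt_1 by (smt (verit) powr_ge_zero powr_less_mono2 powr_mono2)
    also have "(\<bar>s - t\<bar> powr (1 / p)) powr p = \<bar>s - t\<bar>"
      using p_gt_1 by (simp add: powr_powr)
    finally show ?thesis by (simp add: abs_minus_commute)
  qed
  then show ?thesis
    by (intro set_eqI) (simp add: qball_def parabolic_dist_def mem_Q split_paired_all)
qed

lemma Q_mono_time: "L \<le> L' \<Longrightarrow> Q L x s l \<subseteq> Q L' x s l"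
  unfolding pbox_def by (intro Sigma_mono order_refl subsetI) (smt (verit) greaterThanLessThan_iff
      mult_right_mono powr_ge_zero)

lemma Q_mono_scale: "0 \<le> L \<Longrightarrow> 0 < l \<Longrightarrow> l \<le> l' \<Longrightarrow> Q L x s l \<subseteq> Q L x s l'"
proof -
  assume "0 \<le> L" "0 < l" "l \<le> l'"
  then have "L * l powr p \<le> L * l' powr p"
    using p_gt_1 by (intro mult_left_mono powr_mono2) auto
  then show ?thesis
    using \<open>l \<le> l'\<close> by (auto simp: pbox_def qball_def)
qed

text \<open>Lebesgue density for sets. If \<open>Bad\<close> had outer measure
  \<open>\<beta> > 0\<close>, take an open \<open>W\<close> around it with little measure outside
  \<open>E\<close>. Disjoint boxes inside \<open>W\<close> centred in \<open>Bad\<close> carry mass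
  at least \<open>\<beta> / A\<close>, and two thirds of it lies outside \<open>E\<close>, which is
  too much. \<open>Bad\<close> may be nonmeasurable, hence the outer measure and the Borel hull
  \<open>H\<close>.\<close>

lemma density_null:
  assumes E: "E \<in> sets \<Lambda>" "E \<subseteq> Q h x0 s0 l0" and h: "0 < h" "h \<le> 1" and "0 < l0" "0 < r"
    and Bad: "Bad \<subseteq> E"
    and sparse: "\<And>y s j. (y, s) \<in> Bad \<Longrightarrow>
      emeasure \<Lambda> (E \<inter> Q h y s (r / 2 ^ j)) \<le> ennreal (vol h y (r / 2 ^ j) / 3)"
  obtains N where "N \<in> null_sets \<Lambda>" "Bad \<subseteq> N"
proof -
  let ?d = "parabolic_dist \<rho> p"
  interpret prod: basic_assumptions ?d \<Lambda> by (rule basic_product)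
  define B where "B = qball ?d (x0, s0) l0"
  have B_eq: "B = Q 1 x0 s0 l0" using \<open>0 < l0\<close> by (simp add: B_def parabolic_ball_eq)
  have B: "B \<in> sets \<Lambda>" "emeasure \<Lambda> B < \<infinity>" "qopen ?d B" "E \<subseteq> B"
    using prod.ball_finite[OF \<open>0 < l0\<close>, of "(x0, s0)"] prod.ball_open[OF \<open>0 < l0\<close>, of "(x0, s0)"]
      \<open>0 < l0\<close> Q_mono_time[OF h(2), of x0 s0 l0] E(2)
    by (auto simp: B_def[symmetric]) (auto simp: B_eq)
  obtain H where H: "H \<in> qborel ?d" "Bad \<subseteq> H" "outer_measure_of \<Lambda> Bad = emeasure \<Lambda> H"
    using prod.borel_regular[of Bad] by blast
  have H_sets: "H \<in> sets \<Lambda>"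
    using H(1) sets.sigma_sets_subset[of "{U. qopen ?d U}" \<Lambda>] prod.open_measurable
    by (auto simp: qborel_def space_\<Lambda>)
  have H_le: "emeasure \<Lambda> H \<le> emeasure \<Lambda> T" if "T \<in> sets \<Lambda>" "Bad \<subseteq> T" for T
    unfolding H(3)[symmetric] outer_measure_of_def using that by (intro INF_lower) auto
  obtain \<beta> where \<beta>: "0 \<le> \<beta>" "emeasure \<Lambda> H = ennreal \<beta>"
  proof -
    have "emeasure \<Lambda> H < \<infinity>" using H_le[of B] B Bad by (auto intro: le_less_trans)
    then show ?thesis using that by (cases "emeasure \<Lambda> H") auto
  qed
  have "\<beta> = 0"
  proof (rule ccontr)
    assume "\<beta> \<noteq> 0"
    then have "0 < \<beta>" using \<beta> by simp
    define C where "C = 3 * K + 2"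
    have C: "1 \<le> C" "3 * K \<le> C" "2 * h \<le> h * C" using K_ge_1 h by (auto simp: C_def)
    obtain A where A: "0 < A" "\<And>y l. 0 < l \<Longrightarrow> vol h y (C * l) \<le> A * vol h y l"
      using vol_compare[OF h(1) h(1), of C] C dist_refl
      by (smt (verit) mult_nonneg_nonneg mult_pos_pos)
    \<comment> \<open>Half of \<open>\<beta> / A\<close>, to be contradicted by the two thirds of
      \<open>\<beta> / A\<close> that the disjoint boxes force into \<open>W - E\<close>.\<close>
    define \<eta> where "\<eta> = \<beta> / (2 * A)"
    have "0 < \<eta>" using \<open>0 < \<beta>\<close> A by (simp add: \<eta>_def)
    have "\<And>x y. ?d x y = ?d y x" "\<And>x. ?d x x = 0"
      by (auto simp: parabolic_dist_def dist_sym dist_refl abs_minus_commute)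
    then obtain U V where UV: "qopen ?d U" "qopen ?d V" "H \<subseteq> U" "- H \<subseteq> V"
      "emeasure \<Lambda> (B \<inter> U \<inter> V) < ennreal \<eta>"
      using qborel_outer_regular[OF basic_product _ _ B(1,2) H(1) \<open>0 < \<eta>\<close>] by blast
    define W where "W = B \<inter> U"
    have W: "qopen ?d W" "W \<in> sets \<Lambda>" "Bad \<subseteq> W"
      using B UV(1,3) H(2) Bad prod.open_measurable qopen_Int by (auto simp: W_def)
    have W_fin: "emeasure \<Lambda> W < \<infinity>"
      using emeasure_mono[of W B \<Lambda>] B by (auto simp: W_def intro: le_less_trans)
    have "emeasure \<Lambda> W \<le> emeasure \<Lambda> (H \<union> (B \<inter> U \<inter> V))"
      using UV H_sets B(1) prod.open_measurable by (intro emeasure_mono) (auto simp: W_def)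
    also have "\<dots> \<le> emeasure \<Lambda> H + emeasure \<Lambda> (B \<inter> U \<inter> V)"
      using UV H_sets B(1) prod.open_measurable by (intro emeasure_subadditive) auto
    also have "\<dots> \<le> ennreal \<beta> + ennreal \<eta>"
      using UV(5) \<beta> by (intro add_mono) auto
    finally have W_le: "emeasure \<Lambda> W \<le> ennreal \<beta> + ennreal \<eta>" .
    \<comment> \<open>\<open>W \<inter> E\<close> is a measurable set containing \<open>Bad\<close>,
      so it has measure at least \<open>\<beta>\<close>, and at most \<open>\<eta>\<close> of
      \<open>W\<close> remains.\<close>
    have "ennreal \<beta> + emeasure \<Lambda> (W - E) \<le> emeasure \<Lambda> (W \<inter> E) + emeasure \<Lambda> (W - E)"
      using H_le[of "W \<inter> E"] W Bad E \<beta> by (intro add_right_mono) auto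
    also have "\<dots> = emeasure \<Lambda> W"
      using W E by (subst plus_emeasure) (auto intro: arg_cong[where f = "emeasure \<Lambda>"])
    also note W_le
    finally have WE: "emeasure \<Lambda> (W - E) \<le> ennreal \<eta>"
      by (simp add: ennreal_add_left_cancel_le)
    define S where "S = (\<lambda>(z, j::nat). Q h (fst z) (snd z) (r / 2 ^ j))"
    \<comment> \<open>Boxes of all scales that fit into \<open>W\<close>; openness of
      \<open>W\<close> supplies one for every point of \<open>Bad\<close>.\<close>
    define I where "I = {(z, j). z \<in> Bad \<and> S (z, j) \<subseteq> W}"
    have S_sets: "S i \<in> sets \<Lambda>" and S_pos: "0 < emeasure \<Lambda> (S i)" for i
      using \<open>0 < r\<close> h by (auto simp: S_def split_beta emeasure_Q vol_pos)
    obtain J where J: "J \<subseteq> I" "countable J" "disjoint_family_on S J"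
      "\<And>i. i \<in> I \<Longrightarrow> \<exists>j\<in>J. S i \<inter> S j \<noteq> {} \<and> snd j \<le> snd i"
      by (rule vitali_covering[of I S \<Lambda> W snd]) (use S_sets S_pos W W_fin in \<open>auto simp: I_def\<close>)
    define T where "T = (\<lambda>(z, j::nat). Q h (fst z) (snd z) (C * (r / 2 ^ j)))"
    have T_sets: "T i \<in> sets \<Lambda>" for i
      using \<open>0 < r\<close> C by (auto simp: T_def split_beta)
    have cover: "Bad \<subseteq> (\<Union>i\<in>J. T i)"
    proof
      fix z assume "z \<in> Bad"
      obtain y s where z: "z = (y, s)" by fastforce
      obtain e where e: "e > 0" "qball ?d z e \<subseteq> W"
        using W(1,3) \<open>z \<in> Bad\<close> unfolding qopen_def by blast
      obtain j where "r / 2 ^ j < e"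
      proof -
        obtain j where "(1 / 2) ^ j < e / r"
          using real_arch_pow_inv[of "e / r" "1 / 2"] e \<open>0 < r\<close> by auto
        then show ?thesis
          using that[of j] \<open>0 < r\<close> by (simp add: field_simps power_divide)
      qed
      then have "S (z, j) \<subseteq> Q 1 y s e"
        using Q_mono_time[OF h(2), of y s "r / 2 ^ j"] Q_mono_scale[of 1 "r / 2 ^ j" e y s] \<open>0 < r\<close>
        by (auto simp: S_def z)
      also have "\<dots> \<subseteq> W" using e by (simp add: z parabolic_ball_eq)
      finally have "(z, j) \<in> I" using \<open>z \<in> Bad\<close> by (auto simp: I_def)
      then obtain w i where wi: "(w, i) \<in> J" "S (z, j) \<inter> S (w, i) \<noteq> {}" "i \<le> j"
        using J(4)[OF \<open>(z, j) \<in> I\<close>] by (metis surj_pair snd_conv)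
      have "(y, s) \<in> Q h (fst w) (snd w) (C * (r / 2 ^ i))"
        by (rule center_mem_dilated_box[OF C, where l = "r / 2 ^ j"])
          (use wi h \<open>0 < r\<close> in \<open>auto simp: S_def z intro!: divide_left_mono power_increasing\<close>)
      then have "z \<in> T (w, i)" by (simp add: z T_def)
      then show "z \<in> (\<Union>i\<in>J. T i)" using wi(1) by blast
    qed
    define X where "X = (\<integral>\<^sup>+i. emeasure \<Lambda> (S i) \<partial>count_space J)"
    have "ennreal \<beta> \<le> emeasure \<Lambda> (\<Union>i\<in>J. T i)"
      using H_le[OF sets.countable_UN'[OF J(2)] cover] T_sets \<beta> by (simp add: image_subset_iff)
    also have "\<dots> \<le> (\<integral>\<^sup>+i. emeasure \<Lambda> (T i) \<partial>count_space J)"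
      using J(2) T_sets by (intro emeasure_UN_le) auto
    also have "\<dots> \<le> (\<integral>\<^sup>+i. ennreal A * emeasure \<Lambda> (S i) \<partial>count_space J)"
    proof (rule nn_integral_mono)
      fix i
      show "emeasure \<Lambda> (T i) \<le> ennreal A * emeasure \<Lambda> (S i)"
        using A(2)[of "r / 2 ^ snd i" "fst (fst i)"] A(1) \<open>0 < r\<close> h C vol_pos
        by (auto simp: T_def S_def split_beta emeasure_Q less_imp_le simp flip: ennreal_mult)
    qed
    also have "\<dots> = ennreal A * X"
      unfolding X_def by (rule nn_integral_cmult) auto
    finally have 1: "ennreal \<beta> \<le> ennreal A * X" .
    have "ennreal (2 / 3) * X = (\<integral>\<^sup>+i. ennreal (2 / 3) * emeasure \<Lambda> (S i) \<partial>count_space J)"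
      unfolding X_def by (rule nn_integral_cmult[symmetric]) auto
    also have "\<dots> \<le> (\<integral>\<^sup>+i. emeasure \<Lambda> (S i - E) \<partial>count_space J)"
    proof (rule nn_integral_mono)
      fix i assume "i \<in> space (count_space J)"
      then have i: "fst i \<in> Bad" using J(1) by (auto simp: I_def)
      define v where "v = vol h (fst (fst i)) (r / 2 ^ snd i)"
      have v: "emeasure \<Lambda> (S i) = ennreal v" "0 < v"
        using \<open>0 < r\<close> h vol_pos by (auto simp: S_def split_beta emeasure_Q v_def)
      have "ennreal (v / 3) + ennreal (2 / 3 * v) = emeasure \<Lambda> (S i)"
        using v by (simp flip: ennreal_plus)
      also have "\<dots> = emeasure \<Lambda> (E \<inter> S i) + emeasure \<Lambda> (S i - E)"
        using S_sets E by (subst plus_emeasure) (auto intro: arg_cong[where f = "emeasure \<Lambda>"])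
      also have "\<dots> \<le> ennreal (v / 3) + emeasure \<Lambda> (S i - E)"
        using sparse[of "fst (fst i)" "snd (fst i)" "snd i"] i
        by (intro add_right_mono) (auto simp: S_def split_beta v_def)
      finally have "ennreal (2 / 3 * v) \<le> emeasure \<Lambda> (S i - E)"
        by (simp add: ennreal_add_left_cancel_le)
      then show "ennreal (2 / 3) * emeasure \<Lambda> (S i) \<le> emeasure \<Lambda> (S i - E)"
        using v by (simp flip: ennreal_mult)
    qed
    also have "\<dots> \<le> emeasure \<Lambda> (W - E)"
    proof (rule emeasure_disjoint_le)
      show "disjoint_family_on (\<lambda>i. S i - E) J"
        using J(3) unfolding disjoint_family_on_def by blast
      show "S i - E \<subseteq> W - E" if "i \<in> J" for i
        using that J(1) unfolding I_def by fastforce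
    qed (use J(2) S_sets E W in auto)
    also note WE
    finally have 2: "ennreal (2 / 3) * X \<le> ennreal \<eta>" .
    have "ennreal (2 / 3 * \<beta>) = ennreal (2 / 3) * ennreal \<beta>"
      using \<beta> by (simp flip: ennreal_mult)
    also have "\<dots> \<le> ennreal (2 / 3) * (ennreal A * X)" using 1 by (rule mult_left_mono) simp
    also have "\<dots> = ennreal A * (ennreal (2 / 3) * X)" by (simp add: mult_ac)
    also have "\<dots> \<le> ennreal A * ennreal \<eta>" using 2 by (rule mult_left_mono) simp
    also have "\<dots> = ennreal (A * \<eta>)" using A \<open>0 < \<eta>\<close> by (simp flip: ennreal_mult)
    finally have "2 / 3 * \<beta> \<le> A * \<eta>" using A \<open>0 < \<eta>\<close> by (simp add: ennreal_le_iff)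
    then show False using \<open>0 < \<beta>\<close> A by (simp add: \<eta>_def)
  qed
  then have "H \<in> null_sets \<Lambda>" using \<beta> H_sets by (simp add: null_sets_def)
  then show thesis using that H(2) by blast
qed

end

section \<open>Local exponential integrability\<close>

lemma ennreal_mult_le_imp_le:
  assumes "0 < c" "ennreal c * x \<le> ennreal a"
  shows "x \<le> ennreal (a / c)"
proof (cases x)
  case (real r)
  then have "ennreal (c * r) \<le> ennreal a" using assms by (simp add: ennreal_mult)
  then have "c * r \<le> max 0 a" by (auto simp: ennreal_le_iff2)
  then have "r \<le> max 0 a / c" using assms by (simp add: field_simps)
  then show ?thesis using real assms
    by (auto simp: max_def ennreal_le_iff2 split: if_splits)
next
  case top
  then show ?thesis using assms by (simp add: ennreal_mult_top top_unique)
qed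

lemma const_le_set_nn_integral:
  assumes "S \<in> sets M" "f \<in> borel_measurable M" "\<And>z. z \<in> S \<Longrightarrow> c \<le> f z"
  shows "c * emeasure M S \<le> (\<integral>\<^sup>+z\<in>S. f z \<partial>M)"
proof -
  have "c * emeasure M S = (\<integral>\<^sup>+z. c * indicator S z \<partial>M)"
    using assms by (simp add: nn_integral_cmult_indicator)
  also have "\<dots> \<le> (\<integral>\<^sup>+z\<in>S. f z \<partial>M)"
    by (rule nn_integral_mono) (use assms in \<open>auto split: split_indicator\<close>)
  finally show ?thesis .
qed

text \<open>Pointwise, \<open>\<alpha> - \<beta>\<close> is at most the sum of the positive parts of
  \<open>\<alpha> - u\<close> and \<open>u - \<beta>\<close>, whatever the value of
  \<open>u\<close>.\<close>

lemma gap_le_set_nn_integrals: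
  fixes u :: "'b \<Rightarrow> real"
  assumes S: "S \<in> sets M" and u: "u \<in> borel_measurable M"
  shows "ennreal (\<alpha> - \<beta>) * emeasure M S \<le>
    (\<integral>\<^sup>+z\<in>S. ennreal (max 0 (\<alpha> - u z)) \<partial>M) + (\<integral>\<^sup>+z\<in>S. ennreal (max 0 (u z - \<beta>)) \<partial>M)"
proof -
  note u [measurable] and S [measurable]
  have "ennreal (\<alpha> - \<beta>) * emeasure M S \<le>
      (\<integral>\<^sup>+z\<in>S. ennreal (max 0 (\<alpha> - u z)) + ennreal (max 0 (u z - \<beta>)) \<partial>M)"
    by (rule const_le_set_nn_integral) (auto simp flip: ennreal_plus intro!: ennreal_leI)
  also have "\<dots> = (\<integral>\<^sup>+z\<in>S. ennreal (max 0 (\<alpha> - u z)) \<partial>M) +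
      (\<integral>\<^sup>+z\<in>S. ennreal (max 0 (u z - \<beta>)) \<partial>M)"
    by (subst nn_integral_add[symmetric]) (auto simp: distrib_right)
  finally show ?thesis .
qed

text \<open>Compares the constants of two cylinders: on the common part \<open>S\<close> of a half
  of each, \<open>u\<close> is in mean not far above \<open>\<beta>\<close> and not far below
  \<open>\<alpha>\<close>.\<close>

lemma gap_le:
  fixes u :: "'b \<Rightarrow> real"
  assumes S: "S \<in> sets M" "emeasure M S = ennreal v" "0 < v" and u: "u \<in> borel_measurable M"
    and sub: "S \<subseteq> T" "S \<subseteq> T'" and nonneg: "0 \<le> a" "0 \<le> a'"
    and up: "(\<integral>\<^sup>+z\<in>T. ennreal (max 0 (u z - \<beta>)) \<partial>M) \<le> ennreal a"
    and lo: "(\<integral>\<^sup>+z\<in>T'. ennreal (max 0 (\<alpha> - u z)) \<partial>M) \<le> ennreal a'"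
  shows "\<alpha> - \<beta> \<le> (a + a') / v"
proof (cases "\<alpha> \<le> \<beta>")
  case True
  then show ?thesis using S(3) nonneg by (smt (verit) divide_nonneg_pos)
next
  case False
  have "ennreal (\<alpha> - \<beta>) * ennreal v \<le>
      (\<integral>\<^sup>+z\<in>S. ennreal (max 0 (\<alpha> - u z)) \<partial>M) + (\<integral>\<^sup>+z\<in>S. ennreal (max 0 (u z - \<beta>)) \<partial>M)"
    using gap_le_set_nn_integrals[OF S(1) u] S(2) by metis
  also have "\<dots> \<le> (\<integral>\<^sup>+z\<in>T'. ennreal (max 0 (\<alpha> - u z)) \<partial>M) +
      (\<integral>\<^sup>+z\<in>T. ennreal (max 0 (u z - \<beta>)) \<partial>M)"
    by (intro add_mono nn_integral_mono) (use sub in \<open>auto split: split_indicator\<close>)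
  also have "\<dots> \<le> ennreal a' + ennreal a" by (intro add_mono up lo)
  finally have "ennreal ((\<alpha> - \<beta>) * v) \<le> ennreal (a + a')"
    using False S(3) nonneg by (simp add: ennreal_mult ennreal_plus add.commute)
  then have "(\<alpha> - \<beta>) * v \<le> a + a'" using nonneg by (subst (asm) ennreal_le_iff) auto
  then show ?thesis using S(3) by (simp add: field_simps)
qed

text \<open>On the layer \<open>k * c < f \<le> (k + 1) * c\<close> the exponential is at most
  \<open>(3 / 2) ^ (k + 1)\<close>, while the measure is at most \<open>(1 / 2) ^ k * V\<close>. The
  geometric series of ratio 3/4 contributes \<open>6 * V\<close>, and the bound 1 on all of
  \<open>S\<close> contributes \<open>V\<close>.\<close>

lemma exp_set_nn_integral_le:
  fixes f :: "'b \<Rightarrow> real"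
  assumes S: "S \<in> sets M" and f: "f \<in> borel_measurable M" and "0 < c" "0 \<le> V"
    and V: "emeasure M S \<le> ennreal V"
    and decay: "\<And>k::nat. emeasure M {z \<in> S. real k * c < f z} \<le> ennreal ((1 / 2) ^ k * V)"
  shows "(\<integral>\<^sup>+z\<in>S. ennreal (exp (ln (3 / 2) / c * max 0 (f z))) \<partial>M) \<le> ennreal (7 * V)"
proof -
  note S [measurable] and f [measurable]
  define E where "E k = {z \<in> S. real k * c < f z}" for k :: nat
  have E [measurable]: "E k \<in> sets M" for k
  proof -
    have "E k = S \<inter> (f -` {real k * c<..} \<inter> space M)"
      using sets.sets_into_space[OF S] by (auto simp: E_def)
    then show ?thesis by simp
  qed
  have point: "ennreal (exp (ln (3 / 2) / c * max 0 (f z))) * indicator S z \<le>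
      indicator S z + (\<Sum>k. ennreal ((3 / 2) ^ Suc k) * indicator (E k) z)" for z
  proof (cases "z \<in> S \<and> 0 < f z")
    case True
    \<comment> \<open>Ceiling minus one instead of floor, because the superlevel sets are strict: a
      value \<open>k * c\<close> belongs to the layer below.\<close>
    define k where "k = nat \<lceil>f z / c\<rceil> - 1"
    have "0 < f z / c" using True \<open>0 < c\<close> by simp
    then have "real k < f z / c" "f z / c \<le> real k + 1"
      unfolding k_def by linarith+
    then have k: "real k * c < f z" "f z \<le> (real k + 1) * c"
      using \<open>0 < c\<close> by (simp_all add: field_simps)
    have "ln (3 / 2) / c * max 0 (f z) \<le> ln (3 / 2) / c * ((real k + 1) * c)"
      using k True \<open>0 < c\<close> by (intro mult_left_mono) auto
    also have "\<dots> = real (Suc k) * ln (3 / 2)" using \<open>0 < c\<close> by simp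
    finally have "exp (ln (3 / 2) / c * max 0 (f z)) \<le> exp (real (Suc k) * ln (3 / 2))" by simp
    also have "\<dots> = (3 / 2) ^ Suc k" by (simp only: exp_of_nat_mult) simp
    finally have "ennreal (exp (ln (3 / 2) / c * max 0 (f z))) \<le> ennreal ((3 / 2) ^ Suc k)"
      by (rule ennreal_leI)
    also have "\<dots> = (\<Sum>k\<in>{k}. ennreal ((3 / 2) ^ Suc k) * indicator (E k) z)"
      using True k by (simp add: E_def)
    also have "\<dots> \<le> (\<Sum>k. ennreal ((3 / 2) ^ Suc k) * indicator (E k) z)"
      by (rule sum_le_suminf) auto
    finally show ?thesis using True by (simp add: add_increasing)
  next
    case False
    then show ?thesis by (auto split: split_indicator)
  qed
  have "(\<integral>\<^sup>+z\<in>S. ennreal (exp (ln (3 / 2) / c * max 0 (f z))) \<partial>M) \<le>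
      (\<integral>\<^sup>+z. indicator S z + (\<Sum>k. ennreal ((3 / 2) ^ Suc k) * indicator (E k) z) \<partial>M)"
    by (rule nn_integral_mono) (rule point)
  also have "\<dots> = emeasure M S + (\<Sum>k. ennreal ((3 / 2) ^ Suc k) * emeasure M (E k))"
    by (subst nn_integral_add) (auto simp: nn_integral_suminf nn_integral_cmult_indicator)
  also have "\<dots> \<le> ennreal V + (\<Sum>k. ennreal (3 / 2 * V * (3 / 4) ^ k))"
  proof (intro add_mono suminf_le V)
    fix k
    have "ennreal ((3 / 2) ^ Suc k) * emeasure M (E k) \<le>
        ennreal ((3 / 2) ^ Suc k) * ennreal ((1 / 2) ^ k * V)"
      unfolding E_def by (intro mult_left_mono decay) auto
    also have "\<dots> = ennreal ((3 / 2) ^ Suc k * ((1 / 2) ^ k * V))"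
      using \<open>0 \<le> V\<close> by (simp flip: ennreal_mult)
    also have "(3 / 2) ^ Suc k * ((1 / 2) ^ k * V) = 3 / 2 * V * ((3 / 2) * (1 / 2)) ^ k"
      by (simp only: power_mult_distrib) simp
    finally show "ennreal ((3 / 2) ^ Suc k) * emeasure M (E k) \<le> ennreal (3 / 2 * V * (3 / 4) ^ k)"
      by simp
  qed auto
  also have "(\<Sum>k. ennreal (3 / 2 * V * (3 / 4) ^ k)) = ennreal (3 / 2 * V * (1 / (1 - 3 / 4)))"
    using \<open>0 \<le> V\<close> by (intro suminf_ennreal_eq sums_mult geometric_sums) auto
  also have "ennreal V + \<dots> = ennreal (7 * V)"
    using \<open>0 \<le> V\<close> by (simp flip: ennreal_plus)
  finally show ?thesis .
qed

text \<open>Cylinders are recentred at the middle of one of their halves, which becomes \<open>Q h y s l\<close>; the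
  middle of the other half is earlier by \<open>\<kappa> l^p\<close>. The sign of \<open>\<kappa>\<close> is the direction of time.\<close>

locale parabolic_bmo = parabolic_space +
  fixes u :: "'a \<times> real \<Rightarrow> real" and h \<kappa> A :: real and b :: "'a \<Rightarrow> real \<Rightarrow> real \<Rightarrow> real"
  assumes u_measurable [measurable]: "u \<in> borel_measurable \<Lambda>"
    and h_pos: "0 < h" and h_le_1: "h \<le> 1" and A_pos: "0 < A"
    and upper: "0 < l \<Longrightarrow>
      (\<integral>\<^sup>+z\<in>Q h y s l. ennreal (max 0 (u z - b y s l)) \<partial>\<Lambda>) \<le> ennreal (A * vol h y l)"
    and lower: "0 < l \<Longrightarrow>
      (\<integral>\<^sup>+z\<in>Q h y (s - \<kappa> * l powr p) l. ennreal (max 0 (b y s l - u z)) \<partial>\<Lambda>) \<le> ennreal (A * vol h y l)"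
begin

lemma superlevel_sets: "S \<in> sets \<Lambda> \<Longrightarrow> {z \<in> S. c < u z} \<in> sets \<Lambda>"
proof -
  assume S: "S \<in> sets \<Lambda>"
  have "{z \<in> S. c < u z} = S \<inter> (u -` {c<..} \<inter> space \<Lambda>)"
    by (auto simp: space_\<Lambda>)
  then show ?thesis using S by simp
qed

text \<open>The height at which a box about the middle of one half contains the other half as well,
  for either sign of \<open>\<kappa>\<close>.\<close>

definition L :: real where "L = h + \<bar>\<kappa>\<bar>"

text \<open>Made for \<open>box_subset\<close>. The first bound is the quasi-triangle inequality
  with two distances below \<open>\<delta> * l0\<close>; the second is its analogue in time, where
  \<open>2 * L * \<delta> powr p \<le> 2 * L * \<delta> \<le> h\<close>.\<close>

definition \<delta> :: real where "\<delta> = min (1 / (2 * K)) (h / (2 * L))"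

lemma L_pos: "0 < L" and h_le_L: "h \<le> L"
  using h_pos by (auto simp: L_def)

lemma \<delta>_pos: "0 < \<delta>"
  using h_pos L_pos K_ge_1 by (simp add: \<delta>_def)

lemma \<delta>_K: "\<delta> * (2 * K) \<le> 1" and \<delta>_L: "\<delta> * (2 * L) \<le> h"
proof -
  have "\<delta> \<le> 1 / (2 * K)" "\<delta> \<le> h / (2 * L)" by (auto simp: \<delta>_def)
  then show "\<delta> * (2 * K) \<le> 1" "\<delta> * (2 * L) \<le> h"
    using K_ge_1 L_pos by (simp_all add: field_simps)
qed

lemma \<delta>_le: "\<delta> \<le> 1"
  using \<delta>_K K_ge_1 \<delta>_pos by (smt (verit) mult_le_cancel_left1)

lemma past_subset: "Q h y (s - \<kappa> * l powr p) l \<subseteq> Q L y s l"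
proof (safe)
  fix z t assume "(z, t) \<in> Q h y (s - \<kappa> * l powr p) l"
  then have "\<rho> y z < l" "\<bar>t - (s - \<kappa> * l powr p)\<bar> < h * l powr p" by (auto simp: mem_Q)
  moreover have "\<bar>\<kappa> * l powr p\<bar> = \<bar>\<kappa>\<bar> * l powr p" by (simp add: abs_mult)
  ultimately show "(z, t) \<in> Q L y s l"
    by (auto simp: mem_Q L_def distrib_right)
qed

lemma box_subset:
  assumes "(y, s) \<in> Q h x0 t0 (\<delta> * l0)" "0 < l" "l \<le> \<delta> * l0" "0 < l0"
  shows "Q L y s l \<subseteq> Q h x0 t0 l0"
proof safe
  fix z t assume z: "(z, t) \<in> Q L y s l"
  have "\<rho> x0 z \<le> K * (\<rho> x0 y + \<rho> y z)" by (rule dist_triangle)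
  also have "\<dots> < K * (\<delta> * l0 + \<delta> * l0)"
  proof (rule mult_strict_left_mono)
    show "\<rho> x0 y + \<rho> y z < \<delta> * l0 + \<delta> * l0"
      using z assms by (intro add_strict_mono) (auto simp: mem_Q)
  qed (use K_ge_1 in simp)
  also have "\<dots> = \<delta> * (2 * K) * l0" by simp
  also have "\<dots> \<le> 1 * l0" using \<delta>_K assms by (intro mult_right_mono) auto
  finally have 1: "\<rho> x0 z < l0" by simp
  have "\<bar>t - t0\<bar> \<le> \<bar>t - s\<bar> + \<bar>s - t0\<bar>" by simp
  also have "\<dots> < L * l powr p + h * (\<delta> * l0) powr p"
    using z assms by (intro add_strict_mono) (auto simp: mem_Q)
  also have "\<dots> \<le> L * (\<delta> * l0) powr p + L * (\<delta> * l0) powr p"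
    using L_pos h_le_L assms p_gt_1
    by (intro add_mono mult_left_mono mult_right_mono powr_mono2) auto
  also have "\<dots> = 2 * L * (\<delta> powr p * l0 powr p)"
    using \<delta>_pos assms by (simp add: powr_mult)
  also have "\<dots> \<le> 2 * L * (\<delta> powr 1 * l0 powr p)"
    using L_pos \<delta>_pos \<delta>_le p_gt_1 by (intro mult_left_mono mult_right_mono powr_mono') auto
  also have "\<dots> = \<delta> * (2 * L) * l0 powr p" using \<delta>_pos by simp
  also have "\<dots> \<le> h * l0 powr p" using \<delta>_L by (rule mult_right_mono) simp
  finally show "(z, t) \<in> Q h x0 t0 l0" using 1 by (simp add: mem_Q)
qed

text \<open>Stopping time: around each point the scales \<open>\<delta> l0 / 2^j\<close> are searched for the first one at
  which the constant \<open>b\<close> exceeds \<open>b x0 t0 l0\<close> by \<open>M\<close>. On the opposite halves of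
  the stopping cylinders \<open>u - b x0 t0 l0\<close> is large on average, so that a disjoint subfamily of them has small total measure.\<close>

lemma superlevel_decay:
  obtains M where "0 < M"
    "\<And>(k::nat) x t l. 0 < l \<Longrightarrow>
      emeasure \<Lambda> {z \<in> Q h x t (\<delta> * l). b x t l + real k * M < u z} \<le> ennreal ((1 / 2) ^ k * vol h x l)"
proof -
  \<comment> \<open>The engulfing dilation \<open>C\<close> is taken of the form
    \<open>2 ^ n0 * \<delta>\<close>: going up \<open>n0\<close> scales from a stopping scale and
    then shrinking by \<open>\<delta>\<close> is exactly this dilation.\<close>
  obtain n0 :: nat where n0: "max (3 * K) (2 * L / h) / \<delta> < 2 ^ n0"
    using real_arch_pow[of 2] by (metis one_less_numeral_iff semiring_norm(76))
  define C where "C = 2 ^ n0 * \<delta>"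
  have C_gt: "max (3 * K) (2 * L / h) < C"
    using n0 \<delta>_pos by (simp add: C_def field_simps)
  have C: "1 \<le> C" "3 * K \<le> C" "2 * L \<le> h * C"
    using C_gt K_ge_1 h_pos by (auto simp: field_simps)
  have "0 < n0"
  proof (rule ccontr)
    assume "\<not> 0 < n0"
    then have "C \<le> 1" using \<delta>_le by (simp add: C_def)
    then show False using C(2) K_ge_1 by simp
  qed
  \<comment> \<open>With this ratio \<open>B\<close> compares volumes at size \<open>l0\<close> with
    those at the early search scales, since \<open>l0 = C' * lv n0\<close>, and also volumes at a
    stopping scale with those \<open>n0\<close> scales above.\<close>
  define C' where "C' = 2 ^ n0 / \<delta>"
  have C': "0 < C'" "2 ^ n0 \<le> C'" "1 \<le> C'"
    using \<delta>_pos \<delta>_le by (auto simp: C'_def field_simps intro: order_trans[of \<delta> 1])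
  obtain B where B: "0 < B"
    "\<And>y y' l l'. 0 < l \<Longrightarrow> 0 < l' \<Longrightarrow> l' \<le> C' * l \<Longrightarrow> \<rho> y y' \<le> C' * l \<Longrightarrow>
      vol h y l' \<le> B * vol h y' l"
    using vol_compare[OF h_pos h_pos C'(1)] by metis
  \<comment> \<open>On a stopping cylinder the oscillation uses up \<open>A\<close>. The remaining
    \<open>2 * A * B\<close> keeps the total selected volume below \<open>1 / (2 * B)\<close> of the
    parent volume, and the factor \<open>B\<close> lost by enlarging leaves 1/2. The extra
    \<open>3 * A\<close> in \<open>M'\<close> yields density at most 1/3 at points that never
    stop.\<close>
  define M where "M = A + 2 * A * B"
  define M' where "M' = M + 3 * A"
  have M: "0 < M" "0 < M'" using A_pos B(1) by (simp_all add: M_def M'_def add_pos_pos)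
  \<comment> \<open>The cylinder is quantified inside the induction, since the hypothesis is applied
    to the ancestors of all selected cylinders.\<close>
  have decay: "\<forall>x0 t0 l0. 0 < l0 \<longrightarrow>
      emeasure \<Lambda> {z \<in> Q h x0 t0 (\<delta> * l0). b x0 t0 l0 + real k * M' < u z} \<le>
        ennreal ((1 / 2) ^ k * vol h x0 l0)" for k :: nat
  proof (induction k)
    case 0
    show ?case
    proof (intro allI impI)
      fix x0 t0 and l0 :: real assume "0 < l0"
      have "Q h x0 t0 (\<delta> * l0) \<subseteq> Q h x0 t0 l0"
        using Q_mono_scale[of h "\<delta> * l0" l0 x0 t0] h_pos \<delta>_pos \<delta>_le \<open>0 < l0\<close> by simp
      then have "emeasure \<Lambda> {z \<in> Q h x0 t0 (\<delta> * l0). b x0 t0 l0 + real 0 * M' < u z} \<le>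
          emeasure \<Lambda> (Q h x0 t0 l0)"
        using \<open>0 < l0\<close> by (intro emeasure_mono) auto
      then show "emeasure \<Lambda> {z \<in> Q h x0 t0 (\<delta> * l0). b x0 t0 l0 + real 0 * M' < u z} \<le>
          ennreal ((1 / 2) ^ 0 * vol h x0 l0)"
        using \<open>0 < l0\<close> h_pos by (simp add: emeasure_Q)
    qed
  next
    case (Suc k)
    show ?case
    proof (intro allI impI)
      fix x0 t0 and l0 :: real assume "0 < l0"
      define b0 where "b0 = b x0 t0 l0"
      define lv where "lv j = \<delta> * l0 / 2 ^ j" for j :: nat
      have lv_pos: "0 < lv j" and lv_le: "lv j \<le> \<delta> * l0" for j
        using \<open>0 < l0\<close> \<delta>_pos by (auto simp: lv_def field_simps)
      have lv_anti: "lv j \<le> lv i" if "i \<le> j" for i j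
        using that \<open>0 < l0\<close> \<delta>_pos unfolding lv_def
        by (intro divide_left_mono power_increasing) auto
      define stop where "stop z j \<longleftrightarrow> b0 + M < b (fst z) (snd z) (lv j)" for z j
      define E where "E = {z \<in> Q h x0 t0 (\<delta> * l0). b0 + M' < u z}"
      have E: "E \<in> sets \<Lambda>" "E \<subseteq> Q h x0 t0 (\<delta> * l0)"
        using \<open>0 < l0\<close> \<delta>_pos by (auto simp: E_def intro!: superlevel_sets)
      \<comment> \<open>At a point that never stops the constants stay below \<open>b0 + M\<close>
        at all scales while \<open>u\<close> exceeds \<open>b0 + M'\<close> on \<open>E\<close>, so
        by Chebyshev \<open>E\<close> is sparse around it.\<close>
      define Bad where "Bad = {z \<in> E. \<forall>j. \<not> stop z j}"
      obtain Z where Z: "Z \<in> null_sets \<Lambda>" "Bad \<subseteq> Z"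
      proof (rule density_null[of E h x0 t0 "\<delta> * l0" "\<delta> * l0" Bad])
        fix y s j assume ys: "(y, s) \<in> Bad"
        have lv: "\<delta> * l0 / 2 ^ j = lv j" by (simp add: lv_def)
        have b_le: "b y s (lv j) \<le> b0 + M" using ys by (auto simp: Bad_def stop_def not_less)
        let ?f = "\<lambda>z. ennreal (max 0 (u z - b y s (lv j)))"
        have "ennreal (3 * A) * emeasure \<Lambda> (E \<inter> Q h y s (lv j)) \<le> (\<integral>\<^sup>+z\<in>E \<inter> Q h y s (lv j). ?f z \<partial>\<Lambda>)"
        proof (rule const_le_set_nn_integral)
          fix z assume "z \<in> E \<inter> Q h y s (lv j)"
          then have "3 * A \<le> u z - b y s (lv j)"
            using b_le by (auto simp: E_def M'_def)
          then show "ennreal (3 * A) \<le> ?f z" by (intro ennreal_leI) auto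
        qed (use E lv_pos in auto)
        also have "\<dots> \<le> (\<integral>\<^sup>+z\<in>Q h y s (lv j). ?f z \<partial>\<Lambda>)"
          by (rule nn_integral_mono) (auto split: split_indicator)
        also have "\<dots> \<le> ennreal (A * vol h y (lv j))"
          by (rule upper[OF lv_pos])
        finally have "emeasure \<Lambda> (E \<inter> Q h y s (lv j)) \<le> ennreal (A * vol h y (lv j) / (3 * A))"
          using A_pos by (intro ennreal_mult_le_imp_le) auto
        then show "emeasure \<Lambda> (E \<inter> Q h y s (\<delta> * l0 / 2 ^ j)) \<le> ennreal (vol h y (\<delta> * l0 / 2 ^ j) / 3)"
          using A_pos by (simp add: lv)
      qed (use E h_pos h_le_1 \<delta>_pos \<open>0 < l0\<close> that in \<open>auto simp: Bad_def\<close>)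
      define J where "J z = (LEAST j. stop z j)" for z
      define I where "I = {z \<in> E. \<exists>j. stop z j}"
      have stop_J: "stop z (J z)" if "z \<in> I" for z
        using that unfolding I_def J_def by (auto intro: LeastI)
      have not_stop: "\<not> stop z j" if "j < J z" for z j
        using that unfolding J_def by (rule not_less_Least)
      \<comment> \<open>A cylinder at one of the first \<open>n0\<close> scales is comparable in
        size with the parent, so its constant exceeds \<open>b0\<close> by at most
        \<open>A * B + A\<close>, which is not enough to stop.\<close>
      have J_ge: "n0 \<le> J z" if z: "z \<in> I" for z
      proof (rule ccontr)
        assume "\<not> n0 \<le> J z"
        obtain y s where ys: "z = (y, s)" by fastforce
        have ysQ: "(y, s) \<in> Q h x0 t0 (\<delta> * l0)" using z E by (auto simp: I_def ys)
        let ?l = "lv (J z)"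
        have "l0 \<le> C' * ?l"
        proof -
          have "l0 = C' * lv n0" using \<delta>_pos by (simp add: C'_def lv_def)
          also have "\<dots> \<le> C' * ?l"
            using \<open>\<not> n0 \<le> J z\<close> C' by (intro mult_left_mono lv_anti) auto
          finally show ?thesis .
        qed
        moreover have "\<rho> x0 y \<le> l0"
          using ysQ \<delta>_le \<open>0 < l0\<close> by (auto simp: mem_Q intro: order_trans less_imp_le mult_left_le_one_le)
        ultimately have volB: "vol h x0 l0 \<le> B * vol h y ?l"
          using \<open>0 < l0\<close> lv_pos by (intro B(2)) auto
        have "b y s ?l - b0 \<le> (A * vol h x0 l0 + A * vol h y ?l) / vol h y ?l"
        proof (rule gap_le)
          show "emeasure \<Lambda> (Q h y (s - \<kappa> * ?l powr p) ?l) = ennreal (vol h y ?l)"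
            using lv_pos h_pos by (intro emeasure_Q)
          show "Q h y (s - \<kappa> * ?l powr p) ?l \<subseteq> Q h x0 t0 l0"
            using past_subset box_subset[OF ysQ lv_pos lv_le \<open>0 < l0\<close>] by blast
          show "(\<integral>\<^sup>+z\<in>Q h x0 t0 l0. ennreal (max 0 (u z - b0)) \<partial>\<Lambda>) \<le> ennreal (A * vol h x0 l0)"
            unfolding b0_def by (rule upper[OF \<open>0 < l0\<close>])
          show "(\<integral>\<^sup>+z\<in>Q h y (s - \<kappa> * ?l powr p) ?l. ennreal (max 0 (b y s ?l - u z)) \<partial>\<Lambda>) \<le>
              ennreal (A * vol h y ?l)"
            by (rule lower[OF lv_pos])
        qed (use A_pos vol_pos h_pos \<open>0 < l0\<close> lv_pos in \<open>auto simp: less_imp_le\<close>)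
        also have "\<dots> \<le> (A * (B * vol h y ?l) + A * vol h y ?l) / vol h y ?l"
          using volB A_pos vol_pos[OF lv_pos h_pos, of y "J z"]
          by (intro divide_right_mono add_mono mult_left_mono) auto
        also have "\<dots> = A * B + A"
          using vol_pos[OF lv_pos h_pos, of y "J z"] by (simp add: field_simps)
        also have "\<dots> \<le> M" using A_pos B(1) by (simp add: M_def)
        finally show False using stop_J[OF z] by (simp add: stop_def ys)
      qed
      \<comment> \<open>Selection is made with \<open>S\<close>, which contains the opposite half
        \<open>N\<close>. So the sets \<open>N\<close> inherit disjointness and stay in the half of
        the parent on which \<open>u\<close> is bounded above in mean.\<close>
      define S where "S z = Q L (fst z) (snd z) (lv (J z))" for z
      define N where "N z = Q h (fst z) (snd z - \<kappa> * lv (J z) powr p) (lv (J z))" for z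
      have N_S: "N z \<subseteq> S z" for z unfolding N_def S_def by (rule past_subset)
      have S_sub: "S z \<subseteq> Q h x0 t0 l0" if "z \<in> I" for z
        unfolding S_def
        by (rule box_subset[OF _ lv_pos lv_le \<open>0 < l0\<close>]) (use that E in \<open>auto simp: I_def\<close>)
      have sets_SN: "S z \<in> sets \<Lambda>" "N z \<in> sets \<Lambda>" for z
        unfolding S_def N_def by (intro Q_sets lv_pos)+
      obtain G where G: "G \<subseteq> I" "countable G" "disjoint_family_on S G"
        "\<And>w. w \<in> I \<Longrightarrow> \<exists>z\<in>G. S w \<inter> S z \<noteq> {} \<and> J z \<le> J w"
        by (rule vitali_covering[of I S \<Lambda> "Q h x0 t0 l0" J])
          (use sets_SN(1) S_sub \<open>0 < l0\<close> h_pos lv_pos L_pos vol_pos in \<open>auto simp: S_def emeasure_Q\<close>)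
      \<comment> \<open>Size of the ancestor \<open>n0\<close> scales above. It did not stop,
        because \<open>n0 > 0\<close> and the stopping index is least; hence its constant is at most
        \<open>b0 + M\<close>.\<close>
      define m where "m z = 2 ^ n0 * lv (J z)" for z
      have m_pos: "0 < m z" for z using lv_pos by (simp add: m_def)
      have m_lv: "m z = lv (J z - n0)" if "z \<in> I" for z
        using J_ge[OF that] by (simp add: m_def lv_def power_diff)
      define T where "T z = {w \<in> Q h (fst z) (snd z) (\<delta> * m z). b (fst z) (snd z) (m z) + real k * M' < u w}" for z
      have T_sets: "T z \<in> sets \<Lambda>" for z
        unfolding T_def using m_pos \<delta>_pos by (intro superlevel_sets Q_sets mult_pos_pos)
      have cover: "{z \<in> Q h x0 t0 (\<delta> * l0). b x0 t0 l0 + real (Suc k) * M' < u z} \<subseteq> Z \<union> (\<Union>z\<in>G. T z)"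
      proof
        fix w assume w: "w \<in> {z \<in> Q h x0 t0 (\<delta> * l0). b x0 t0 l0 + real (Suc k) * M' < u z}"
        have "0 \<le> real k * M'" using M by simp
        then have "w \<in> E" using w by (auto simp: E_def b0_def distrib_right)
        show "w \<in> Z \<union> (\<Union>z\<in>G. T z)"
        proof (cases "w \<in> I")
          case False
          then show ?thesis using \<open>w \<in> E\<close> Z(2) by (auto simp: I_def Bad_def)
        next
          case True
          then obtain z where z: "z \<in> G" "S w \<inter> S z \<noteq> {}" "J z \<le> J w" using G(4) by blast
          have "z \<in> I" using z(1) G(1) by blast
          have "(fst w, snd w) \<in> Q h (fst z) (snd z) (C * lv (J z))"
            by (rule center_mem_dilated_box[OF C L_pos h_pos lv_pos lv_anti[OF z(3)]]) (use z(2) in \<open>simp add: S_def\<close>)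
          then have "w \<in> Q h (fst z) (snd z) (\<delta> * m z)"
            by (simp add: C_def m_def mult_ac)
          moreover have "\<not> stop z (J z - n0)"
            using J_ge[OF \<open>z \<in> I\<close>] \<open>0 < n0\<close> by (intro not_stop) auto
          then have "b (fst z) (snd z) (m z) \<le> b0 + M"
            using m_lv[OF \<open>z \<in> I\<close>] by (simp add: stop_def)
          then have "b (fst z) (snd z) (m z) + real k * M' < u w"
            using w A_pos by (auto simp: b0_def M'_def algebra_simps)
          ultimately have "w \<in> T z" by (simp add: T_def)
          then show ?thesis using z(1) by blast
        qed
      qed
      \<comment> \<open>Total volume of the selected cylinders. On each opposite half the mean of
        the positive part of \<open>u - b0\<close> is at least
        \<open>M - A = 2 * A * B\<close>.\<close>
      define X where "X = (\<integral>\<^sup>+z. ennreal (vol h (fst z) (lv (J z))) \<partial>count_space G)"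
      have "ennreal (2 * A * B) * X = (\<integral>\<^sup>+z. ennreal (2 * A * B) * ennreal (vol h (fst z) (lv (J z))) \<partial>count_space G)"
        unfolding X_def by (rule nn_integral_cmult[symmetric]) auto
      also have "\<dots> \<le> (\<integral>\<^sup>+z. (\<integral>\<^sup>+w\<in>N z. ennreal (max 0 (u w - b0)) \<partial>\<Lambda>) \<partial>count_space G)"
      proof (rule nn_integral_mono)
        fix z assume "z \<in> space (count_space G)"
        then have "z \<in> I" using G(1) by auto
        define v where "v = vol h (fst z) (lv (J z))"
        have v: "0 < v" "emeasure \<Lambda> (N z) = ennreal v"
          using vol_pos lv_pos h_pos by (auto simp: v_def N_def emeasure_Q)
        let ?\<alpha> = "b (fst z) (snd z) (lv (J z))"
        have "ennreal (A * v) + ennreal (2 * A * B) * ennreal v = ennreal M * emeasure \<Lambda> (N z)"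
          using v A_pos B(1) by (simp add: M_def algebra_simps flip: ennreal_mult ennreal_plus)
        also have "\<dots> \<le> ennreal (?\<alpha> - b0) * emeasure \<Lambda> (N z)"
          using stop_J[OF \<open>z \<in> I\<close>] by (intro mult_right_mono ennreal_leI) (auto simp: stop_def)
        also have "\<dots> \<le> (\<integral>\<^sup>+w\<in>N z. ennreal (max 0 (?\<alpha> - u w)) \<partial>\<Lambda>) +
            (\<integral>\<^sup>+w\<in>N z. ennreal (max 0 (u w - b0)) \<partial>\<Lambda>)"
          by (rule gap_le_set_nn_integrals[OF sets_SN(2) u_measurable])
        also have "(\<integral>\<^sup>+w\<in>N z. ennreal (max 0 (?\<alpha> - u w)) \<partial>\<Lambda>) \<le> ennreal (A * v)"
          unfolding v_def N_def by (rule lower[OF lv_pos])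
        finally show "ennreal (2 * A * B) * ennreal (vol h (fst z) (lv (J z))) \<le>
            (\<integral>\<^sup>+w\<in>N z. ennreal (max 0 (u w - b0)) \<partial>\<Lambda>)"
          by (simp add: v_def ennreal_add_left_cancel_le add_right_mono)
      qed
      also have "\<dots> \<le> (\<integral>\<^sup>+w\<in>Q h x0 t0 l0. ennreal (max 0 (u w - b0)) \<partial>\<Lambda>)"
      proof (rule nn_integral_disjoint_le)
        show "disjoint_family_on N G"
          using G(3) N_S unfolding disjoint_family_on_def by blast
        show "N z \<subseteq> Q h x0 t0 l0" if "z \<in> G" for z
          using N_S S_sub that G(1) by blast
      qed (use G sets_SN in auto)
      also have "\<dots> \<le> ennreal (A * vol h x0 l0)"
        unfolding b0_def by (rule upper[OF \<open>0 < l0\<close>])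
      finally have X_le: "X \<le> ennreal (A * vol h x0 l0 / (2 * A * B))"
        using A_pos B(1) by (intro ennreal_mult_le_imp_le) auto
      have UT: "(\<Union>z\<in>G. T z) \<in> sets \<Lambda>"
        using G(2) T_sets by (intro sets.countable_UN') auto
      have "emeasure \<Lambda> {z \<in> Q h x0 t0 (\<delta> * l0). b x0 t0 l0 + real (Suc k) * M' < u z} \<le>
          emeasure \<Lambda> (Z \<union> (\<Union>z\<in>G. T z))"
        using cover Z(1) UT by (intro emeasure_mono sets.Un) auto
      also have "\<dots> = emeasure \<Lambda> (\<Union>z\<in>G. T z)"
        using emeasure_Un_null_set[OF UT Z(1)] by (simp add: Un_commute)
      also have "\<dots> \<le> (\<integral>\<^sup>+z. emeasure \<Lambda> (T z) \<partial>count_space G)"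
        using G(2) T_sets by (intro emeasure_UN_le) auto
      \<comment> \<open>The induction hypothesis at the ancestor gives \<open>(1 / 2) ^ k\<close>;
        passing from its volume to that at the stopping scale costs \<open>B\<close>.\<close>
      also have "\<dots> \<le> (\<integral>\<^sup>+z. ennreal ((1 / 2) ^ k * B) * ennreal (vol h (fst z) (lv (J z))) \<partial>count_space G)"
      proof (rule nn_integral_mono)
        fix z
        have "emeasure \<Lambda> (T z) \<le> ennreal ((1 / 2) ^ k * vol h (fst z) (m z))"
          unfolding T_def using Suc m_pos by blast
        also have "\<dots> \<le> ennreal ((1 / 2) ^ k * (B * vol h (fst z) (lv (J z))))"
          using C' lv_pos[of "J z"] by (intro ennreal_leI mult_left_mono B(2))
            (auto simp: m_def dist_refl)
        also have "\<dots> = ennreal ((1 / 2) ^ k * B) * ennreal (vol h (fst z) (lv (J z)))"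
          using B(1) vol_pos[OF lv_pos h_pos, of "fst z" "J z"] by (simp add: mult.assoc flip: ennreal_mult)
        finally show "emeasure \<Lambda> (T z) \<le> ennreal ((1 / 2) ^ k * B) * ennreal (vol h (fst z) (lv (J z)))" .
      qed
      also have "\<dots> = ennreal ((1 / 2) ^ k * B) * X"
        unfolding X_def by (rule nn_integral_cmult) auto
      also have "\<dots> \<le> ennreal ((1 / 2) ^ k * B) * ennreal (A * vol h x0 l0 / (2 * A * B))"
        by (rule mult_left_mono[OF X_le]) simp
      also have "\<dots> = ennreal ((1 / 2) ^ Suc k * vol h x0 l0)"
        using B(1) A_pos vol_pos[OF \<open>0 < l0\<close> h_pos, of x0] by (simp flip: ennreal_mult)
      finally show "emeasure \<Lambda> {z \<in> Q h x0 t0 (\<delta> * l0). b x0 t0 l0 + real (Suc k) * M' < u z} \<le>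
          ennreal ((1 / 2) ^ Suc k * vol h x0 l0)" .
    qed
  qed
  show thesis
    using that[of M'] M decay by blast
qed

text \<open>Each further level \<open>M\<close> halves the bound on the measure, so summation over
  layers gives \<open>\<epsilon> = ln (3 / 2) / M\<close>.\<close>

lemma exp_local:
  obtains \<epsilon> where "0 < \<epsilon>"
    "\<And>x t l. 0 < l \<Longrightarrow>
      (\<integral>\<^sup>+z\<in>Q h x t (\<delta> * l). ennreal (exp (\<epsilon> * max 0 (u z - b x t l))) \<partial>\<Lambda>) \<le> ennreal (7 * vol h x l)"
proof -
  obtain M where M: "0 < M"
    "\<And>(k::nat) x t l. 0 < l \<Longrightarrow>
      emeasure \<Lambda> {z \<in> Q h x t (\<delta> * l). b x t l + real k * M < u z} \<le> ennreal ((1 / 2) ^ k * vol h x l)"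
    using superlevel_decay by blast
  have "(\<integral>\<^sup>+z\<in>Q h x t (\<delta> * l). ennreal (exp (ln (3 / 2) / M * max 0 (u z - b x t l))) \<partial>\<Lambda>) \<le>
      ennreal (7 * vol h x l)" if "0 < l" for x t l
  proof (rule exp_set_nn_integral_le)
    show "Q h x t (\<delta> * l) \<in> sets \<Lambda>" using that \<delta>_pos by (intro Q_sets) simp
    have "Q h x t (\<delta> * l) \<subseteq> Q h x t l"
      using Q_mono_scale[of h "\<delta> * l" l] h_pos \<delta>_pos \<delta>_le that by simp
    then have "emeasure \<Lambda> (Q h x t (\<delta> * l)) \<le> emeasure \<Lambda> (Q h x t l)"
      using that by (intro emeasure_mono) auto
    then show "emeasure \<Lambda> (Q h x t (\<delta> * l)) \<le> ennreal (vol h x l)"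
      using that h_pos by (simp add: emeasure_Q)
    fix k :: nat
    have "{z \<in> Q h x t (\<delta> * l). real k * M < u z - b x t l} =
        {z \<in> Q h x t (\<delta> * l). b x t l + real k * M < u z}" by auto
    then show "emeasure \<Lambda> {z \<in> Q h x t (\<delta> * l). real k * M < u z - b x t l} \<le>
        ennreal ((1 / 2) ^ k * vol h x l)"
      using M(2)[OF that, of x t k] by simp
  qed (use M(1) vol_pos[OF that h_pos, of x] in auto)
  moreover have "0 < ln (3 / 2) / M" using M(1) by simp
  ultimately show thesis using that by blast
qed

end

section \<open>Chains and the John--Nirenberg inequality\<close>

text \<open>Each step brings the path closer to \<open>y\<close> by at least \<open>s\<close>, so it
  arrives after at most \<open>\<rho> x y / s\<close> steps; resting at \<open>y\<close> then allows
  any larger number of steps. The summand 1 covers \<open>\<rho> x y < s\<close>, where the path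
  jumps to \<open>y\<close> at once.\<close>

lemma monotone_geodesic_path:
  assumes "monotone_geodesic \<rho>" and nonneg: "\<And>x y. 0 \<le> \<rho> x y" and refl: "\<And>x. \<rho> x x = 0"
  obtains K where "1 \<le> K"
    "\<And>s x y. 0 < s \<Longrightarrow> \<exists>c::nat \<Rightarrow> 'a. c 0 = x \<and> (\<forall>i. \<rho> (c i) (c (Suc i)) \<le> K * s) \<and>
      (\<forall>i. \<rho> x y / s + 1 \<le> real i \<longrightarrow> c i = y)"
proof -
  obtain K0 where K0: "K0 > 0" "\<And>s x y. 0 < s \<Longrightarrow> s \<le> \<rho> x y \<Longrightarrow>
      \<exists>(m::nat) (c :: nat \<Rightarrow> 'a). c 0 = x \<and> c m = y \<and>
        (\<forall>i<m. \<rho> (c i) (c (Suc i)) \<le> K0 * s \<and> \<rho> (c (Suc i)) (c m) \<le> \<rho> (c i) (c m) - s)"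
    using assms(1) unfolding monotone_geodesic_def by metis
  define K where "K = max 1 K0"
  have "\<exists>c::nat \<Rightarrow> 'a. c 0 = x \<and> (\<forall>i. \<rho> (c i) (c (Suc i)) \<le> K * s) \<and>
      (\<forall>i. \<rho> x y / s + 1 \<le> real i \<longrightarrow> c i = y)" if "0 < s" for s x y
  proof (cases "s \<le> \<rho> x y")
    case True
    obtain m and c :: "nat \<Rightarrow> 'a" where c: "c 0 = x" "c m = y"
      "\<And>i. i < m \<Longrightarrow> \<rho> (c i) (c (Suc i)) \<le> K0 * s"
      "\<And>i. i < m \<Longrightarrow> \<rho> (c (Suc i)) (c m) \<le> \<rho> (c i) (c m) - s"
      using K0(2)[OF \<open>0 < s\<close> True] by blast
    have "i \<le> m \<Longrightarrow> \<rho> (c i) (c m) \<le> \<rho> x y - real i * s" for i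
    proof (induction i)
      case (Suc i)
      then show ?case using c(4)[of i] by (simp add: algebra_simps)
    qed (use c in simp)
    from this[of m] have "real m * s \<le> \<rho> x y" by (simp add: refl)
    then have m: "real m \<le> \<rho> x y / s" using \<open>0 < s\<close> by (simp add: field_simps)
    have "K0 * s \<le> K * s" "0 \<le> K * s" using \<open>0 < s\<close> by (auto simp: K_def mult_right_mono)
    then have "\<rho> (c (min i m)) (c (min (Suc i) m)) \<le> K * s" for i
      using c(3)[of i] refl by (cases "i < m") (auto simp: min_def)
    moreover have "c (min i m) = y" if "\<rho> x y / s + 1 \<le> real i" for i
      using m that c(2) by (simp add: min_def)
    ultimately show ?thesis using c(1) by (intro exI[of _ "\<lambda>i. c (min i m)"]) simp
  next
    case False
    define c where "c i = (if i = 0 then x else y)" for i :: nat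
    have "s \<le> K * s" "0 \<le> K * s" using \<open>0 < s\<close> by (auto simp: K_def)
    then have "\<rho> (c i) (c (Suc i)) \<le> K * s" for i
      using False refl by (auto simp: c_def)
    moreover have "c i = y" if "\<rho> x y / s + 1 \<le> real i" for i
    proof -
      have "0 \<le> \<rho> x y / s" using nonneg \<open>0 < s\<close> by simp
      then show ?thesis using that by (auto simp: c_def)
    qed
    ultimately show ?thesis by (intro exI[of _ c]) (simp add: c_def)
  qed
  moreover have "1 \<le> K" by (simp add: K_def)
  ultimately show thesis using that by blast
qed

section \<open>Chains of overlapping cylinders\<close>

context parabolic_bmo
begin

text \<open>When the time shift is close to \<open>\<kappa> * l powr p\<close>, the half of the
  cylinder at \<open>(y', s')\<close> that bounds \<open>u\<close> above and the opposite half of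
  that at \<open>(y, s)\<close> share a box of size proportional to \<open>l\<close>. The tolerance
  \<open>h / 2\<close> later lets a whole number of steps fill a prescribed time.\<close>

lemma const_step:
  obtains C where "0 \<le> C"
    "\<And>y y' s s' l. 0 < l \<Longrightarrow> \<rho> y y' \<le> l / (2 * K) \<Longrightarrow> \<bar>s - s' - \<kappa> * l powr p\<bar> \<le> h / 2 * l powr p \<Longrightarrow>
      b y s l \<le> b y' s' l + C"
proof -
  \<comment> \<open>Two distances of at most \<open>\<zeta> * l\<close> stay within \<open>l\<close>
    by the quasi-triangle inequality, and \<open>\<zeta> powr p \<le> 1 / 2\<close> leaves half of
    the height \<open>h\<close> for the time tolerance.\<close>
  define \<zeta> where "\<zeta> = 1 / (2 * K)"
  have \<zeta>: "0 < \<zeta>" "\<zeta> \<le> 1 / 2" "2 * K * \<zeta> = 1" using K_ge_1 by (auto simp: \<zeta>_def)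
  have "0 < 2 * K" using K_ge_1 by simp
  then obtain B where B: "0 < B"
    "\<And>y y' l l'. 0 < l \<Longrightarrow> 0 < l' \<Longrightarrow> l' \<le> 2 * K * l \<Longrightarrow> \<rho> y y' \<le> 2 * K * l \<Longrightarrow>
      vol h y l' \<le> B * vol h y' l"
    using vol_compare[OF h_pos h_pos] by metis
  have "b y s l \<le> b y' s' l + 2 * A * B"
    if l: "0 < l" and dist: "\<rho> y y' \<le> l / (2 * K)"
      and time: "\<bar>s - s' - \<kappa> * l powr p\<bar> \<le> h / 2 * l powr p" for y y' s s' l
  proof -
    have \<zeta>l: "0 < \<zeta> * l" "\<zeta> * l \<le> l" using \<zeta> l by auto
    have "2 * K * (\<zeta> * l) = 2 * K * \<zeta> * l" by (simp only: mult.assoc)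
    then have KK: "2 * K * (\<zeta> * l) = l" by (simp only: \<zeta>(3) mult_1)
    have dist': "\<rho> y y' \<le> \<zeta> * l" using dist by (simp add: \<zeta>_def)
    have v: "0 < vol h y' (\<zeta> * l)" using \<zeta>l h_pos by (intro vol_pos)
    have "b y s l - b y' s' l \<le> (A * vol h y' l + A * vol h y l) / vol h y' (\<zeta> * l)"
    proof (rule gap_le)
      show "emeasure \<Lambda> (Q h y' s' (\<zeta> * l)) = ennreal (vol h y' (\<zeta> * l))"
        using \<zeta>l h_pos by (intro emeasure_Q)
      show "Q h y' s' (\<zeta> * l) \<subseteq> Q h y' s' l"
        using \<zeta>l h_pos by (intro Q_mono_scale) auto
      show "Q h y' s' (\<zeta> * l) \<subseteq> Q h y (s - \<kappa> * l powr p) l"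
      proof safe
        fix z t assume z: "(z, t) \<in> Q h y' s' (\<zeta> * l)"
        have "\<rho> y z \<le> K * (\<rho> y y' + \<rho> y' z)" by (rule dist_triangle)
        also have "\<dots> < K * (\<zeta> * l + \<zeta> * l)"
          using z dist' K_ge_1 by (intro mult_strict_left_mono add_le_less_mono) (auto simp: mem_Q)
        also have "\<dots> = 2 * K * (\<zeta> * l)" by simp
        also note KK
        finally have 1: "\<rho> y z < l" .
        have "\<bar>t - s'\<bar> < h * (\<zeta> * l) powr p" using z by (simp add: mem_Q)
        also have "\<dots> = h * (\<zeta> powr p * l powr p)" using \<zeta> l by (simp add: powr_mult)
        also have "\<dots> \<le> h * (1 / 2 * l powr p)"
        proof (intro mult_left_mono mult_right_mono)
          have "\<zeta> powr p \<le> \<zeta> powr 1" using \<zeta> p_gt_1 by (intro powr_mono') auto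
          then show "\<zeta> powr p \<le> 1 / 2" using \<zeta> by simp
        qed (use h_pos in auto)
        finally have "\<bar>t - s'\<bar> < h / 2 * l powr p" by simp
        then have "\<bar>t - (s - \<kappa> * l powr p)\<bar> < h / 2 * l powr p + h / 2 * l powr p"
          using time by linarith
        then show "(z, t) \<in> Q h y (s - \<kappa> * l powr p) l" using 1 by (simp add: mem_Q)
      qed
      show "(\<integral>\<^sup>+z\<in>Q h y' s' l. ennreal (max 0 (u z - b y' s' l)) \<partial>\<Lambda>) \<le> ennreal (A * vol h y' l)"
        by (rule upper[OF l])
      show "(\<integral>\<^sup>+z\<in>Q h y (s - \<kappa> * l powr p) l. ennreal (max 0 (b y s l - u z)) \<partial>\<Lambda>) \<le> ennreal (A * vol h y l)"
        by (rule lower[OF l])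
    qed (use \<zeta>l v A_pos vol_pos[OF l h_pos] in \<open>auto simp: less_imp_le\<close>)
    also have "\<dots> \<le> (A * (B * vol h y' (\<zeta> * l)) + A * (B * vol h y' (\<zeta> * l))) / vol h y' (\<zeta> * l)"
    proof (intro divide_right_mono add_mono mult_left_mono)
      have near: "l \<le> 2 * K * (\<zeta> * l)" "\<rho> y' y' \<le> 2 * K * (\<zeta> * l)" "\<rho> y y' \<le> 2 * K * (\<zeta> * l)"
        unfolding KK using l order_trans[OF dist' \<zeta>l(2)] by (simp_all add: dist_refl)
      show "vol h y' l \<le> B * vol h y' (\<zeta> * l)" "vol h y l \<le> B * vol h y' (\<zeta> * l)"
        by (rule B(2)[OF \<zeta>l(1) l near(1)]; rule near)+
    qed (use A_pos v in auto)
    also have "\<dots> = 2 * A * B" using v by (simp add: field_simps)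
    finally show ?thesis by simp
  qed
  moreover have "0 \<le> 2 * A * B" using A_pos B(1) by simp
  ultimately show thesis using that by blast
qed

lemma const_chain:
  assumes "0 < l" "\<And>i. \<rho> (c (Suc i)) (c i) \<le> l / (2 * K)" "\<bar>\<tau> - \<kappa> * l powr p\<bar> \<le> h / 2 * l powr p"
    and C: "\<And>y y' s s' l. 0 < l \<Longrightarrow> \<rho> y y' \<le> l / (2 * K) \<Longrightarrow>
      \<bar>s - s' - \<kappa> * l powr p\<bar> \<le> h / 2 * l powr p \<Longrightarrow> b y s l \<le> b y' s' l + C"
  shows "b (c n) (s + real n * \<tau>) l \<le> b (c 0) s l + real n * C"
proof (induction n)
  case (Suc n)
  have "b (c (Suc n)) (s + real (Suc n) * \<tau>) l \<le> b (c n) (s + real n * \<tau>) l + C"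
    by (rule C) (use assms in \<open>auto simp: algebra_simps\<close>)
  then show ?case using Suc by (simp add: algebra_simps)
qed simp

text \<open>A chain of \<open>n\<close> cylinders of radius \<open>\<theta> l\<close> covers the spatial distance \<open>n \<theta> l\<close> and takes
  the time \<open>n (\<theta> l)^p\<close>. Since \<open>p > 1\<close>, a small \<open>\<theta>\<close> allows it to reach any point of the ball
  within the time lag \<open>\<gamma> l^p\<close>.\<close>

lemma const_le_reference:
  assumes geo: "monotone_geodesic \<rho>" and \<kappa>: "\<kappa> = \<sigma> * k" "\<bar>\<sigma>\<bar> = 1" "0 < k" and "0 < \<gamma>"
  obtains \<theta>0 where "0 < \<theta>0" "\<theta>0 \<le> 1"
    "\<And>\<theta>. 0 < \<theta> \<Longrightarrow> \<theta> \<le> \<theta>0 \<Longrightarrow> \<exists>C\<ge>0. \<forall>x y t t' s l. 0 < l \<longrightarrow> \<rho> x y < l \<longrightarrow>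
      \<gamma> * l powr p \<le> \<sigma> * (s - t) \<longrightarrow> \<sigma> * (s - t) \<le> l powr p \<longrightarrow> \<bar>t' - t\<bar> \<le> k * (\<theta> * l) powr p \<longrightarrow>
      b y s (\<theta> * l) \<le> b x t' (\<theta> * l) + C"
proof -
  obtain K' where K': "1 \<le> K'" "\<And>s x y. 0 < s \<Longrightarrow> \<exists>c::nat \<Rightarrow> 'a. c 0 = x \<and>
      (\<forall>i. \<rho> (c i) (c (Suc i)) \<le> K' * s) \<and> (\<forall>i. \<rho> x y / s + 1 \<le> real i \<longrightarrow> c i = y)"
    using monotone_geodesic_path[OF geo dist_nonneg dist_refl] by metis
  obtain C where C: "0 \<le> C" "\<And>y y' s s' l. 0 < l \<Longrightarrow> \<rho> y y' \<le> l / (2 * K) \<Longrightarrow>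
      \<bar>s - s' - \<kappa> * l powr p\<bar> \<le> h / 2 * l powr p \<Longrightarrow> b y s l \<le> b y' s' l + C"
    using const_step by metis
  have \<sigma>\<sigma>: "\<sigma> * \<sigma> = 1" using \<kappa>(2) by (metis abs_mult_self_eq mult_1)
  \<comment> \<open>Budget for the number of steps: \<open>2 * K * K'\<close> over
    \<open>\<theta>\<close> to bridge the distance \<open>l\<close>, \<open>2 * k / h\<close> to
    spread the rounding of the time, and 3 for the displacement of \<open>t'\<close>, the rounding
    of the number of steps and the summand 1 in the path length.\<close>
  define c1 where "c1 = 3 + 2 * k / h + 2 * K * K'"
  have "0 < 2 * k / h" "0 < 2 * K * K'" using \<kappa> h_pos K_ge_1 K' by auto
  then have c1: "0 < c1" by (simp add: c1_def)
  \<comment> \<open>It gives \<open>\<theta> powr (p - 1) \<le> \<gamma> / (c1 * k)\<close>: the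
    \<open>\<gamma> / (k * \<theta> powr p)\<close> steps for which there is time exceed the
    required \<open>c1 / \<theta>\<close>.\<close>
  define \<theta>0 where "\<theta>0 = min 1 ((\<gamma> / (c1 * k)) powr (1 / (p - 1)))"
  have \<theta>0: "0 < \<theta>0" "\<theta>0 \<le> 1" using \<open>0 < \<gamma>\<close> c1 \<kappa> by (auto simp: \<theta>0_def)
  have main: "b y s (\<theta> * l) \<le> b x t' (\<theta> * l) + (1 / (k * \<theta> powr p) + 1) * C"
    if \<theta>: "0 < \<theta>" "\<theta> \<le> \<theta>0" and l: "0 < l" and xy: "\<rho> x y < l"
      and s: "\<gamma> * l powr p \<le> \<sigma> * (s - t)" "\<sigma> * (s - t) \<le> l powr p"
      and t': "\<bar>t' - t\<bar> \<le> k * (\<theta> * l) powr p" for \<theta> x y t t' s l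
  proof -
    define r where "r = \<theta> * l"
    have r: "0 < r" "r powr p = \<theta> powr p * l powr p" using \<theta> l by (auto simp: r_def powr_mult)
    have rp: "0 < r powr p" "0 < l powr p" "0 < \<theta> powr p" using r l \<theta> by auto
    have \<theta>p: "\<theta> powr p \<le> \<theta> * (\<gamma> / (c1 * k))"
    proof -
      have "\<theta> powr (p - 1) \<le> ((\<gamma> / (c1 * k)) powr (1 / (p - 1))) powr (p - 1)"
        using \<theta> p_gt_1 by (intro powr_mono2) (auto simp: \<theta>0_def)
      also have "\<dots> = \<gamma> / (c1 * k)" using p_gt_1 \<open>0 < \<gamma>\<close> c1 \<kappa> by (simp add: powr_powr)
      finally have "\<theta> * \<theta> powr (p - 1) \<le> \<theta> * (\<gamma> / (c1 * k))" using \<theta> by (intro mult_left_mono) auto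
      moreover have "\<theta> * \<theta> powr (p - 1) = \<theta> powr p" using \<theta> by (simp add: powr_diff)
      ultimately show ?thesis by simp
    qed
    have "c1 / \<theta> \<le> \<gamma> / (k * \<theta> powr p)"
      using \<theta>p \<theta> c1 \<kappa> rp \<open>0 < \<gamma>\<close> by (simp add: field_simps)
    moreover have "3 + 2 * k / h + 2 * K * K' / \<theta> \<le> c1 / \<theta>"
    proof -
      have "(3 + 2 * k / h) * \<theta> \<le> (3 + 2 * k / h) * 1"
        using \<theta> \<theta>0 \<open>0 < 2 * k / h\<close> by (intro mult_left_mono) auto
      then have "(3 + 2 * k / h) * \<theta> + 2 * K * K' \<le> c1" by (simp add: c1_def)
      then have "((3 + 2 * k / h) * \<theta> + 2 * K * K') / \<theta> \<le> c1 / \<theta>"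
        using \<theta> by (intro divide_right_mono) auto
      then show ?thesis using \<theta> by (simp add: add_divide_distrib)
    qed
    ultimately have big: "3 + 2 * k / h + 2 * K * K' / \<theta> \<le> \<gamma> / (k * \<theta> powr p)" by simp
    define T where "T = s - t'"
    \<comment> \<open>Elapsed time in units of the natural step \<open>k * r powr p\<close>. Its
      integer part \<open>n\<close> is the number of steps; dividing the time evenly keeps each
      within the tolerance, because \<open>X - n < 1\<close> and
      \<open>n \<ge> 2 * k / h\<close>.\<close>
    define X where "X = \<sigma> * T / (k * r powr p)"
    have kr: "0 < k * r powr p" using \<kappa> rp by simp
    have \<sigma>T: "\<bar>\<sigma> * T - \<sigma> * (s - t)\<bar> \<le> k * r powr p"
    proof -
      have "\<sigma> * T - \<sigma> * (s - t) = - (\<sigma> * (t' - t))" by (simp add: T_def algebra_simps)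
      then show ?thesis using t' \<kappa>(2) by (simp add: abs_mult r_def)
    qed
    have "\<gamma> / (k * \<theta> powr p) - 1 = (\<gamma> * l powr p - k * r powr p) / (k * r powr p)"
      using kr rp \<kappa> by (simp add: r(2) field_simps)
    also have "\<dots> \<le> X" unfolding X_def using s \<sigma>T kr by (intro divide_right_mono) auto
    finally have X_ge: "2 + 2 * k / h + 2 * K * K' / \<theta> \<le> X" using big by linarith
    have "X \<le> (l powr p + k * r powr p) / (k * r powr p)"
      unfolding X_def using s \<sigma>T kr by (intro divide_right_mono) auto
    also have "\<dots> = 1 / (k * \<theta> powr p) + 1" using kr rp \<kappa> by (simp add: r(2) field_simps)
    finally have X_le: "X \<le> 1 / (k * \<theta> powr p) + 1" .
    have K\<theta>: "0 < 2 * K * K' / \<theta>" using \<open>0 < 2 * K * K'\<close> \<theta> by simp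
    define n where "n = nat \<lfloor>X\<rfloor>"
    have n: "real n \<le> X" "X < real n + 1"
      using X_ge K\<theta> \<open>0 < 2 * k / h\<close> unfolding n_def by linarith+
    then have n_ge: "2 * k / h \<le> real n" "2 * K * K' / \<theta> + 1 \<le> real n"
      using X_ge K\<theta> \<open>0 < 2 * k / h\<close> by linarith+
    have n_pos: "0 < real n" using n_ge K\<theta> by linarith
    define \<tau> where "\<tau> = T / real n"
    have T_eq: "T = \<sigma> * (X * (k * r powr p))"
    proof -
      have "X * (k * r powr p) = \<sigma> * T"
        unfolding X_def using kr by (metis less_irrefl nonzero_eq_divide_eq)
      then show ?thesis using \<sigma>\<sigma> by (simp flip: mult.assoc)
    qed
    have "\<tau> - \<kappa> * r powr p = \<sigma> * (k * r powr p * ((X - real n) / real n))"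
      using n_pos by (simp add: \<tau>_def T_eq \<kappa>(1) field_simps)
    then have "\<bar>\<tau> - \<kappa> * r powr p\<bar> = k * r powr p * ((X - real n) / real n)"
      using n kr n_pos \<kappa>(2,3) by (simp add: abs_mult)
    also have "\<dots> \<le> k * r powr p * (1 / (2 * k / h))"
      using n n_ge kr \<open>0 < 2 * k / h\<close> by (intro mult_left_mono frac_le) auto
    also have "\<dots> = h / 2 * r powr p" using \<kappa> h_pos by simp
    finally have \<tau>: "\<bar>\<tau> - \<kappa> * r powr p\<bar> \<le> h / 2 * r powr p" .
    \<comment> \<open>With this geodesic parameter consecutive points are at most
      \<open>r / (2 * K)\<close> apart, as \<open>const_step\<close> demands.\<close>
    define s0 where "s0 = r / (2 * K * K')"
    have s0: "0 < s0" "K' * s0 = r / (2 * K)" using r K_ge_1 K' by (auto simp: s0_def)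
    obtain c where c: "c 0 = x" "\<And>i. \<rho> (c i) (c (Suc i)) \<le> K' * s0"
      "\<And>i. \<rho> x y / s0 + 1 \<le> real i \<Longrightarrow> c i = y"
      using K'(2)[OF s0(1), of x y] by blast
    have "\<rho> x y / s0 \<le> l / s0" using xy s0 by (intro divide_right_mono) auto
    also have "\<dots> = 2 * K * K' / \<theta>" using l \<theta> K_ge_1 K' by (simp add: s0_def r_def)
    finally have "c n = y" using n_ge by (intro c(3)) linarith
    have "b (c n) (t' + real n * \<tau>) r \<le> b (c 0) t' r + real n * C"
      by (rule const_chain[OF r(1) _ \<tau> C(2)]) (use c(2) s0 in \<open>auto simp: dist_sym\<close>)
    moreover have "t' + real n * \<tau> = s" using n_pos by (simp add: \<tau>_def T_def)
    moreover have "real n * C \<le> (1 / (k * \<theta> powr p) + 1) * C"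
      using n X_le C(1) by (intro mult_right_mono) auto
    ultimately show ?thesis using \<open>c n = y\<close> c(1) by (simp add: r_def)
  qed
  show thesis
  proof (rule that[OF \<theta>0])
    fix \<theta> assume \<theta>: "0 < \<theta>" "\<theta> \<le> \<theta>0"
    have "0 \<le> (1 / (k * \<theta> powr p) + 1) * C" using \<kappa> C by simp
    then show "\<exists>C\<ge>0. \<forall>x y t t' s l. 0 < l \<longrightarrow> \<rho> x y < l \<longrightarrow>
      \<gamma> * l powr p \<le> \<sigma> * (s - t) \<longrightarrow> \<sigma> * (s - t) \<le> l powr p \<longrightarrow> \<bar>t' - t\<bar> \<le> k * (\<theta> * l) powr p \<longrightarrow>
      b y s (\<theta> * l) \<le> b x t' (\<theta> * l) + C"
      using main[OF \<theta>] by (intro exI[of _ "(1 / (k * \<theta> powr p) + 1) * C"]) auto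
  qed
qed

text \<open>Each covering box has size \<open>\<delta> * \<theta> * l\<close> and is controlled by
  the local estimate at scale \<open>\<theta> * l\<close> about its own centre. Replacing its
  constant by the common \<open>c\<close> costs \<open>exp (\<epsilon> * C)\<close>, and smaller
  disjoint boxes bound the total volume.\<close>

lemma exp_region:
  assumes \<epsilon>: "0 < \<epsilon>" and local: "\<And>x t l. 0 < l \<Longrightarrow>
      (\<integral>\<^sup>+z\<in>Q h x t (\<delta> * l). ennreal (exp (\<epsilon> * max 0 (u z - b x t l))) \<partial>\<Lambda>) \<le> ennreal (7 * vol h x l)"
    and "0 < \<theta>" "\<theta> \<le> 1" "0 < H" "0 \<le> C"
  obtains B where "0 < B"
    "\<forall>x s0 l c. 0 < l \<longrightarrow> (\<forall>y s. (y, s) \<in> Q H x s0 l \<longrightarrow> b y s (\<theta> * l) \<le> c + C) \<longrightarrow>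
      (\<integral>\<^sup>+z\<in>Q H x s0 l. ennreal (exp (\<epsilon> * max 0 (u z - c))) \<partial>\<Lambda>) \<le> ennreal (B * vol H x l)"
proof -
  define C2 where "C2 = 3 * K + 2"
  have C2: "1 \<le> C2" "3 * K \<le> C2" "2 * h \<le> h * C2" using K_ge_1 h_pos by (auto simp: C2_def)
  \<comment> \<open>Dilation by \<open>C2\<close> takes the disjoint boxes of size
    \<open>\<eta> * l\<close> to the size \<open>\<delta> * \<theta> * l\<close> of the local
    estimate.\<close>
  define \<eta> where "\<eta> = \<delta> * \<theta> / C2"
  have \<eta>: "0 < \<eta>" using C2 \<delta>_pos \<open>0 < \<theta>\<close> by (simp add: \<eta>_def)
  have "\<eta> \<le> 1"
  proof -
    have "\<delta> * \<theta> \<le> 1 * 1" using \<delta>_pos \<delta>_le assms by (intro mult_mono) auto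
    then show ?thesis using C2 by (simp add: \<eta>_def divide_le_eq)
  qed
  have "0 < \<theta> / \<eta>" using \<eta> \<open>0 < \<theta>\<close> by simp
  then obtain B1 where B1: "0 < B1" "\<And>y y' l l'. 0 < l \<Longrightarrow> 0 < l' \<Longrightarrow> l' \<le> \<theta> / \<eta> * l \<Longrightarrow>
      \<rho> y y' \<le> \<theta> / \<eta> * l \<Longrightarrow> vol h y l' \<le> B1 * vol h y' l"
    using vol_compare[OF h_pos h_pos] by metis
  have "0 < H + h" "0 < 2 * K" using h_pos assms K_ge_1 by auto
  then obtain B2 where B2: "0 < B2" "\<And>y y' l l'. 0 < l \<Longrightarrow> 0 < l' \<Longrightarrow> l' \<le> 2 * K * l \<Longrightarrow>
      \<rho> y y' \<le> 2 * K * l \<Longrightarrow> vol (H + h) y l' \<le> B2 * vol H y' l"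
    using vol_compare[OF \<open>0 < H\<close>] by metis
  define B where "B = exp (\<epsilon> * C) * 7 * B1 * B2"
  have "(\<integral>\<^sup>+z\<in>Q H x s0 l. ennreal (exp (\<epsilon> * max 0 (u z - c))) \<partial>\<Lambda>) \<le> ennreal (B * vol H x l)"
    if l: "0 < l" and b_le: "\<And>y s. (y, s) \<in> Q H x s0 l \<Longrightarrow> b y s (\<theta> * l) \<le> c + C" for x s0 l c
  proof -
    \<comment> \<open>Boxes centred near the edge protrude from the region, so their volumes are
      counted in a larger box.\<close>
    define W where "W = Q (H + h) x s0 (2 * K * l)"
    have Kl: "0 < 2 * K * l" "l \<le> 2 * K * l" using K_ge_1 l by auto
    define S where "S z = Q h (fst z) (snd z) (\<eta> * l)" for z
    define T where "T z = Q h (fst z) (snd z) (\<delta> * (\<theta> * l))" for z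
    have \<eta>l: "0 < \<eta> * l" "\<eta> * l \<le> l" using \<eta> \<open>\<eta> \<le> 1\<close> l by auto
    have \<theta>l: "0 < \<theta> * l" "0 < \<delta> * (\<theta> * l)" using \<delta>_pos assms l by auto
    have S_sets: "S z \<in> sets \<Lambda>" and T_sets: "T z \<in> sets \<Lambda>" for z
      unfolding S_def T_def using \<eta>l \<theta>l by (auto intro: Q_sets)
    have S_W: "S z \<subseteq> W" if z: "z \<in> Q H x s0 l" for z
    proof safe
      fix w t assume w: "(w, t) \<in> S z"
      obtain y s where ys: "z = (y, s)" by fastforce
      have "\<rho> x w \<le> K * (\<rho> x y + \<rho> y w)" by (rule dist_triangle)
      also have "\<dots> < K * (l + l)"
        using z w \<eta>l K_ge_1 by (intro mult_strict_left_mono add_strict_mono) (auto simp: ys S_def mem_Q)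
      finally have 1: "\<rho> x w < 2 * K * l" by simp
      have "\<bar>t - s0\<bar> < h * (\<eta> * l) powr p + H * l powr p"
        using z w by (auto simp: ys S_def mem_Q)
      also have "\<dots> \<le> h * (2 * K * l) powr p + H * (2 * K * l) powr p"
        using \<eta>l Kl h_pos assms p_gt_1 l by (intro add_mono mult_left_mono powr_mono2) auto
      also have "\<dots> = (H + h) * (2 * K * l) powr p" by (simp add: algebra_simps)
      finally show "(w, t) \<in> W" using 1 by (simp add: W_def mem_Q)
    qed
    obtain G where G: "G \<subseteq> Q H x s0 l" "countable G" "disjoint_family_on S G"
      "\<And>w. w \<in> Q H x s0 l \<Longrightarrow> \<exists>z\<in>G. S w \<inter> S z \<noteq> {} \<and> (0::nat) \<le> 0"
    proof (rule vitali_covering[of "Q H x s0 l" S \<Lambda> W "\<lambda>_. 0"])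
      show "W \<in> sets \<Lambda>" "emeasure \<Lambda> W < \<infinity>"
        unfolding W_def using Kl \<open>0 < H + h\<close> by (auto simp: emeasure_Q)
      show "0 < emeasure \<Lambda> (S z)" for z
        unfolding S_def using \<eta>l h_pos vol_pos by (simp add: emeasure_Q)
    qed (use S_sets S_W that in auto)
    have cover: "Q H x s0 l \<subseteq> (\<Union>z\<in>G. T z)"
    proof
      fix w assume "w \<in> Q H x s0 l"
      then obtain z where z: "z \<in> G" "S w \<inter> S z \<noteq> {}" using G(4) by blast
      have "(fst w, snd w) \<in> Q h (fst z) (snd z) (C2 * (\<eta> * l))"
        by (rule center_mem_dilated_box[OF C2 h_pos h_pos \<eta>l(1) order_refl]) (use z(2) in \<open>simp add: S_def\<close>)
      moreover have "C2 * (\<eta> * l) = \<delta> * (\<theta> * l)" using C2 by (simp add: \<eta>_def)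
      ultimately show "w \<in> (\<Union>z\<in>G. T z)" using z(1) by (auto simp: T_def)
    qed
    have "(\<integral>\<^sup>+z\<in>Q H x s0 l. ennreal (exp (\<epsilon> * max 0 (u z - c))) \<partial>\<Lambda>) \<le>
        (\<integral>\<^sup>+z. (\<integral>\<^sup>+w\<in>T z. ennreal (exp (\<epsilon> * max 0 (u w - c))) \<partial>\<Lambda>) \<partial>count_space G)"
      by (rule nn_integral_UN_le) (use G T_sets cover in auto)
    also have "\<dots> \<le> (\<integral>\<^sup>+z. ennreal (exp (\<epsilon> * C) * 7 * B1) * emeasure \<Lambda> (S z) \<partial>count_space G)"
    proof (rule nn_integral_mono)
      fix z assume "z \<in> space (count_space G)"
      then have z: "z \<in> Q H x s0 l" using G(1) by auto
      define \<beta> where "\<beta> = b (fst z) (snd z) (\<theta> * l)"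
      have \<beta>: "\<beta> \<le> c + C" using b_le[of "fst z" "snd z"] z by (simp add: \<beta>_def)
      have point: "ennreal (exp (\<epsilon> * max 0 (u w - c))) \<le>
          ennreal (exp (\<epsilon> * C)) * ennreal (exp (\<epsilon> * max 0 (u w - \<beta>)))" for w
      proof -
        have "max 0 (u w - c) \<le> C + max 0 (u w - \<beta>)" using \<beta> \<open>0 \<le> C\<close> by auto
        then have "\<epsilon> * max 0 (u w - c) \<le> \<epsilon> * (C + max 0 (u w - \<beta>))"
          using \<epsilon> by (intro mult_left_mono) auto
        then have "exp (\<epsilon> * max 0 (u w - c)) \<le> exp (\<epsilon> * C) * exp (\<epsilon> * max 0 (u w - \<beta>))"
          by (simp add: distrib_left flip: exp_add)
        then show ?thesis by (simp add: ennreal_leI flip: ennreal_mult)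
      qed
      have "(\<integral>\<^sup>+w\<in>T z. ennreal (exp (\<epsilon> * max 0 (u w - c))) \<partial>\<Lambda>) \<le>
          (\<integral>\<^sup>+w. ennreal (exp (\<epsilon> * C)) * (ennreal (exp (\<epsilon> * max 0 (u w - \<beta>))) * indicator (T z) w) \<partial>\<Lambda>)"
        by (rule nn_integral_mono) (use point in \<open>auto split: split_indicator\<close>)
      also have "\<dots> = ennreal (exp (\<epsilon> * C)) * (\<integral>\<^sup>+w\<in>T z. ennreal (exp (\<epsilon> * max 0 (u w - \<beta>))) \<partial>\<Lambda>)"
        by (rule nn_integral_cmult) (use T_sets in measurable)
      also have "\<dots> \<le> ennreal (exp (\<epsilon> * C)) * ennreal (7 * vol h (fst z) (\<theta> * l))"
        unfolding T_def \<beta>_def by (intro mult_left_mono local \<theta>l) simp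
      also have "\<dots> \<le> ennreal (exp (\<epsilon> * C)) * ennreal (7 * (B1 * vol h (fst z) (\<eta> * l)))"
        using \<eta> \<eta>l \<theta>l assms by (intro mult_left_mono ennreal_leI B1(2)) (auto simp: dist_refl)
      also have "\<dots> = ennreal (exp (\<epsilon> * C) * 7 * B1) * emeasure \<Lambda> (S z)"
        unfolding S_def using \<eta>l h_pos B1(1) vol_pos[OF \<eta>l(1) h_pos, of "fst z"]
        by (simp add: emeasure_Q mult.assoc flip: ennreal_mult)
      finally show "(\<integral>\<^sup>+w\<in>T z. ennreal (exp (\<epsilon> * max 0 (u w - c))) \<partial>\<Lambda>) \<le>
          ennreal (exp (\<epsilon> * C) * 7 * B1) * emeasure \<Lambda> (S z)" .
    qed
    also have "\<dots> = ennreal (exp (\<epsilon> * C) * 7 * B1) * (\<integral>\<^sup>+z. emeasure \<Lambda> (S z) \<partial>count_space G)"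
      by (rule nn_integral_cmult) auto
    also have "\<dots> \<le> ennreal (exp (\<epsilon> * C) * 7 * B1) * emeasure \<Lambda> W"
    proof (intro mult_left_mono emeasure_disjoint_le[OF G(2) _ _ _ G(3)])
      show "W \<in> sets \<Lambda>" unfolding W_def using Kl by (intro Q_sets)
      show "S z \<subseteq> W" if "z \<in> G" for z using that G(1) S_W by blast
    qed (use S_sets in auto)
    also have "\<dots> \<le> ennreal (exp (\<epsilon> * C) * 7 * B1) * ennreal (B2 * vol H x l)"
      unfolding W_def using Kl l \<open>0 < H + h\<close>
      by (subst emeasure_Q) (auto intro!: mult_left_mono ennreal_leI B2(2) simp: dist_refl)
    also have "\<dots> = ennreal (B * vol H x l)"
      using B1(1) B2(1) vol_pos[OF l \<open>0 < H\<close>, of x] by (simp add: B_def mult.assoc flip: ennreal_mult)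
    finally show ?thesis .
  qed
  moreover have "0 < B" using B1 B2 by (simp add: B_def)
  ultimately show thesis using that by blast
qed

text \<open>In the direction \<open>\<sigma>\<close>, every centre in this half is later than
  \<open>t\<close> by between \<open>\<gamma> * l powr p\<close> and \<open>l powr p\<close>, the
  time range that a chain from the reference cylinder can fill. The freedom in
  \<open>\<theta>\<close> and \<open>t'\<close> is kept for matching the constant with that of
  \<open>-u\<close>.\<close>

lemma john_nirenberg_upper:
  assumes geo: "monotone_geodesic \<rho>" and \<kappa>: "\<kappa> = \<sigma> * k" "\<bar>\<sigma>\<bar> = 1" "0 < k" and \<gamma>: "0 < \<gamma>" "\<gamma> < 1"
  obtains \<theta>0 \<epsilon> where "0 < \<theta>0" "0 < \<epsilon>"
    "\<And>\<theta>. 0 < \<theta> \<Longrightarrow> \<theta> \<le> \<theta>0 \<Longrightarrow> \<exists>B>0. \<forall>x t t' l. 0 < l \<longrightarrow> \<bar>t' - t\<bar> \<le> k * (\<theta> * l) powr p \<longrightarrow>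
      (\<integral>\<^sup>+z\<in>Q ((1 - \<gamma>) / 2) x (t + \<sigma> * ((1 + \<gamma>) / 2) * l powr p) l.
        ennreal (exp (\<epsilon> * max 0 (u z - b x t' (\<theta> * l)))) \<partial>\<Lambda>) \<le> ennreal (B * vol ((1 - \<gamma>) / 2) x l)"
proof -
  obtain \<epsilon> where \<epsilon>: "0 < \<epsilon>" "\<And>x t l. 0 < l \<Longrightarrow>
      (\<integral>\<^sup>+z\<in>Q h x t (\<delta> * l). ennreal (exp (\<epsilon> * max 0 (u z - b x t l))) \<partial>\<Lambda>) \<le> ennreal (7 * vol h x l)"
    by (rule exp_local) (rule that)
  obtain \<theta>0 where \<theta>0: "0 < \<theta>0" "\<theta>0 \<le> 1"
    "\<And>\<theta>. 0 < \<theta> \<Longrightarrow> \<theta> \<le> \<theta>0 \<Longrightarrow> \<exists>C\<ge>0. \<forall>x y t t' s l. 0 < l \<longrightarrow> \<rho> x y < l \<longrightarrow>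
      \<gamma> * l powr p \<le> \<sigma> * (s - t) \<longrightarrow> \<sigma> * (s - t) \<le> l powr p \<longrightarrow> \<bar>t' - t\<bar> \<le> k * (\<theta> * l) powr p \<longrightarrow>
      b y s (\<theta> * l) \<le> b x t' (\<theta> * l) + C"
    by (rule const_le_reference[OF geo \<kappa> \<gamma>(1)]) (rule that)
  show thesis
  proof (rule that[OF \<theta>0(1) \<epsilon>(1)])
    fix \<theta> assume \<theta>: "0 < \<theta>" "\<theta> \<le> \<theta>0"
    obtain C where C: "0 \<le> C" "\<And>x y t t' s l. 0 < l \<Longrightarrow> \<rho> x y < l \<Longrightarrow>
      \<gamma> * l powr p \<le> \<sigma> * (s - t) \<Longrightarrow> \<sigma> * (s - t) \<le> l powr p \<Longrightarrow> \<bar>t' - t\<bar> \<le> k * (\<theta> * l) powr p \<Longrightarrow>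
      b y s (\<theta> * l) \<le> b x t' (\<theta> * l) + C"
      using \<theta>0(3)[OF \<theta>] by metis
    have H: "0 < (1 - \<gamma>) / 2" using \<gamma> by simp
    have "\<theta> \<le> 1" using \<theta> \<theta>0 by simp
    obtain B where B: "0 < B" "\<forall>x s0 l c. 0 < l \<longrightarrow>
      (\<forall>y s. (y, s) \<in> Q ((1 - \<gamma>) / 2) x s0 l \<longrightarrow> b y s (\<theta> * l) \<le> c + C) \<longrightarrow>
      (\<integral>\<^sup>+z\<in>Q ((1 - \<gamma>) / 2) x s0 l. ennreal (exp (\<epsilon> * max 0 (u z - c))) \<partial>\<Lambda>) \<le>
        ennreal (B * vol ((1 - \<gamma>) / 2) x l)"
      by (rule exp_region[OF \<epsilon>(1) _ \<theta>(1) \<open>\<theta> \<le> 1\<close> H C(1)]) (erule \<epsilon>(2), rule that)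
    have "(\<integral>\<^sup>+z\<in>Q ((1 - \<gamma>) / 2) x (t + \<sigma> * ((1 + \<gamma>) / 2) * l powr p) l.
        ennreal (exp (\<epsilon> * max 0 (u z - b x t' (\<theta> * l)))) \<partial>\<Lambda>) \<le> ennreal (B * vol ((1 - \<gamma>) / 2) x l)"
      if l: "0 < l" and t': "\<bar>t' - t\<bar> \<le> k * (\<theta> * l) powr p" for x t t' l
    proof (rule B(2)[rule_format, OF l])
      fix y s assume ys: "(y, s) \<in> Q ((1 - \<gamma>) / 2) x (t + \<sigma> * ((1 + \<gamma>) / 2) * l powr p) l"
      have \<sigma>\<sigma>: "\<sigma> * \<sigma> = 1" using \<kappa>(2) by (metis abs_mult_self_eq mult_1)
      have "\<sigma> * (s - (t + \<sigma> * ((1 + \<gamma>) / 2) * l powr p)) = \<sigma> * (s - t) - \<sigma> * \<sigma> * ((1 + \<gamma>) / 2) * l powr p"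
        by (simp add: algebra_simps)
      then have "\<bar>\<sigma> * (s - t) - (1 + \<gamma>) / 2 * l powr p\<bar> = \<bar>s - (t + \<sigma> * ((1 + \<gamma>) / 2) * l powr p)\<bar>"
        using \<kappa>(2) \<sigma>\<sigma> by (metis abs_mult mult_1)
      also have "\<dots> < (1 - \<gamma>) / 2 * l powr p" using ys by (simp add: mem_Q)
      finally have "\<gamma> * l powr p \<le> \<sigma> * (s - t)" "\<sigma> * (s - t) \<le> l powr p"
        by (auto simp: abs_less_iff field_simps)
      then show "b y s (\<theta> * l) \<le> b x t' (\<theta> * l) + C"
        using ys by (intro C(2)[OF l _ _ _ t']) (auto simp: mem_Q)
    qed
    then show "\<exists>B>0. \<forall>x t t' l. 0 < l \<longrightarrow> \<bar>t' - t\<bar> \<le> k * (\<theta> * l) powr p \<longrightarrow>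
      (\<integral>\<^sup>+z\<in>Q ((1 - \<gamma>) / 2) x (t + \<sigma> * ((1 + \<gamma>) / 2) * l powr p) l.
        ennreal (exp (\<epsilon> * max 0 (u z - b x t' (\<theta> * l)))) \<partial>\<Lambda>) \<le> ennreal (B * vol ((1 - \<gamma>) / 2) x l)"
      using B(1) by blast
  qed
qed

end

section \<open>Muckenhoupt weights\<close>

lemma SUP_ennreal_finite_iff:
  "(SUP (x, t, l) \<in> UNIV \<times> UNIV \<times> {0<..}. f x t l) < (\<infinity>::ennreal) \<longleftrightarrow>
    (\<exists>B\<ge>0. \<forall>x t. \<forall>l>0::real. f x t l \<le> ennreal B)" (is "?S < \<infinity> \<longleftrightarrow> ?R")
proof
  assume "?S < \<infinity>"
  then obtain B where B: "0 \<le> B" "?S = ennreal B" by (cases ?S) auto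
  have "f x t l \<le> ?S" if "0 < l" for x t l
    using that by (intro SUP_upper2[of "(x, t, l)"]) auto
  then show ?R using B by auto
next
  assume ?R
  then obtain B where "\<forall>x t. \<forall>l>0. f x t l \<le> ennreal B" by blast
  then have "?S \<le> ennreal B" by (intro SUP_least) auto
  then show "?S < \<infinity>" by (simp add: le_less_trans)
qed

lemma average_le_iff:
  assumes "emeasure M S = ennreal v" "0 < v" "0 \<le> B"
  shows "average M S f \<le> ennreal B \<longleftrightarrow> (\<integral>\<^sup>+z\<in>S. ennreal (f z) \<partial>M) \<le> ennreal (B * v)"
proof (cases "\<integral>\<^sup>+z\<in>S. ennreal (f z) \<partial>M")
  case (real r)
  then show ?thesis
    using assms by (simp add: average_def divide_ennreal ennreal_le_iff pos_divide_le_eq)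
next
  case top
  then show ?thesis using assms by (simp add: average_def ennreal_top_divide top_unique)
qed

lemma average_le_cmult:
  assumes g: "g \<in> borel_measurable M" and S: "S \<in> sets M" "emeasure M S = ennreal v" "0 < v"
    and c: "0 \<le> c" "0 \<le> y" "average M S g \<le> ennreal y"
    and le: "AE z in M. z \<in> S \<longrightarrow> f z \<le> c * g z"
  shows "average M S f \<le> ennreal (c * y)"
proof -
  note g [measurable] and S(1) [measurable]
  have "(\<integral>\<^sup>+z\<in>S. ennreal (f z) \<partial>M) \<le> (\<integral>\<^sup>+z. ennreal c * (ennreal (g z) * indicator S z) \<partial>M)"
  proof (rule nn_integral_mono_AE)
    show "AE z in M. ennreal (f z) * indicator S z \<le> ennreal c * (ennreal (g z) * indicator S z)"
      using le by eventually_elim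
        (use c in \<open>auto split: split_indicator intro: ennreal_leI simp flip: ennreal_mult'\<close>)
  qed
  also have "\<dots> = ennreal c * (\<integral>\<^sup>+z\<in>S. ennreal (g z) \<partial>M)"
    by (rule nn_integral_cmult) measurable
  also have "\<dots> \<le> ennreal c * ennreal (y * v)"
    using c average_le_iff[OF S(2,3) c(2)] by (intro mult_left_mono) auto
  also have "\<dots> = ennreal (c * y * v)"
    using c S by (simp add: mult.assoc flip: ennreal_mult)
  finally show ?thesis using c S by (subst average_le_iff) auto
qed

text \<open>In \<open>ennreal\<close> zero times infinity is zero, so a bounded product shows one
  average to be finite only once the other is known to be positive.\<close>

lemma average_pos:
  assumes f: "f \<in> borel_measurable M" and S: "S \<in> sets M" "emeasure M S = ennreal v" "0 < v"
    and pos: "AE z in M. 0 < f z"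
  shows "0 < average M S f"
proof -
  note f [measurable] and S(1) [measurable]
  have "(\<integral>\<^sup>+z\<in>S. ennreal (f z) \<partial>M) \<noteq> 0"
  proof
    assume "(\<integral>\<^sup>+z\<in>S. ennreal (f z) \<partial>M) = 0"
    then have "AE z in M. ennreal (f z) * indicator S z = 0"
      by (subst (asm) nn_integral_0_iff_AE) measurable
    then have "AE z in M. z \<notin> S"
      using pos by eventually_elim (auto split: split_indicator_asm)
    then have "emeasure M S = 0" using AE_iff_null_sets[OF S(1)] by (simp add: null_sets_def)
    then show False using S by simp
  qed
  then show ?thesis
    using S by (simp add: average_def zero_less_iff_neq_zero)
qed

lemma ennreal_pow_mono_le:
  assumes "0 < a" "0 \<le> y" "c \<le> ennreal y"
  shows "ennreal_pow c a \<le> ennreal (y powr a)"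
proof -
  obtain x where x: "c = ennreal x" "0 \<le> x" using assms(3) by (cases c) (auto simp: top_unique)
  then have "x \<le> y" using assms by (simp add: ennreal_le_iff)
  then show ?thesis using x assms by (auto simp: ennreal_pow_def intro!: ennreal_leI powr_mono2)
qed

lemma ennreal_pow_pos: "0 < c \<Longrightarrow> 0 < ennreal_pow c a"
  by (cases c) (auto simp: ennreal_pow_def)

text \<open>In units of \<open>l powr p\<close>, \<open>(1 + \<gamma>) / 2\<close> and
  \<open>(1 - \<gamma>) / 2\<close> are the midpoint and half the length of the interval from
  \<open>\<gamma>\<close> to 1. Each half becomes a box, selected by the sign
  \<open>\<sigma>\<close>.\<close>

definition half_cylinder ::
    "('a \<Rightarrow> 'a \<Rightarrow> real) \<Rightarrow> real \<Rightarrow> real \<Rightarrow> real \<Rightarrow> 'a \<Rightarrow> real \<Rightarrow> real \<Rightarrow> ('a \<times> real) set"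
  where "half_cylinder \<rho> p \<gamma> \<sigma> x t l =
    pbox \<rho> p ((1 - \<gamma>) / 2) x (t + \<sigma> * ((1 + \<gamma>) / 2) * l powr p) l"

lemma cylinder_plus_eq: "cylinder_plus \<rho> p \<gamma> x t l = half_cylinder \<rho> p \<gamma> 1 x t l"
proof -
  have "t + 1 * ((1 + \<gamma>) / 2) * v - (1 - \<gamma>) / 2 * v = t + \<gamma> * v"
    "t + 1 * ((1 + \<gamma>) / 2) * v + (1 - \<gamma>) / 2 * v = t + v" for v
    by (simp_all add: field_simps)
  then show ?thesis by (simp only: cylinder_plus_def half_cylinder_def pbox_def)
qed

lemma cylinder_minus_eq: "cylinder_minus \<rho> p \<gamma> x t l = half_cylinder \<rho> p \<gamma> (-1) x t l"
proof -
  have "t + - 1 * ((1 + \<gamma>) / 2) * v - (1 - \<gamma>) / 2 * v = t - v"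
    "t + - 1 * ((1 + \<gamma>) / 2) * v + (1 - \<gamma>) / 2 * v = t - \<gamma> * v" for v
    by (simp_all add: field_simps)
  then show ?thesis by (simp only: cylinder_minus_def half_cylinder_def pbox_def)
qed

text \<open>The sign \<open>\<sigma> = 1\<close> gives the forward and \<open>\<sigma> = -1\<close> the backward classes. The symmetry
  \<open>u \<mapsto> -u\<close> exchanges the two halves of a cylinder, and so replaces a reversal of time.\<close>

definition PBMO_dir ::
    "('a \<Rightarrow> 'a \<Rightarrow> real) \<Rightarrow> 'a measure \<Rightarrow> real \<Rightarrow> real \<Rightarrow> ('a \<times> real \<Rightarrow> real) set"
  where "PBMO_dir \<rho> \<mu> p \<sigma> = {u. locally_integrable \<rho> \<mu> p u \<and>
    (\<exists>\<gamma>. 0 < \<gamma> \<and> \<gamma> < 1 \<and> (\<exists>a :: 'a \<Rightarrow> real \<Rightarrow> real \<Rightarrow> real.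
      (SUP (x, t, l) \<in> UNIV \<times> UNIV \<times> {0<..}.
         average (time_product \<mu>) (half_cylinder \<rho> p \<gamma> \<sigma> x t l) (\<lambda>z. max 0 (u z - a x t l)) +
         average (time_product \<mu>) (half_cylinder \<rho> p \<gamma> (- \<sigma>) x t l) (\<lambda>z. max 0 (a x t l - u z)))
      < \<infinity>))}"

definition A_dir ::
    "('a \<Rightarrow> 'a \<Rightarrow> real) \<Rightarrow> 'a measure \<Rightarrow> real \<Rightarrow> real \<Rightarrow> real \<Rightarrow> real \<Rightarrow> ('a \<times> real \<Rightarrow> real) set"
  where "A_dir \<rho> \<mu> p q \<gamma> \<sigma> = {\<omega>. weight \<rho> \<mu> p \<omega> \<and>
    (SUP (x, t, l) \<in> UNIV \<times> UNIV \<times> {0<..}.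
       average (time_product \<mu>) (half_cylinder \<rho> p \<gamma> (- \<sigma>) x t l) \<omega> *
       ennreal_pow (average (time_product \<mu>) (half_cylinder \<rho> p \<gamma> \<sigma> x t l)
                      (\<lambda>z. \<omega> z powr (1 - conj_exponent q))) (q - 1)) < \<infinity>}"

lemma PBMO_plus_eq: "PBMO_plus \<rho> \<mu> p = PBMO_dir \<rho> \<mu> p 1"
  and PBMO_minus_eq: "PBMO_minus \<rho> \<mu> p = PBMO_dir \<rho> \<mu> p (-1)"
  by (simp_all add: PBMO_plus_def PBMO_minus_def PBMO_dir_def cylinder_plus_eq cylinder_minus_eq)

lemma A_plus_eq: "A_plus \<rho> \<mu> p q \<gamma> = A_dir \<rho> \<mu> p q \<gamma> 1"
  and A_minus_eq: "A_minus \<rho> \<mu> p q \<gamma> = A_dir \<rho> \<mu> p q \<gamma> (-1)"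
  by (simp_all add: A_plus_def A_minus_def A_dir_def cylinder_plus_eq cylinder_minus_eq)

section \<open>From bounded mean oscillation to weights and back\<close>

context parabolic_space
begin

abbreviation Hc :: "real \<Rightarrow> real \<Rightarrow> 'a \<Rightarrow> real \<Rightarrow> real \<Rightarrow> ('a \<times> real) set"
  where "Hc \<equiv> half_cylinder \<rho> p"

lemma Hc_sets [measurable]: "0 < l \<Longrightarrow> Hc \<gamma> \<sigma> x t l \<in> sets \<Lambda>"
  unfolding half_cylinder_def by (rule Q_sets)

lemma emeasure_Hc: "0 < l \<Longrightarrow> \<gamma> < 1 \<Longrightarrow> emeasure \<Lambda> (Hc \<gamma> \<sigma> x t l) = ennreal (vol ((1 - \<gamma>) / 2) x l)"
  unfolding half_cylinder_def by (rule emeasure_Q) auto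

lemma vol_Hc_pos: "0 < l \<Longrightarrow> \<gamma> < 1 \<Longrightarrow> 0 < vol ((1 - \<gamma>) / 2) x l"
  by (rule vol_pos) auto

text \<open>Every box of size 1 and this height is a half of some cylinder, in either direction;
  bounds on halves thus become bounds around every point.\<close>

lemma Hc_unit: "Hc \<gamma> \<sigma> x (t - \<sigma> * ((1 + \<gamma>) / 2)) 1 = Q ((1 - \<gamma>) / 2) x t 1"
  by (simp add: half_cylinder_def)

lemma john_nirenberg:
  fixes u :: "'a \<times> real \<Rightarrow> real"
  assumes geo: "monotone_geodesic \<rho>" and \<sigma>: "\<bar>\<sigma>\<bar> = 1" and \<gamma>0: "0 < \<gamma>0" "\<gamma>0 < 1" and \<gamma>: "0 < \<gamma>" "\<gamma> < 1"
    and u: "u \<in> borel_measurable \<Lambda>" and A: "0 < A"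
    and up: "\<And>x t l. 0 < l \<Longrightarrow> (\<integral>\<^sup>+z\<in>Hc \<gamma>0 \<sigma> x t l. ennreal (max 0 (u z - a x t l)) \<partial>\<Lambda>) \<le>
      ennreal (A * vol ((1 - \<gamma>0) / 2) x l)"
    and lo: "\<And>x t l. 0 < l \<Longrightarrow> (\<integral>\<^sup>+z\<in>Hc \<gamma>0 (- \<sigma>) x t l. ennreal (max 0 (a x t l - u z)) \<partial>\<Lambda>) \<le>
      ennreal (A * vol ((1 - \<gamma>0) / 2) x l)"
  obtains \<epsilon> B c where "0 < \<epsilon>" "0 < B"
    "\<And>x t l. 0 < l \<Longrightarrow> (\<integral>\<^sup>+z\<in>Hc \<gamma> \<sigma> x t l. ennreal (exp (\<epsilon> * max 0 (u z - c x t l))) \<partial>\<Lambda>) \<le>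
      ennreal (B * vol ((1 - \<gamma>) / 2) x l)"
    "\<And>x t l. 0 < l \<Longrightarrow> (\<integral>\<^sup>+z\<in>Hc \<gamma> (- \<sigma>) x t l. ennreal (exp (\<epsilon> * max 0 (c x t l - u z))) \<partial>\<Lambda>) \<le>
      ennreal (B * vol ((1 - \<gamma>) / 2) x l)"
proof -
  define h where "h = (1 - \<gamma>0) / 2"
  define \<tau> where "\<tau> = (1 + \<gamma>0) / 2"
  define k where "k = 2 * \<tau>"
  define \<kappa> where "\<kappa> = \<sigma> * k"
  \<comment> \<open>Recentring: if the half in direction \<open>\<sigma>\<close> has its middle at
    time \<open>s\<close>, the cylinder is centred at
    \<open>s - \<sigma> * \<tau> * l powr p\<close>, and the two middles are
    \<open>2 * \<tau> * l powr p\<close> apart.\<close>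
  define b where "b y s l = a y (s - \<sigma> * \<tau> * l powr p) l" for y s l
  \<comment> \<open>For \<open>-u\<close> the halves trade places and the constant changes sign:
    time \<open>s\<close> now belongs to the cylinder whose other half has its middle at
    \<open>s\<close>.\<close>
  define b' where "b' y s l = - b y (s + \<kappa> * l powr p) l" for y s l
  have h: "0 < h" "h \<le> 1" "0 < k" using \<gamma>0 by (auto simp: h_def k_def \<tau>_def)
  have upper: "(\<integral>\<^sup>+z\<in>Q h y s l. ennreal (max 0 (u z - b y s l)) \<partial>\<Lambda>) \<le> ennreal (A * vol h y l)"
    if "0 < l" for y s l
    using up[OF that, of y "s - \<sigma> * \<tau> * l powr p"]
    by (simp add: half_cylinder_def b_def h_def \<tau>_def)
  have lower: "(\<integral>\<^sup>+z\<in>Q h y (s - \<kappa> * l powr p) l. ennreal (max 0 (b y s l - u z)) \<partial>\<Lambda>) \<le> ennreal (A * vol h y l)"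
    if "0 < l" for y s l
  proof -
    have "s - \<sigma> * \<tau> * v + - \<sigma> * \<tau> * v = s - \<kappa> * v" for v by (simp add: \<kappa>_def k_def)
    then show ?thesis
      using lo[OF that, of y "s - \<sigma> * \<tau> * l powr p"]
      by (simp only: half_cylinder_def b_def h_def \<tau>_def)
  qed
  interpret P: parabolic_bmo \<rho> \<mu> p K D u h \<kappa> A b
    by unfold_locales (use u h A upper lower in auto)
  interpret N: parabolic_bmo \<rho> \<mu> p K D "\<lambda>z. - u z" h "- \<kappa>" A b'
  proof unfold_locales
    fix y s and l :: real assume l: "0 < l"
    show "(\<integral>\<^sup>+z\<in>Q h y s l. ennreal (max 0 (- u z - b' y s l)) \<partial>\<Lambda>) \<le> ennreal (A * vol h y l)"
      using lower[OF l, of y "s + \<kappa> * l powr p"] by (simp add: b'_def add.commute)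
    show "(\<integral>\<^sup>+z\<in>Q h y (s - - \<kappa> * l powr p) l. ennreal (max 0 (b' y s l - - u z)) \<partial>\<Lambda>) \<le> ennreal (A * vol h y l)"
      using upper[OF l, of y "s + \<kappa> * l powr p"] by (simp add: b'_def add.commute)
  qed (use u h A in auto)
  obtain \<theta>1 \<epsilon>1 where 1: "0 < \<theta>1" "0 < \<epsilon>1"
    "\<And>\<theta>. 0 < \<theta> \<Longrightarrow> \<theta> \<le> \<theta>1 \<Longrightarrow> \<exists>B>0. \<forall>x t t' l. 0 < l \<longrightarrow> \<bar>t' - t\<bar> \<le> k * (\<theta> * l) powr p \<longrightarrow>
      (\<integral>\<^sup>+z\<in>Q ((1 - \<gamma>) / 2) x (t + \<sigma> * ((1 + \<gamma>) / 2) * l powr p) l.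
        ennreal (exp (\<epsilon>1 * max 0 (u z - b x t' (\<theta> * l)))) \<partial>\<Lambda>) \<le> ennreal (B * vol ((1 - \<gamma>) / 2) x l)"
    by (rule P.john_nirenberg_upper[OF geo \<kappa>_def \<sigma> h(3) \<gamma>]) (rule that)
  have "- \<kappa> = - \<sigma> * k" "\<bar>- \<sigma>\<bar> = 1" using \<sigma> by (auto simp: \<kappa>_def)
  obtain \<theta>2 \<epsilon>2 where 2: "0 < \<theta>2" "0 < \<epsilon>2"
    "\<And>\<theta>. 0 < \<theta> \<Longrightarrow> \<theta> \<le> \<theta>2 \<Longrightarrow> \<exists>B>0. \<forall>x t t' l. 0 < l \<longrightarrow> \<bar>t' - t\<bar> \<le> k * (\<theta> * l) powr p \<longrightarrow>
      (\<integral>\<^sup>+z\<in>Q ((1 - \<gamma>) / 2) x (t + - \<sigma> * ((1 + \<gamma>) / 2) * l powr p) l.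
        ennreal (exp (\<epsilon>2 * max 0 (- u z - b' x t' (\<theta> * l)))) \<partial>\<Lambda>) \<le> ennreal (B * vol ((1 - \<gamma>) / 2) x l)"
    by (rule N.john_nirenberg_upper[OF geo \<open>- \<kappa> = - \<sigma> * k\<close> \<open>\<bar>- \<sigma>\<bar> = 1\<close> h(3) \<gamma>]) (rule that)
  \<comment> \<open>The constants depend on the scale, so both signs have to use the same
    one.\<close>
  define \<theta> where "\<theta> = min \<theta>1 \<theta>2"
  have \<theta>: "0 < \<theta>" "\<theta> \<le> \<theta>1" "\<theta> \<le> \<theta>2" using 1 2 by (auto simp: \<theta>_def)
  obtain B1 where B1: "0 < B1" "\<And>x t t' l. 0 < l \<Longrightarrow> \<bar>t' - t\<bar> \<le> k * (\<theta> * l) powr p \<Longrightarrow>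
      (\<integral>\<^sup>+z\<in>Q ((1 - \<gamma>) / 2) x (t + \<sigma> * ((1 + \<gamma>) / 2) * l powr p) l.
        ennreal (exp (\<epsilon>1 * max 0 (u z - b x t' (\<theta> * l)))) \<partial>\<Lambda>) \<le> ennreal (B1 * vol ((1 - \<gamma>) / 2) x l)"
    using 1(3)[OF \<theta>(1,2)] by blast
  obtain B2 where B2: "0 < B2" "\<And>x t t' l. 0 < l \<Longrightarrow> \<bar>t' - t\<bar> \<le> k * (\<theta> * l) powr p \<Longrightarrow>
      (\<integral>\<^sup>+z\<in>Q ((1 - \<gamma>) / 2) x (t + - \<sigma> * ((1 + \<gamma>) / 2) * l powr p) l.
        ennreal (exp (\<epsilon>2 * max 0 (- u z - b' x t' (\<theta> * l)))) \<partial>\<Lambda>) \<le> ennreal (B2 * vol ((1 - \<gamma>) / 2) x l)"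
    using 2(3)[OF \<theta>(1,3)] by blast
  define \<epsilon> where "\<epsilon> = min \<epsilon>1 \<epsilon>2"
  define B where "B = max B1 B2"
  define c where "c x t l = b x t (\<theta> * l)" for x t l
  have exp_le: "(\<integral>\<^sup>+z\<in>S. ennreal (exp (\<epsilon> * max 0 (f z))) \<partial>\<Lambda>) \<le> ennreal (B * vol ((1 - \<gamma>) / 2) x l)"
    if "(\<integral>\<^sup>+z\<in>S. ennreal (exp (\<epsilon>' * max 0 (f z))) \<partial>\<Lambda>) \<le> ennreal (B' * vol ((1 - \<gamma>) / 2) x l)"
      "\<epsilon> \<le> \<epsilon>'" "B' \<le> B" "0 < l" for S f x l \<epsilon>' B'
  proof -
    have "(\<integral>\<^sup>+z\<in>S. ennreal (exp (\<epsilon> * max 0 (f z))) \<partial>\<Lambda>) \<le> (\<integral>\<^sup>+z\<in>S. ennreal (exp (\<epsilon>' * max 0 (f z))) \<partial>\<Lambda>)"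
      using that(2) by (intro nn_integral_mono mult_right_mono ennreal_leI) (auto intro: mult_right_mono)
    also note that(1)
    also have "ennreal (B' * vol ((1 - \<gamma>) / 2) x l) \<le> ennreal (B * vol ((1 - \<gamma>) / 2) x l)"
      using that(3) vol_Hc_pos[OF that(4) \<gamma>(2), of x] by (intro ennreal_leI mult_right_mono) auto
    finally show ?thesis .
  qed
  show thesis
  proof (rule that[of \<epsilon> B c])
    show "0 < \<epsilon>" "0 < B" using 1 2 B1 B2 by (auto simp: \<epsilon>_def B_def)
    fix x t and l :: real assume l: "0 < l"
    show "(\<integral>\<^sup>+z\<in>Hc \<gamma> \<sigma> x t l. ennreal (exp (\<epsilon> * max 0 (u z - c x t l))) \<partial>\<Lambda>) \<le> ennreal (B * vol ((1 - \<gamma>) / 2) x l)"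
      unfolding half_cylinder_def c_def
      by (rule exp_le[OF B1(2)[OF l]]) (use l h in \<open>auto simp: \<epsilon>_def B_def\<close>)
    \<comment> \<open>At this reference time the constant of \<open>-u\<close> at scale
      \<open>\<theta> * l\<close> is exactly \<open>- c x t l\<close>. The shift is the largest that
      the estimate allows.\<close>
    have "\<bar>(t - \<kappa> * (\<theta> * l) powr p) - t\<bar> \<le> k * (\<theta> * l) powr p"
      using \<sigma> h by (simp add: \<kappa>_def abs_mult)
    from B2(2)[OF l this]
    have "(\<integral>\<^sup>+z\<in>Hc \<gamma> (- \<sigma>) x t l. ennreal (exp (\<epsilon>2 * max 0 (c x t l - u z))) \<partial>\<Lambda>) \<le> ennreal (B2 * vol ((1 - \<gamma>) / 2) x l)"
      by (simp add: half_cylinder_def c_def b'_def add.commute)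
    then show "(\<integral>\<^sup>+z\<in>Hc \<gamma> (- \<sigma>) x t l. ennreal (exp (\<epsilon> * max 0 (c x t l - u z))) \<partial>\<Lambda>) \<le> ennreal (B * vol ((1 - \<gamma>) / 2) x l)"
      by (rule exp_le) (use l in \<open>auto simp: \<epsilon>_def B_def\<close>)
  qed
qed

lemma locally_integrable_if_unit_boxes:
  assumes f: "f \<in> borel_measurable \<Lambda>" and H: "0 < H" "H \<le> 1"
    and fin: "\<And>x t. (\<integral>\<^sup>+z\<in>Q H x t 1. ennreal \<bar>f z\<bar> \<partial>\<Lambda>) < \<infinity>"
  shows "locally_integrable \<rho> \<mu> p f"
  unfolding locally_integrable_def
proof (intro conjI allI f)
  fix x t
  note f [measurable]
  have "cylinder \<rho> p x t H \<subseteq> Q H x t 1"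
  proof -
    have "H powr p \<le> H powr 1" using H p_gt_1 by (intro powr_mono') auto
    then show ?thesis using H by (auto simp: cylinder_def pbox_def qball_def)
  qed
  moreover have [measurable]: "cylinder \<rho> p x t H \<in> sets \<Lambda>"
    using Q_sets[OF H(1), of 1 x t] by (simp add: cylinder_def pbox_def)
  moreover have "set_integrable \<Lambda> (Q H x t 1) f"
    unfolding set_integrable_def
  proof (rule integrableI_bounded)
    show "(\<lambda>z. indicator (Q H x t 1) z *\<^sub>R f z) \<in> borel_measurable \<Lambda>"
      using Q_sets[of 1 H x t] by measurable
    have "(\<integral>\<^sup>+z. ennreal (norm (indicator (Q H x t 1) z *\<^sub>R f z)) \<partial>\<Lambda>) =
        (\<integral>\<^sup>+z\<in>Q H x t 1. ennreal \<bar>f z\<bar> \<partial>\<Lambda>)"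
      by (rule nn_integral_cong) (auto split: split_indicator)
    then show "(\<integral>\<^sup>+z. ennreal (norm (indicator (Q H x t 1) z *\<^sub>R f z)) \<partial>\<Lambda>) < \<infinity>"
      using fin by simp
  qed
  ultimately show "\<exists>r>0. set_integrable \<Lambda> (cylinder \<rho> p x t r) f"
    using H(1) by (intro exI[of _ H]) (auto intro: set_integrable_subset)
qed

text \<open>Take \<open>\<omega> = exp (- \<epsilon>' * u)\<close> and
  \<open>\<xi> = 1 / \<epsilon>'\<close>. The averages are at most
  \<open>B * exp (- \<epsilon>' * c)\<close> and \<open>B * exp (\<epsilon>' * c / (q - 1))\<close>;
  the power \<open>q - 1\<close> of the second makes the exponentials cancel.\<close>

lemma A_dir_if_PBMO_dir:
  assumes geo: "monotone_geodesic \<rho>" and \<sigma>: "\<bar>\<sigma>\<bar> = 1" and \<gamma>: "0 < \<gamma>" "\<gamma> < 1" and q: "1 < q"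
    and u: "u \<in> PBMO_dir \<rho> \<mu> p \<sigma>"
  shows "\<exists>\<omega> \<xi>. \<omega> \<in> A_dir \<rho> \<mu> p q \<gamma> \<sigma> \<and> 0 < \<xi> \<and> u = (\<lambda>z. - \<xi> * ln (\<omega> z))"
proof -
  obtain \<gamma>0 a A0 where \<gamma>0: "0 < \<gamma>0" "\<gamma>0 < 1" and "0 \<le> A0"
    and A0: "\<And>x t l. 0 < l \<Longrightarrow> average \<Lambda> (Hc \<gamma>0 \<sigma> x t l) (\<lambda>z. max 0 (u z - a x t l)) +
      average \<Lambda> (Hc \<gamma>0 (- \<sigma>) x t l) (\<lambda>z. max 0 (a x t l - u z)) \<le> ennreal A0"
    and u_meas [measurable]: "u \<in> borel_measurable \<Lambda>"
    using u unfolding PBMO_dir_def SUP_ennreal_finite_iff locally_integrable_def by blast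
  \<comment> \<open>Enlarged by 1 because the stopping argument divides by \<open>A\<close>.\<close>
  define A where "A = A0 + 1"
  have A: "0 < A" "0 \<le> A" "ennreal A0 \<le> ennreal A" using \<open>0 \<le> A0\<close> by (auto simp: A_def intro: ennreal_leI)
  have avg: "average \<Lambda> (Hc \<gamma>0 \<sigma> x t l) (\<lambda>z. max 0 (u z - a x t l)) \<le> ennreal A"
    "average \<Lambda> (Hc \<gamma>0 (- \<sigma>) x t l) (\<lambda>z. max 0 (a x t l - u z)) \<le> ennreal A" if "0 < l" for x t l
    using order_trans[OF A0[OF that, of x t] A(3)] by (auto intro: order_trans[rotated])
  obtain \<epsilon> B c where \<epsilon>: "0 < \<epsilon>" and B: "0 < B"
    and up: "\<And>x t l. 0 < l \<Longrightarrow> (\<integral>\<^sup>+z\<in>Hc \<gamma> \<sigma> x t l. ennreal (exp (\<epsilon> * max 0 (u z - c x t l))) \<partial>\<Lambda>) \<le>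
      ennreal (B * vol ((1 - \<gamma>) / 2) x l)"
    and lo: "\<And>x t l. 0 < l \<Longrightarrow> (\<integral>\<^sup>+z\<in>Hc \<gamma> (- \<sigma>) x t l. ennreal (exp (\<epsilon> * max 0 (c x t l - u z))) \<partial>\<Lambda>) \<le>
      ennreal (B * vol ((1 - \<gamma>) / 2) x l)"
  proof (rule john_nirenberg[OF geo \<sigma> \<gamma>0 \<gamma> u_meas A(1), of a])
    fix x t and l :: real assume l: "0 < l"
    show "(\<integral>\<^sup>+z\<in>Hc \<gamma>0 \<sigma> x t l. ennreal (max 0 (u z - a x t l)) \<partial>\<Lambda>) \<le> ennreal (A * vol ((1 - \<gamma>0) / 2) x l)"
      "(\<integral>\<^sup>+z\<in>Hc \<gamma>0 (- \<sigma>) x t l. ennreal (max 0 (a x t l - u z)) \<partial>\<Lambda>) \<le> ennreal (A * vol ((1 - \<gamma>0) / 2) x l)"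
      using avg[OF l] by (auto simp flip: average_le_iff[OF emeasure_Hc[OF l \<gamma>0(2)] vol_Hc_pos[OF l \<gamma>0(2)] A(2)])
  qed (rule that)
  \<comment> \<open>The dual exponent is \<open>-1 / (q - 1)\<close>, so both
    \<open>\<epsilon>'\<close> and \<open>\<epsilon>' / (q - 1)\<close> have to stay below
    \<open>\<epsilon>\<close>.\<close>
  define \<epsilon>' where "\<epsilon>' = \<epsilon> * min 1 (q - 1)"
  have \<epsilon>': "0 < \<epsilon>'" "\<epsilon>' \<le> \<epsilon>" "\<epsilon>' / (q - 1) \<le> \<epsilon>"
  proof -
    show "0 < \<epsilon>'" using \<epsilon> q by (simp add: \<epsilon>'_def)
    have "\<epsilon> * min 1 (q - 1) \<le> \<epsilon> * 1" "\<epsilon> * min 1 (q - 1) \<le> \<epsilon> * (q - 1)"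
      using \<epsilon> by (intro mult_left_mono; simp)+
    then show "\<epsilon>' \<le> \<epsilon>" "\<epsilon>' / (q - 1) \<le> \<epsilon>" using q by (simp_all add: \<epsilon>'_def divide_le_eq)
  qed
  define \<omega> where "\<omega> z = exp (- \<epsilon>' * u z)" for z
  have \<omega>_meas [measurable]: "\<omega> \<in> borel_measurable \<Lambda>" unfolding \<omega>_def by measurable
  have exp_le: "exp (e * v) \<le> exp (\<epsilon> * max 0 v)" if "0 \<le> e" "e \<le> \<epsilon>" for e v :: real
  proof -
    have "e * v \<le> e * max 0 v" using that by (intro mult_left_mono) auto
    also have "\<dots> \<le> \<epsilon> * max 0 v" using that by (intro mult_right_mono) auto
    finally show ?thesis by simp
  qed
  have avgN: "average \<Lambda> (Hc \<gamma> (- \<sigma>) x t l) \<omega> \<le> ennreal (exp (- \<epsilon>' * c x t l) * B)" if l: "0 < l" for x t l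
  proof (rule average_le_cmult[where g = "\<lambda>z. exp (\<epsilon> * max 0 (c x t l - u z))",
      OF _ Hc_sets[OF l] emeasure_Hc[OF l \<gamma>(2)] vol_Hc_pos[OF l \<gamma>(2)]])
    show "average \<Lambda> (Hc \<gamma> (- \<sigma>) x t l) (\<lambda>z. exp (\<epsilon> * max 0 (c x t l - u z))) \<le> ennreal B"
      using lo[OF l] average_le_iff[OF emeasure_Hc[OF l \<gamma>(2)] vol_Hc_pos[OF l \<gamma>(2)]] B by (simp add: less_imp_le)
    show "AE z in \<Lambda>. z \<in> Hc \<gamma> (- \<sigma>) x t l \<longrightarrow>
        \<omega> z \<le> exp (- \<epsilon>' * c x t l) * exp (\<epsilon> * max 0 (c x t l - u z))"
    proof (intro AE_I2 impI)
      fix z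
      have "\<omega> z = exp (- \<epsilon>' * c x t l) * exp (\<epsilon>' * (c x t l - u z))"
        by (simp add: \<omega>_def algebra_simps flip: exp_add)
      also have "\<dots> \<le> exp (- \<epsilon>' * c x t l) * exp (\<epsilon> * max 0 (c x t l - u z))"
        using \<epsilon>' by (intro mult_left_mono exp_le) auto
      finally show "\<omega> z \<le> exp (- \<epsilon>' * c x t l) * exp (\<epsilon> * max 0 (c x t l - u z))" .
    qed
  qed (use B in auto)
  have exponent: "1 - conj_exponent q = - 1 / (q - 1)"
    using q by (simp add: conj_exponent_def field_simps)
  have avgP: "average \<Lambda> (Hc \<gamma> \<sigma> x t l) (\<lambda>z. \<omega> z powr (1 - conj_exponent q)) \<le>
      ennreal (exp (\<epsilon>' / (q - 1) * c x t l) * B)" if l: "0 < l" for x t l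
  proof (rule average_le_cmult[where g = "\<lambda>z. exp (\<epsilon> * max 0 (u z - c x t l))",
      OF _ Hc_sets[OF l] emeasure_Hc[OF l \<gamma>(2)] vol_Hc_pos[OF l \<gamma>(2)]])
    show "average \<Lambda> (Hc \<gamma> \<sigma> x t l) (\<lambda>z. exp (\<epsilon> * max 0 (u z - c x t l))) \<le> ennreal B"
      using up[OF l] average_le_iff[OF emeasure_Hc[OF l \<gamma>(2)] vol_Hc_pos[OF l \<gamma>(2)]] B by (simp add: less_imp_le)
    show "AE z in \<Lambda>. z \<in> Hc \<gamma> \<sigma> x t l \<longrightarrow> \<omega> z powr (1 - conj_exponent q) \<le>
        exp (\<epsilon>' / (q - 1) * c x t l) * exp (\<epsilon> * max 0 (u z - c x t l))"
    proof (intro AE_I2 impI)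
      fix z
      have "\<omega> z powr (1 - conj_exponent q) = exp (\<epsilon>' / (q - 1) * u z)"
        unfolding exponent by (simp add: \<omega>_def powr_def)
      also have "\<dots> = exp (\<epsilon>' / (q - 1) * c x t l) * exp (\<epsilon>' / (q - 1) * (u z - c x t l))"
        by (simp add: algebra_simps diff_divide_distrib flip: exp_add)
      also have "\<dots> \<le> exp (\<epsilon>' / (q - 1) * c x t l) * exp (\<epsilon> * max 0 (u z - c x t l))"
        using \<epsilon>' q by (intro mult_left_mono exp_le) auto
      finally show "\<omega> z powr (1 - conj_exponent q) \<le>
        exp (\<epsilon>' / (q - 1) * c x t l) * exp (\<epsilon> * max 0 (u z - c x t l))" .
    qed
  qed (use B in auto)
  have "locally_integrable \<rho> \<mu> p \<omega>"
  proof (rule locally_integrable_if_unit_boxes[OF \<omega>_meas, of "(1 - \<gamma>) / 2"])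
    fix x t
    let ?t = "t - - \<sigma> * ((1 + \<gamma>) / 2)"
    have "(\<integral>\<^sup>+z\<in>Hc \<gamma> (- \<sigma>) x ?t 1. ennreal (\<omega> z) \<partial>\<Lambda>) \<le> ennreal (exp (- \<epsilon>' * c x ?t 1) * B * vol ((1 - \<gamma>) / 2) x 1)"
      using avgN[of 1 x ?t] average_le_iff[OF emeasure_Hc vol_Hc_pos, of 1 \<gamma>] \<gamma> B
      by (simp add: less_imp_le)
    then show "(\<integral>\<^sup>+z\<in>Q ((1 - \<gamma>) / 2) x t 1. ennreal \<bar>\<omega> z\<bar> \<partial>\<Lambda>) < \<infinity>"
      unfolding Hc_unit by (simp add: \<omega>_def le_less_trans)
  qed (use \<gamma> in auto)
  then have "weight \<rho> \<mu> p \<omega>" by (simp add: weight_def \<omega>_def)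
  moreover have "average \<Lambda> (Hc \<gamma> (- \<sigma>) x t l) \<omega> *
      ennreal_pow (average \<Lambda> (Hc \<gamma> \<sigma> x t l) (\<lambda>z. \<omega> z powr (1 - conj_exponent q))) (q - 1) \<le>
      ennreal (B * B powr (q - 1))" if l: "0 < l" for x t l
  proof -
    define v where "v = \<epsilon>' * c x t l"
    have "average \<Lambda> (Hc \<gamma> (- \<sigma>) x t l) \<omega> *
      ennreal_pow (average \<Lambda> (Hc \<gamma> \<sigma> x t l) (\<lambda>z. \<omega> z powr (1 - conj_exponent q))) (q - 1) \<le>
      ennreal (exp (- \<epsilon>' * c x t l) * B) * ennreal ((exp (\<epsilon>' / (q - 1) * c x t l) * B) powr (q - 1))"
      using q B by (intro mult_mono avgN[OF l] ennreal_pow_mono_le avgP[OF l]) auto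
    also have "(exp (\<epsilon>' / (q - 1) * c x t l) * B) powr (q - 1) = exp v * B powr (q - 1)"
      using q B by (simp add: powr_mult v_def) (simp add: powr_def)
    also have "ennreal (exp (- \<epsilon>' * c x t l) * B) * ennreal (exp v * B powr (q - 1)) =
        ennreal (exp (- v) * B * (exp v * B powr (q - 1)))"
      using B by (simp add: v_def flip: ennreal_mult)
    also have "exp (- v) * B * (exp v * B powr (q - 1)) = B * B powr (q - 1)"
      by (simp add: exp_minus field_simps)
    finally show ?thesis .
  qed
  ultimately have "\<omega> \<in> A_dir \<rho> \<mu> p q \<gamma> \<sigma>"
    using mult_nonneg_nonneg[OF less_imp_le[OF B] powr_ge_zero[of B "q - 1"]]
    unfolding A_dir_def SUP_ennreal_finite_iff by blast
  moreover have "u = (\<lambda>z. - (1 / \<epsilon>') * ln (\<omega> z))"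
    using \<epsilon>' by (simp add: \<omega>_def)
  ultimately show ?thesis using \<epsilon>'(1) by (intro exI[of _ \<omega>] exI[of _ "1 / \<epsilon>'"]) simp
qed

text \<open>A unit box is the \<open>\<sigma>\<close> half of one cylinder and the opposite half of
  another, so \<open>u\<close> is controlled in mean from above by the constant of the first and
  from below by that of the second.\<close>

lemma locally_integrable_if_averages:
  fixes u :: "'a \<times> real \<Rightarrow> real"
  assumes u [measurable]: "u \<in> borel_measurable \<Lambda>" and \<gamma>: "0 < \<gamma>" "\<gamma> < 1" and C: "0 \<le> C"
    and up: "\<And>x t. average \<Lambda> (Hc \<gamma> \<sigma> x t 1) (\<lambda>z. max 0 (u z - a x t)) \<le> ennreal C"
    and lo: "\<And>x t. average \<Lambda> (Hc \<gamma> (- \<sigma>) x t 1) (\<lambda>z. max 0 (a x t - u z)) \<le> ennreal C"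
  shows "locally_integrable \<rho> \<mu> p u"
proof (rule locally_integrable_if_unit_boxes[OF u, of "(1 - \<gamma>) / 2"])
  fix x t
  let ?H = "(1 - \<gamma>) / 2"
  let ?S = "Q ?H x t 1"
  define t1 where "t1 = t - \<sigma> * ((1 + \<gamma>) / 2)"
  define t2 where "t2 = t - - \<sigma> * ((1 + \<gamma>) / 2)"
  define k where "k = \<bar>a x t1\<bar> + \<bar>a x t2\<bar>"
  note iff = average_le_iff[OF emeasure_Q vol_pos C, of 1 ?H]
  have [measurable]: "?S \<in> sets \<Lambda>" by (rule Q_sets) simp
  have 1: "(\<integral>\<^sup>+z\<in>?S. ennreal (max 0 (u z - a x t1)) \<partial>\<Lambda>) \<le> ennreal (C * vol ?H x 1)"
    using up[of x t1] \<gamma> iff unfolding t1_def Hc_unit by simp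
  have 2: "(\<integral>\<^sup>+z\<in>?S. ennreal (max 0 (a x t2 - u z)) \<partial>\<Lambda>) \<le> ennreal (C * vol ?H x 1)"
    using lo[of x t2] \<gamma> iff unfolding t2_def Hc_unit by simp
  have "(\<integral>\<^sup>+z\<in>?S. ennreal \<bar>u z\<bar> \<partial>\<Lambda>) \<le> (\<integral>\<^sup>+z. ennreal (max 0 (u z - a x t1)) * indicator ?S z +
      (ennreal (max 0 (a x t2 - u z)) * indicator ?S z + ennreal k * indicator ?S z) \<partial>\<Lambda>)"
  proof (rule nn_integral_mono)
    fix z
    have "\<bar>u z\<bar> \<le> max 0 (u z - a x t1) + (max 0 (a x t2 - u z) + k)" by (auto simp: k_def)
    then have "ennreal \<bar>u z\<bar> \<le> ennreal (max 0 (u z - a x t1) + (max 0 (a x t2 - u z) + k))"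
      by (rule ennreal_leI)
    also have "\<dots> = ennreal (max 0 (u z - a x t1)) + (ennreal (max 0 (a x t2 - u z)) + ennreal k)"
      by (simp add: k_def)
    finally show "ennreal \<bar>u z\<bar> * indicator ?S z \<le> ennreal (max 0 (u z - a x t1)) * indicator ?S z +
      (ennreal (max 0 (a x t2 - u z)) * indicator ?S z + ennreal k * indicator ?S z)"
      by (auto split: split_indicator)
  qed
  also have "\<dots> = (\<integral>\<^sup>+z\<in>?S. ennreal (max 0 (u z - a x t1)) \<partial>\<Lambda>) +
      ((\<integral>\<^sup>+z\<in>?S. ennreal (max 0 (a x t2 - u z)) \<partial>\<Lambda>) + ennreal k * emeasure \<Lambda> ?S)"
    by (simp add: nn_integral_add nn_integral_cmult_indicator)
  also have "\<dots> < \<infinity>"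
    using 1 2 \<gamma> by (auto simp: emeasure_Q ennreal_mult_less_top intro: le_less_trans)
  finally show "(\<integral>\<^sup>+z\<in>?S. ennreal \<bar>u z\<bar> \<partial>\<Lambda>) < \<infinity>" .
qed (use \<gamma> in auto)

text \<open>With \<open>\<alpha>\<close> and \<open>\<beta>\<close> the means of the weight and of
  its negative power, and \<open>e = 1 / (q - 1)\<close>, the logarithm is estimated for
  \<open>\<omega> / \<alpha>\<close> on one half and for
  \<open>\<alpha> powr e * \<omega> powr (- e)\<close> on the other. The latter has mean
  \<open>(\<alpha> * \<beta> powr (q - 1)) powr e\<close>, which the \<open>A_q\<close> bound
  controls.\<close>

lemma PBMO_dir_if_A_dir:
  assumes \<gamma>: "0 < \<gamma>" "\<gamma> < 1" and q: "1 < q" and \<omega>: "\<omega> \<in> A_dir \<rho> \<mu> p q \<gamma> \<sigma>" and \<xi>: "0 < \<xi>"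
  shows "(\<lambda>z. - \<xi> * ln (\<omega> z)) \<in> PBMO_dir \<rho> \<mu> p \<sigma>"
proof -
  define f where "f z = \<omega> z powr (1 - conj_exponent q)" for z
  define avgN where "avgN x t l = average \<Lambda> (Hc \<gamma> (- \<sigma>) x t l) \<omega>" for x t l
  define avgP where "avgP x t l = average \<Lambda> (Hc \<gamma> \<sigma> x t l) f" for x t l
  define u where "u z = - \<xi> * ln (\<omega> z)" for z
  obtain B where "0 \<le> B" and B: "\<And>x t l. 0 < l \<Longrightarrow> avgN x t l * ennreal_pow (avgP x t l) (q - 1) \<le> ennreal B"
    and \<omega>_meas [measurable]: "\<omega> \<in> borel_measurable \<Lambda>" and pos: "AE z in \<Lambda>. 0 < \<omega> z"
    using \<omega> unfolding A_dir_def weight_def locally_integrable_def SUP_ennreal_finite_iff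
      avgN_def avgP_def f_def by blast
  have f_meas [measurable]: "f \<in> borel_measurable \<Lambda>" unfolding f_def by measurable
  have u_meas [measurable]: "u \<in> borel_measurable \<Lambda>" unfolding u_def by measurable
  have pos_f: "AE z in \<Lambda>. 0 < f z" using pos by eventually_elim (simp add: f_def)
  define C where "C = \<xi> + \<xi> * (q - 1) * B powr (1 / (q - 1))"
  \<comment> \<open>\<open>enn2real\<close> would send an infinite average to 0, but the averages
    prove to be finite and positive, so this is a genuine logarithm.\<close>
  define a where "a x t l = - \<xi> * ln (enn2real (avgN x t l))" for x t l
  have bound: "average \<Lambda> (Hc \<gamma> \<sigma> x t l) (\<lambda>z. max 0 (u z - a x t l)) \<le> ennreal (\<xi> * (q - 1) * B powr (1 / (q - 1)))"
    "average \<Lambda> (Hc \<gamma> (- \<sigma>) x t l) (\<lambda>z. max 0 (a x t l - u z)) \<le> ennreal \<xi>" if l: "0 < l" for x t l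
  proof -
    note Hc = Hc_sets[OF l] emeasure_Hc[OF l \<gamma>(2)] vol_Hc_pos[OF l \<gamma>(2)]
    have N_pos: "0 < avgN x t l" and P_pos: "0 < avgP x t l"
      unfolding avgN_def avgP_def using average_pos[OF _ Hc] pos pos_f by auto
    have pow_pos: "0 < ennreal_pow (avgP x t l) (q - 1)" by (rule ennreal_pow_pos[OF P_pos])
    have "avgN x t l \<noteq> \<infinity>"
      using B[OF l, of x t] pow_pos by (auto simp: ennreal_top_mult top_unique split: if_splits)
    then obtain \<alpha> where \<alpha>: "avgN x t l = ennreal \<alpha>" "0 < \<alpha>"
      using N_pos by (cases "avgN x t l") auto
    have "avgP x t l \<noteq> \<infinity>"
      using B[OF l, of x t] N_pos by (auto simp: ennreal_pow_def ennreal_mult_top top_unique split: if_splits)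
    then obtain \<beta> where \<beta>: "avgP x t l = ennreal \<beta>" "0 < \<beta>"
      using P_pos by (cases "avgP x t l") auto
    have "ennreal (\<alpha> * \<beta> powr (q - 1)) \<le> ennreal B"
      using B[OF l, of x t] \<alpha> \<beta> by (simp add: ennreal_pow_def ennreal_mult)
    then have \<alpha>\<beta>: "\<alpha> * \<beta> powr (q - 1) \<le> B" using \<open>0 \<le> B\<close> by (simp add: ennreal_le_iff)
    have a: "a x t l = - \<xi> * ln \<alpha>" using \<alpha> by (simp add: a_def)
    have "average \<Lambda> (Hc \<gamma> (- \<sigma>) x t l) (\<lambda>z. max 0 (a x t l - u z)) \<le> ennreal (\<xi> / \<alpha> * \<alpha>)"
    proof (rule average_le_cmult[OF \<omega>_meas Hc])
      show "AE z in \<Lambda>. z \<in> Hc \<gamma> (- \<sigma>) x t l \<longrightarrow> max 0 (a x t l - u z) \<le> \<xi> / \<alpha> * \<omega> z"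
        using pos
      proof eventually_elim
        case (elim z)
        have "a x t l - u z = \<xi> * ln (\<omega> z / \<alpha>)"
          using \<alpha> elim by (simp add: a u_def ln_div algebra_simps)
        also have "\<dots> \<le> \<xi> * (\<omega> z / \<alpha>)"
          using \<xi> \<alpha> elim by (intro mult_left_mono less_imp_le[OF ln_less_self]) auto
        finally show ?case using \<xi> \<alpha> elim by simp
      qed
    qed (use \<xi> \<alpha> in \<open>auto simp: avgN_def\<close>)
    then show "average \<Lambda> (Hc \<gamma> (- \<sigma>) x t l) (\<lambda>z. max 0 (a x t l - u z)) \<le> ennreal \<xi>"
      using \<alpha> by simp
    define e where "e = 1 / (q - 1)"
    have e: "0 < e" "(q - 1) * e = 1" using q by (auto simp: e_def)
    have f_eq: "f z = \<omega> z powr (- e)" for z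
    proof -
      have "1 - conj_exponent q = - e" using q by (simp add: e_def conj_exponent_def field_simps)
      then show ?thesis by (simp add: f_def)
    qed
    have "average \<Lambda> (Hc \<gamma> \<sigma> x t l) (\<lambda>z. max 0 (u z - a x t l)) \<le> ennreal (\<xi> * (q - 1) * \<alpha> powr e * \<beta>)"
    proof (rule average_le_cmult[OF f_meas Hc])
      show "AE z in \<Lambda>. z \<in> Hc \<gamma> \<sigma> x t l \<longrightarrow> max 0 (u z - a x t l) \<le> \<xi> * (q - 1) * \<alpha> powr e * f z"
        using pos
      proof eventually_elim
        case (elim z)
        have "ln (\<alpha> powr e * f z) = e * (ln \<alpha> - ln (\<omega> z))"
          using \<alpha> elim by (simp add: f_eq ln_mult ln_powr algebra_simps)
        then have "\<xi> * (q - 1) * ln (\<alpha> powr e * f z) = \<xi> * ((q - 1) * e) * (ln \<alpha> - ln (\<omega> z))"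
          by (simp only: mult.assoc)
        then have "u z - a x t l = \<xi> * (q - 1) * ln (\<alpha> powr e * f z)"
          unfolding e(2) by (simp add: a u_def algebra_simps)
        also have "\<dots> \<le> \<xi> * (q - 1) * (\<alpha> powr e * f z)"
          using \<xi> q \<alpha> elim by (intro mult_left_mono less_imp_le[OF ln_less_self]) (auto simp: f_eq)
        finally show ?case using \<xi> q \<alpha> elim by (simp add: f_eq mult.assoc)
      qed
    qed (use \<xi> q \<alpha> \<beta> in \<open>auto simp: avgP_def\<close>)
    also have "\<dots> \<le> ennreal (\<xi> * (q - 1) * B powr e)"
    proof (intro ennreal_leI)
      have "\<alpha> powr e * \<beta> = (\<alpha> * \<beta> powr (q - 1)) powr e"
        using \<alpha> \<beta> e by (simp add: powr_mult powr_powr)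
      also have "\<dots> \<le> B powr e" using \<alpha>\<beta> \<alpha> e by (intro powr_mono2) auto
      finally show "\<xi> * (q - 1) * \<alpha> powr e * \<beta> \<le> \<xi> * (q - 1) * B powr e"
        using \<xi> q by (simp add: mult.assoc)
    qed
    finally show "average \<Lambda> (Hc \<gamma> \<sigma> x t l) (\<lambda>z. max 0 (u z - a x t l)) \<le> ennreal (\<xi> * (q - 1) * B powr (1 / (q - 1)))"
      by (simp add: e_def)
  qed
  have C_ge: "0 \<le> C" "\<xi> \<le> C" "\<xi> * (q - 1) * B powr (1 / (q - 1)) \<le> C"
    using \<xi> q by (auto simp: C_def)
  \<comment> \<open>Derived from the one-sided averages at size 1 and not from local integrability
    of the weight, which says nothing about its logarithm near zero.\<close>
  have "locally_integrable \<rho> \<mu> p u"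
    by (rule locally_integrable_if_averages[OF u_meas \<gamma> C_ge(1), of \<sigma> "\<lambda>x t. a x t 1"])
      (use C_ge in \<open>auto intro!: order_trans[OF bound(1)] order_trans[OF bound(2)] ennreal_leI\<close>)
  moreover have "average \<Lambda> (Hc \<gamma> \<sigma> x t l) (\<lambda>z. max 0 (u z - a x t l)) +
      average \<Lambda> (Hc \<gamma> (- \<sigma>) x t l) (\<lambda>z. max 0 (a x t l - u z)) \<le> ennreal C" if l: "0 < l" for x t l
  proof -
    have "average \<Lambda> (Hc \<gamma> \<sigma> x t l) (\<lambda>z. max 0 (u z - a x t l)) +
      average \<Lambda> (Hc \<gamma> (- \<sigma>) x t l) (\<lambda>z. max 0 (a x t l - u z)) \<le>
      ennreal (\<xi> * (q - 1) * B powr (1 / (q - 1))) + ennreal \<xi>"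
      by (intro add_mono bound l)
    also have "\<dots> = ennreal C" using \<xi> q by (simp add: C_def add.commute flip: ennreal_plus)
    finally show ?thesis .
  qed
  ultimately have "u \<in> PBMO_dir \<rho> \<mu> p \<sigma>"
    using \<gamma> C_ge(1) unfolding PBMO_dir_def SUP_ennreal_finite_iff by blast
  then show ?thesis by (simp add: u_def[abs_def])
qed

lemma PBMO_dir_eq_log_A_dir:
  assumes "monotone_geodesic \<rho>" "\<bar>\<sigma>\<bar> = 1" "0 < \<gamma>" "\<gamma> < 1" "1 < q"
  shows "PBMO_dir \<rho> \<mu> p \<sigma> = {(\<lambda>z. - \<xi> * ln (\<omega> z)) | \<omega> \<xi>. \<omega> \<in> A_dir \<rho> \<mu> p q \<gamma> \<sigma> \<and> 0 < \<xi>}"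
  using A_dir_if_PBMO_dir[OF assms] PBMO_dir_if_A_dir[OF assms(3,4,5)] by blast

end

theorem theorem8p4:
  fixes \<rho> :: "'a \<Rightarrow> 'a \<Rightarrow> real" and \<mu> :: "'a measure" and p q \<gamma> :: real
  assumes "homogeneous_type \<rho> \<mu>"
    and "basic_assumptions \<rho> \<mu>"
    and "monotone_geodesic \<rho>"
    and "1 < p"
    and "basic_assumptions (parabolic_dist \<rho> p) (time_product \<mu>)"
    and "0 < \<gamma>" and "\<gamma> < 1"
    and "1 < q"
  shows "ae_class (time_product \<mu>) ` PBMO_plus \<rho> \<mu> p =
      {ae_class (time_product \<mu>) (\<lambda>z. - \<xi> * ln (\<omega> z)) | \<omega> \<xi>. \<omega> \<in> A_plus \<rho> \<mu> p q \<gamma> \<and> 0 < \<xi>}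
    \<and> ae_class (time_product \<mu>) ` PBMO_minus \<rho> \<mu> p =
      {ae_class (time_product \<mu>) (\<lambda>z. - \<xi> * ln (\<omega> z)) | \<omega> \<xi>. \<omega> \<in> A_minus \<rho> \<mu> p q \<gamma> \<and> 0 < \<xi>}"
proof -
  interpret homogeneous_type \<rho> \<mu> by fact
  interpret X: basic_assumptions \<rho> \<mu> by fact
  obtain K where K: "1 \<le> K" "\<And>x y z. \<rho> x y \<le> K * (\<rho> x z + \<rho> z y)"
    using quasi_triangle by blast
  obtain C :: real where C: "\<And>x r. 0 < r \<Longrightarrow>
      emeasure \<mu> (qball \<rho> x (2 * r)) \<le> ennreal C * emeasure \<mu> (qball \<rho> x r)"
    using doubling by blast
  \<comment> \<open>\<open>ennreal C\<close> is 0 for negative \<open>C\<close>, so the doubling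
    constant may be replaced by \<open>max 0 C\<close> before passing to real measures.\<close>
  have "measure \<mu> (qball \<rho> x (2 * r)) \<le> max 0 C * measure \<mu> (qball \<rho> x r)" if "0 < r" for x r
  proof -
    have "emeasure \<mu> (qball \<rho> x s) = ennreal (measure \<mu> (qball \<rho> x s))" if "0 < s" for s
      using X.ball_finite[OF that, of x] by (intro emeasure_eq_ennreal_measure) auto
    moreover have "emeasure \<mu> (qball \<rho> x (2 * r)) \<le> ennreal (max 0 C) * emeasure \<mu> (qball \<rho> x r)"
      using C[OF that, of x] by (rule order_trans) (intro mult_right_mono ennreal_leI; simp)
    ultimately have "ennreal (measure \<mu> (qball \<rho> x (2 * r))) \<le> ennreal (max 0 C * measure \<mu> (qball \<rho> x r))"
      using that by (simp add: ennreal_mult)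
    then show ?thesis by (simp add: ennreal_le_iff)
  qed
  then interpret parabolic_space \<rho> \<mu> p K "max 0 C"
    by (intro parabolic_space.intro K nonneg sym assms(4,5) X.ball_pos X.ball_finite
        ball_measurable space_eq) (simp_all add: eq_0_iff)
  \<comment> \<open>The sets of functions coincide, and images under \<open>ae_class\<close> carry
    this to classes.\<close>
  have "ae_class M ` {(\<lambda>z. - \<xi> * ln (\<omega> z)) | \<omega> \<xi>. \<omega> \<in> W \<and> 0 < \<xi>} =
      {ae_class M (\<lambda>z. - \<xi> * ln (\<omega> z)) | \<omega> \<xi>. \<omega> \<in> W \<and> 0 < \<xi>}" for M :: "('a \<times> real) measure" and W
    by blast
  then show ?thesis
    using PBMO_dir_eq_log_A_dir[of 1 \<gamma> q] PBMO_dir_eq_log_A_dir[of "-1" \<gamma> q] assms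
    by (simp add: PBMO_plus_eq PBMO_minus_eq A_plus_eq A_minus_eq)
qed

end
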